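(* Let $S$ be a semitopological semigroup, $X$ a compact $w$-admissible $S$-flow, and $f\in C(X)$. The following are equivalent: (i) $f\in\mathrm{Asp}_S(X)$. (ii) $(fS)\times X\to\mathbb{R}$, $(fs,x)\mapsto f(sx)$, is an Asplund $S$-duality. (iii) There exist a representation $(h,\alpha)$ of $(S,X)$ into an Asplund space $V$ with a weakly continuous antihomomorphism $h:S\to\Theta(V)$, and a vector $v\in V$, such that $f(x)=\langle v,\alpha(x)\rangle$ for every $x\in X$. (iv) There exist a Banach space $V$, an antihomomorphism $h:S\to\Theta(V)$ (no continuity assumptions on $h$), an equivariant weak$^*$ continuous map $\alpha:X\to B(V^* )$ such that $\alpha(X)$ is (weak$^*$, norm)-fragmented, and a vector $v\in V$ satisfying $f(x)=\langle v,\alpha(x)\rangle$ for every $x\in X$. If $(S,X)$ is jointly continuous, then "weakly continuous" in (iii) can be replaced by "strongly continuous".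
   Context: A semitopological semigroup is a semigroup with separately continuous multiplication. An $S$-flow is a topological space $X$ with a separately continuous left action $S\times X\to X$; identities of monoids act as identity transformations. "Compact" means compact Hausdorff; Banach spaces are real. $C(X)$ has the sup norm and the right $S$-action $(fs)(x)=f(sx)$; $fS=\{fs:s\in S\}$. A compact $S$-flow $X$ is $w$-admissible if for every $f\in C(X)$ the orbit map $S\to C(X)$, $s\mapsto fs$, is continuous for the weak topology of $C(X)$. Asplund set: a nonempty bounded subset $M$ of a Banach space $V$ such that for every countable $C\subset M$ the pseudometric space $(V^*,\rho_C)$ is separable, where $\rho_C(\xi,\eta)=\sup\{|\langle c,\xi\rangle-\langle c,\eta\rangle|:c\in C\}$. $f\in C(X)$ is $S$-Asplund ($f\in\mathrm{Asp}_S(X)$) if $fS$ is an Asplund set in $C(X)$. A duality is a separately continuous map $\langle\cdot,\cdot\rangle:Y\times X\to\mathbb{R}$; it is an $S$-duality if $S$ acts on $X$ from the left and on $Y$ from the right with $\langle ys,x\rangle=\langle y,sx\rangle$. A bounded duality with $X$ compact is Asplund if $\{\langle y,\cdot\rangle:y\in Y\}$ is an Asplund set in $C(X)$. In (ii), $fS$ has the topology of pointwise convergence on $X$. A Banach space is Asplund if each of its separable Banach subspaces has separable dual. $\Theta(V)=\{\sigma\in L(V,V):\|\sigma\|\le1\}$; $B(V^* )$ is the closed unit ball of $V^*$. An antihomomorphism $h$ satisfies $h(st)=h(t)h(s)$; it is weakly (strongly) continuous if continuous for the weak (strong) operator topology. $\alpha:X\to B(V^* )$ is equivariant if $\langle v,\alpha(sx)\rangle=\langle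 h(s)v,\alpha(x)\rangle$ for all $v,s,x$. A representation $(h,\alpha)$ of $(S,X)$ into $V$ consists of a weakly continuous antihomomorphism $h:S\to\Theta(V)$ and a weak$^*$ continuous equivariant $\alpha:X\to B(V^* )$. $K\subset V^*$ is (weak$^*$, norm)-fragmented if for every nonempty $A\subset K$ and $\varepsilon>0$ there is a weak$^*$ open $O$ with $O\cap A\ne\emptyset$ and $O\cap A$ of norm diameter at most $\varepsilon$. *)

theory Defs
  imports "HOL-Analysis.Analysis"
begin

section \<open>Initial topologies\<close>

text \<open>The coarsest topology on \<open>A\<close> making all maps \<open>g \<in> F\<close> (which should map \<open>A\<close> into
  the underlying set of \<open>T\<close>) continuous.\<close>

definition initial_topology :: "'a set \<Rightarrow> 'b topology \<Rightarrow> ('a \<Rightarrow> 'b) set \<Rightarrow> 'a topology" where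
  "initial_topology A T F =
     pullback_topology A (\<lambda>a. \<lambda>g\<in>F. g a) (product_topology (\<lambda>_. T) F)"

lemma topspace_initial_topology:
  assumes "\<And>g. g \<in> F \<Longrightarrow> g ` A \<subseteq> topspace T"
  shows "topspace (initial_topology A T F) = A"
  using assms by (fastforce simp: initial_topology_def topspace_pullback_topology)

lemma continuous_map_initial_topology:
  assumes "\<And>g. g \<in> F \<Longrightarrow> g ` A \<subseteq> topspace T"
  shows "continuous_map S (initial_topology A T F) k \<longleftrightarrow>
           k \<in> topspace S \<rightarrow> A \<and> (\<forall>g\<in>F. continuous_map S T (g \<circ> k))"
proof (intro iffI conjI ballI)
  assume k: "continuous_map S (initial_topology A T F) k"
  show "k \<in> topspace S \<rightarrow> A"
    using continuous_map_funspace[OF k] topspace_initial_topology[of F A T] assms by auto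
  fix g assume g: "g \<in> F"
  have "continuous_map (initial_topology A T F) T ((\<lambda>p. p g) \<circ> (\<lambda>a. \<lambda>g\<in>F. g a))"
    unfolding initial_topology_def
    by (intro continuous_map_pullback continuous_map_product_projection g)
  from continuous_map_compose[OF k this] show "continuous_map S T (g \<circ> k)"
    using g by (simp add: o_def)
next
  assume k: "k \<in> topspace S \<rightarrow> A \<and> (\<forall>g\<in>F. continuous_map S T (g \<circ> k))"
  then show "continuous_map S (initial_topology A T F) k"
    unfolding initial_topology_def
    by (intro continuous_map_pullback')
       (auto simp: continuous_map_componentwise o_def)
qed

section \<open>Banach spaces with explicit carrier and norm\<close>

text \<open>The theorem quantifies existentially over Banach spaces, which is impossible over types.
  A normed space is therefore a pair \<open>(V, N)\<close> of a linear subspace \<open>V\<close> of some ambient real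
  vector space type (whose own topology or norm, if any, plays no role) and a norm \<open>N\<close> on \<open>V\<close>.
  A type of class \<open>real_normed_vector\<close> corresponds to the pair \<open>(UNIV, norm)\<close>.\<close>

definition normed_on :: "'v::real_vector set \<Rightarrow> ('v \<Rightarrow> real) \<Rightarrow> bool" where
  "normed_on V N \<longleftrightarrow> subspace V \<and>
     (\<forall>x\<in>V. 0 \<le> N x \<and> (N x = 0 \<longleftrightarrow> x = 0)) \<and>
     (\<forall>x\<in>V. \<forall>y\<in>V. N (x + y) \<le> N x + N y) \<and>
     (\<forall>c. \<forall>x\<in>V. N (c *\<^sub>R x) = \<bar>c\<bar> * N x)"

text \<open>The value \<open>0\<close> off the carrier only serves the locale \<open>Metric_space\<close>, which requires
  nonnegativity and symmetry on the whole type.\<close>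

definition norm_dist :: "'v::real_vector set \<Rightarrow> ('v \<Rightarrow> real) \<Rightarrow> 'v \<Rightarrow> 'v \<Rightarrow> real" where
  "norm_dist V N x y = (if x \<in> V \<and> y \<in> V then N (x - y) else 0)"

definition norm_topology :: "'v::real_vector set \<Rightarrow> ('v \<Rightarrow> real) \<Rightarrow> 'v topology" where
  "norm_topology V N = Metric_space.mtopology V (norm_dist V N)"

definition banach_on :: "'v::real_vector set \<Rightarrow> ('v \<Rightarrow> real) \<Rightarrow> bool" where
  "banach_on V N \<longleftrightarrow> normed_on V N \<and> Metric_space.mcomplete V (norm_dist V N)"

text \<open>Bounded linear maps from \<open>(V, N)\<close> to \<open>(W, M)\<close>. They are normalized to vanish off \<open>V\<close>, so
  that equality of functions is equality of operators.\<close>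

definition bounded_ops ::
  "'v::real_vector set \<Rightarrow> ('v \<Rightarrow> real) \<Rightarrow> 'w::real_vector set \<Rightarrow> ('w \<Rightarrow> real) \<Rightarrow> ('v \<Rightarrow> 'w) set" where
  "bounded_ops V N W M = {\<sigma>.
     (\<forall>x\<in>V. \<sigma> x \<in> W) \<and>
     (\<forall>x\<in>V. \<forall>y\<in>V. \<sigma> (x + y) = \<sigma> x + \<sigma> y) \<and>
     (\<forall>c. \<forall>x\<in>V. \<sigma> (c *\<^sub>R x) = c *\<^sub>R \<sigma> x) \<and>
     (\<exists>K. \<forall>x\<in>V. M (\<sigma> x) \<le> K * N x) \<and>
     (\<forall>x. x \<notin> V \<longrightarrow> \<sigma> x = 0)}"

definition op_norm :: "'v::real_vector set \<Rightarrow> ('v \<Rightarrow> real) \<Rightarrow> ('w \<Rightarrow> real) \<Rightarrow> ('v \<Rightarrow> 'w) \<Rightarrow> real" where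
  "op_norm V N M \<sigma> = (SUP x\<in>{x\<in>V. N x \<le> 1}. M (\<sigma> x))"

definition dual :: "'v::real_vector set \<Rightarrow> ('v \<Rightarrow> real) \<Rightarrow> ('v \<Rightarrow> real) set" where
  "dual V N = bounded_ops V N UNIV abs"

definition dual_norm :: "'v::real_vector set \<Rightarrow> ('v \<Rightarrow> real) \<Rightarrow> ('v \<Rightarrow> real) \<Rightarrow> real" where
  "dual_norm V N \<phi> = op_norm V N abs \<phi>"

definition dual_dist :: "'v::real_vector set \<Rightarrow> ('v \<Rightarrow> real) \<Rightarrow> ('v \<Rightarrow> real) \<Rightarrow> ('v \<Rightarrow> real) \<Rightarrow> real" where
  "dual_dist V N \<xi> \<eta> = dual_norm V N (\<lambda>x. \<xi> x - \<eta> x)"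

definition dual_ball :: "'v::real_vector set \<Rightarrow> ('v \<Rightarrow> real) \<Rightarrow> ('v \<Rightarrow> real) set" where
  "dual_ball V N = {\<phi> \<in> dual V N. dual_norm V N \<phi> \<le> 1}"

text \<open>\<open>\<Theta>(V)\<close>\<close>

definition contractions :: "'v::real_vector set \<Rightarrow> ('v \<Rightarrow> real) \<Rightarrow> ('v \<Rightarrow> 'v) set" where
  "contractions V N = {\<sigma> \<in> bounded_ops V N V N. op_norm V N N \<sigma> \<le> 1}"

definition weak_topology :: "'v::real_vector set \<Rightarrow> ('v \<Rightarrow> real) \<Rightarrow> 'v topology" where
  "weak_topology V N = initial_topology V euclideanreal (dual V N)"

definition weak_star_topology :: "'v::real_vector set \<Rightarrow> ('v \<Rightarrow> real) \<Rightarrow> ('v \<Rightarrow> real) topology" where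
  "weak_star_topology V N = initial_topology (dual V N) euclideanreal {(\<lambda>\<phi>. \<phi> v) |v. v \<in> V}"

definition weak_operator_topology :: "'v::real_vector set \<Rightarrow> ('v \<Rightarrow> real) \<Rightarrow> ('v \<Rightarrow> 'v) topology" where
  "weak_operator_topology V N =
     initial_topology (bounded_ops V N V N) (weak_topology V N) {(\<lambda>\<sigma>. \<sigma> v) |v. v \<in> V}"

definition strong_operator_topology :: "'v::real_vector set \<Rightarrow> ('v \<Rightarrow> real) \<Rightarrow> ('v \<Rightarrow> 'v) topology" where
  "strong_operator_topology V N =
     initial_topology (bounded_ops V N V N) (norm_topology V N) {(\<lambda>\<sigma>. \<sigma> v) |v. v \<in> V}"

lemma Metric_space_norm_dist:
  assumes "normed_on V N"
  shows "Metric_space V (norm_dist V N)"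
proof
  have V: "subspace V" and N0: "\<And>x. x \<in> V \<Longrightarrow> 0 \<le> N x \<and> (N x = 0 \<longleftrightarrow> x = 0)"
    and tri: "\<And>x y. x \<in> V \<Longrightarrow> y \<in> V \<Longrightarrow> N (x + y) \<le> N x + N y"
    and sc: "\<And>c x. x \<in> V \<Longrightarrow> N (c *\<^sub>R x) = \<bar>c\<bar> * N x"
    using assms by (auto simp: normed_on_def)
  fix x y z :: 'a
  show "0 \<le> norm_dist V N x y"
    using N0 V by (auto simp: norm_dist_def subspace_diff)
  show "norm_dist V N x y = norm_dist V N y x"
    using sc[of "y - x" "-1"] V by (auto simp: norm_dist_def subspace_diff)
  show "norm_dist V N x y = 0 \<longleftrightarrow> x = y" if "x \<in> V" "y \<in> V"
    using that N0[of "x - y"] V by (auto simp: norm_dist_def subspace_diff)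
  show "norm_dist V N x z \<le> norm_dist V N x y + norm_dist V N y z"
    if "x \<in> V" "y \<in> V" "z \<in> V"
    using that tri[of "x - y" "y - z"] V by (auto simp: norm_dist_def subspace_diff)
qed

lemma dual_UNIV: "dual UNIV norm = {\<phi> :: 'v::real_normed_vector \<Rightarrow> real. bounded_linear \<phi>}"
  by (auto simp: dual_def bounded_ops_def bounded_linear_def bounded_linear_axioms_def
      linear_iff mult.commute)

lemma banach_on_UNIV: "banach_on (UNIV :: 'v::banach set) norm"
proof -
  have "normed_on (UNIV :: 'v set) norm"
    by (auto simp: normed_on_def norm_triangle_ineq)
  moreover have "norm_dist (UNIV :: 'v set) norm = dist"
    by (auto simp: norm_dist_def dist_norm fun_eq_iff)
  ultimately show ?thesis
    by (simp add: banach_on_def complete_UNIV)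
qed

section \<open>Asplund sets, Asplund spaces, fragmentability\<close>

text \<open>Separability of \<open>M\<close> for a pseudometric \<open>d\<close>.\<close>

definition separable_for :: "'a set \<Rightarrow> ('a \<Rightarrow> 'a \<Rightarrow> real) \<Rightarrow> bool" where
  "separable_for M d \<longleftrightarrow>
     (\<exists>D. countable D \<and> D \<subseteq> M \<and> (\<forall>x\<in>M. \<forall>\<epsilon>>0. \<exists>y\<in>D. d x y < \<epsilon>))"

text \<open>\<open>C = {}\<close> is excluded because its pseudometric is \<open>0\<close> by convention, whereas the supremum of
  the empty set of reals is unspecified here.\<close>

definition asplund_set :: "'v::real_vector set \<Rightarrow> ('v \<Rightarrow> real) \<Rightarrow> 'v set \<Rightarrow> bool" where
  "asplund_set V N M \<longleftrightarrow> M \<subseteq> V \<and> M \<noteq> {} \<and> (\<exists>K. \<forall>m\<in>M. N m \<le> K) \<and>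
     (\<forall>C. C \<subseteq> M \<and> countable C \<and> C \<noteq> {} \<longrightarrow>
        separable_for (dual V N) (\<lambda>\<xi> \<eta>. SUP c\<in>C. \<bar>\<xi> c - \<eta> c\<bar>))"

definition asplund_space :: "'v::real_vector set \<Rightarrow> ('v \<Rightarrow> real) \<Rightarrow> bool" where
  "asplund_space V N \<longleftrightarrow> banach_on V N \<and>
     (\<forall>W. W \<subseteq> V \<and> banach_on W N \<and> separable_for W (norm_dist W N) \<longrightarrow>
        separable_for (dual W N) (dual_dist W N))"

definition fragmented :: "'v::real_vector set \<Rightarrow> ('v \<Rightarrow> real) \<Rightarrow> ('v \<Rightarrow> real) set \<Rightarrow> bool" where
  "fragmented V N K \<longleftrightarrow>
     (\<forall>A \<epsilon>. A \<subseteq> K \<and> A \<noteq> {} \<and> 0 < \<epsilon> \<longrightarrow>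
        (\<exists>U. openin (weak_star_topology V N) U \<and> U \<inter> A \<noteq> {} \<and>
             (\<forall>\<xi>\<in>U \<inter> A. \<forall>\<eta>\<in>U \<inter> A. dual_dist V N \<xi> \<eta> \<le> \<epsilon>)))"

section \<open>Flows and dualities\<close>

definition semitopological :: "'s::{semigroup_mult,topological_space} itself \<Rightarrow> bool" where
  "semitopological _ \<longleftrightarrow>
     (\<forall>s::'s. continuous_on UNIV (\<lambda>t. s * t)) \<and> (\<forall>t::'s. continuous_on UNIV (\<lambda>s. s * t))"

definition is_identity :: "'s::semigroup_mult \<Rightarrow> bool" where
  "is_identity e \<longleftrightarrow> (\<forall>s. e * s = s \<and> s * e = s)"

definition left_action :: "'x set \<Rightarrow> ('s::semigroup_mult \<Rightarrow> 'x \<Rightarrow> 'x) \<Rightarrow> bool" where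
  "left_action X act \<longleftrightarrow>
     (\<forall>s. \<forall>x\<in>X. act s x \<in> X) \<and>
     (\<forall>s t. \<forall>x\<in>X. act (s * t) x = act s (act t x)) \<and>
     (\<forall>e. is_identity e \<longrightarrow> (\<forall>x\<in>X. act e x = x))"

definition right_action :: "'y set \<Rightarrow> ('y \<Rightarrow> 's::semigroup_mult \<Rightarrow> 'y) \<Rightarrow> bool" where
  "right_action Y ract \<longleftrightarrow>
     (\<forall>s. \<forall>y\<in>Y. ract y s \<in> Y) \<and>
     (\<forall>s t. \<forall>y\<in>Y. ract y (s * t) = ract (ract y s) t) \<and>
     (\<forall>e. is_identity e \<longrightarrow> (\<forall>y\<in>Y. ract y e = y))"

definition flow ::
  "('s::{semigroup_mult,topological_space} \<Rightarrow> 'x::topological_space \<Rightarrow> 'x) \<Rightarrow> bool" where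
  "flow act \<longleftrightarrow> left_action UNIV act \<and>
     (\<forall>s. continuous_on UNIV (act s)) \<and> (\<forall>x. continuous_on UNIV (\<lambda>s. act s x))"

definition jointly_continuous ::
  "('s::topological_space \<Rightarrow> 'x::topological_space \<Rightarrow> 'x) \<Rightarrow> bool" where
  "jointly_continuous act \<longleftrightarrow> continuous_on UNIV (\<lambda>(s, x). act s x)"

text \<open>For compact \<open>X\<close>, given by the type \<open>'x\<close>, the type \<open>'x \<Rightarrow>\<^sub>C real\<close> of bounded continuous
  functions with its norm is \<open>C(X)\<close>.\<close>

definition translate :: "('s \<Rightarrow> 'x \<Rightarrow> 'x) \<Rightarrow> ('x::topological_space \<Rightarrow>\<^sub>C real) \<Rightarrow> 's \<Rightarrow> ('x \<Rightarrow>\<^sub>C real)" where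
  "translate act f s = Bcontfun (\<lambda>x. f (act s x))"

lemma apply_translate:
  assumes "continuous_on UNIV (act s)"
  shows "apply_bcontfun (translate act f s) x = f (act s x)"
proof -
  have "continuous_on UNIV (\<lambda>x. apply_bcontfun f (act s x))"
    by (rule continuous_on_compose2[OF _ assms, of UNIV]) auto
  moreover have "bounded (range (\<lambda>x. apply_bcontfun f (act s x)))"
    by (rule bounded_subset[OF bounded_apply_bcontfun[of f]]) auto
  ultimately show ?thesis
    by (simp add: translate_def Bcontfun_inverse bcontfun_def)
qed

definition orbit :: "('s \<Rightarrow> 'x \<Rightarrow> 'x) \<Rightarrow> ('x::topological_space \<Rightarrow>\<^sub>C real) \<Rightarrow> ('x \<Rightarrow>\<^sub>C real) set" where
  "orbit act f = range (translate act f)"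

definition w_admissible :: "('s::topological_space \<Rightarrow> 'x \<Rightarrow> 'x::topological_space) \<Rightarrow> bool" where
  "w_admissible act \<longleftrightarrow>
     (\<forall>f :: 'x \<Rightarrow>\<^sub>C real. continuous_map euclidean (weak_topology UNIV norm) (translate act f))"

definition Asp :: "('s \<Rightarrow> 'x \<Rightarrow> 'x) \<Rightarrow> ('x::topological_space \<Rightarrow>\<^sub>C real) set" where
  "Asp act = {f. asplund_set UNIV norm (orbit act f)}"

definition duality :: "'y topology \<Rightarrow> ('y \<Rightarrow> 'x::topological_space \<Rightarrow> real) \<Rightarrow> bool" where
  "duality Y b \<longleftrightarrow> (\<forall>y\<in>topspace Y. continuous_on UNIV (b y)) \<and>
     (\<forall>x. continuous_map Y euclideanreal (\<lambda>y. b y x))"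

definition S_duality ::
  "('s::semigroup_mult \<Rightarrow> 'x \<Rightarrow> 'x) \<Rightarrow> ('y \<Rightarrow> 's \<Rightarrow> 'y) \<Rightarrow> 'y topology
     \<Rightarrow> ('y \<Rightarrow> 'x::topological_space \<Rightarrow> real) \<Rightarrow> bool" where
  "S_duality act ract Y b \<longleftrightarrow> duality Y b \<and>
     left_action UNIV act \<and> right_action (topspace Y) ract \<and>
     (\<forall>y\<in>topspace Y. \<forall>s x. b (ract y s) x = b y (act s x))"

definition asplund_duality :: "'y topology \<Rightarrow> ('y \<Rightarrow> 'x::topological_space \<Rightarrow> real) \<Rightarrow> bool" where
  "asplund_duality Y b \<longleftrightarrow> duality Y b \<and>
     (\<exists>K. \<forall>y\<in>topspace Y. \<forall>x. \<bar>b y x\<bar> \<le> K) \<and>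
     asplund_set UNIV norm ((\<lambda>y. Bcontfun (b y)) ` topspace Y)"

text \<open>\<open>fS\<close> with the topology of pointwise convergence on \<open>X\<close>. The pairing
  \<open>(fs, x) \<mapsto> f(sx)\<close> on it is evaluation, \<open>f(sx) = (fs)(x)\<close>.\<close>

definition orbit_topology ::
  "('s \<Rightarrow> 'x \<Rightarrow> 'x) \<Rightarrow> ('x::topological_space \<Rightarrow>\<^sub>C real) \<Rightarrow> ('x \<Rightarrow>\<^sub>C real) topology" where
  "orbit_topology act f =
     initial_topology (orbit act f) euclideanreal (range (\<lambda>x y. apply_bcontfun y x))"

definition orbit_asplund_duality ::
  "('s::semigroup_mult \<Rightarrow> 'x \<Rightarrow> 'x) \<Rightarrow> ('x::topological_space \<Rightarrow>\<^sub>C real) \<Rightarrow> bool" where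
  "orbit_asplund_duality act f \<longleftrightarrow>
     S_duality act (translate act) (orbit_topology act f) apply_bcontfun \<and>
     asplund_duality (orbit_topology act f) apply_bcontfun"

section \<open>Representations on Banach spaces\<close>

definition antihomomorphism ::
  "'v::real_vector set \<Rightarrow> ('v \<Rightarrow> real) \<Rightarrow> ('s::semigroup_mult \<Rightarrow> 'v \<Rightarrow> 'v) \<Rightarrow> bool" where
  "antihomomorphism V N h \<longleftrightarrow> (\<forall>s. h s \<in> contractions V N) \<and> (\<forall>s t. h (s * t) = h t \<circ> h s)"

definition weakly_continuous ::
  "'v::real_vector set \<Rightarrow> ('v \<Rightarrow> real) \<Rightarrow> ('s::topological_space \<Rightarrow> 'v \<Rightarrow> 'v) \<Rightarrow> bool" where
  "weakly_continuous V N h \<longleftrightarrow> continuous_map euclidean (weak_operator_topology V N) h"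

definition strongly_continuous ::
  "'v::real_vector set \<Rightarrow> ('v \<Rightarrow> real) \<Rightarrow> ('s::topological_space \<Rightarrow> 'v \<Rightarrow> 'v) \<Rightarrow> bool" where
  "strongly_continuous V N h \<longleftrightarrow> continuous_map euclidean (strong_operator_topology V N) h"

definition weak_star_continuous ::
  "'v::real_vector set \<Rightarrow> ('v \<Rightarrow> real) \<Rightarrow> ('x::topological_space \<Rightarrow> 'v \<Rightarrow> real) \<Rightarrow> bool" where
  "weak_star_continuous V N \<alpha> \<longleftrightarrow> range \<alpha> \<subseteq> dual_ball V N \<and>
     continuous_map euclidean (weak_star_topology V N) \<alpha>"

definition equivariant ::
  "('s \<Rightarrow> 'x \<Rightarrow> 'x) \<Rightarrow> 'v set \<Rightarrow> ('s \<Rightarrow> 'v \<Rightarrow> 'v) \<Rightarrow> ('x \<Rightarrow> 'v \<Rightarrow> real) \<Rightarrow> bool" where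
  "equivariant act V h \<alpha> \<longleftrightarrow> (\<forall>v\<in>V. \<forall>s x. \<alpha> (act s x) v = \<alpha> x (h s v))"

definition representation ::
  "('s::{semigroup_mult,topological_space} \<Rightarrow> 'x::topological_space \<Rightarrow> 'x)
     \<Rightarrow> 'v::real_vector set \<Rightarrow> ('v \<Rightarrow> real) \<Rightarrow> ('s \<Rightarrow> 'v \<Rightarrow> 'v) \<Rightarrow> ('x \<Rightarrow> 'v \<Rightarrow> real) \<Rightarrow> bool" where
  "representation act V N h \<alpha> \<longleftrightarrow>
     antihomomorphism V N h \<and> weakly_continuous V N h \<and>
     weak_star_continuous V N \<alpha> \<and> equivariant act V h \<alpha>"

text \<open>The three conditions below speak about Banach spaces whose vectors are taken from the
  given type \<open>'v\<close>.\<close>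

definition asplund_representable ::
  "'v::real_vector itself \<Rightarrow> ('s::{semigroup_mult,topological_space} \<Rightarrow> 'x \<Rightarrow> 'x)
     \<Rightarrow> ('x::topological_space \<Rightarrow>\<^sub>C real) \<Rightarrow> bool" where
  "asplund_representable _ act f \<longleftrightarrow>
     (\<exists>(V :: 'v set) N h \<alpha>. asplund_space V N \<and> representation act V N h \<alpha> \<and>
        (\<exists>v\<in>V. \<forall>x. f x = \<alpha> x v))"

definition strongly_asplund_representable ::
  "'v::real_vector itself \<Rightarrow> ('s::{semigroup_mult,topological_space} \<Rightarrow> 'x \<Rightarrow> 'x)
     \<Rightarrow> ('x::topological_space \<Rightarrow>\<^sub>C real) \<Rightarrow> bool" where
  "strongly_asplund_representable _ act f \<longleftrightarrow>
     (\<exists>(V :: 'v set) N h \<alpha>. asplund_space V N \<and>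
        antihomomorphism V N h \<and> strongly_continuous V N h \<and>
        weak_star_continuous V N \<alpha> \<and> equivariant act V h \<alpha> \<and>
        (\<exists>v\<in>V. \<forall>x. f x = \<alpha> x v))"

definition fragmented_representable ::
  "'v::real_vector itself \<Rightarrow> ('s::semigroup_mult \<Rightarrow> 'x \<Rightarrow> 'x)
     \<Rightarrow> ('x::topological_space \<Rightarrow>\<^sub>C real) \<Rightarrow> bool" where
  "fragmented_representable _ act f \<longleftrightarrow>
     (\<exists>(V :: 'v set) N h \<alpha>. banach_on V N \<and> antihomomorphism V N h \<and>
        weak_star_continuous V N \<alpha> \<and> equivariant act V h \<alpha> \<and>
        fragmented V N (range \<alpha>) \<and> (\<exists>v\<in>V. \<forall>x. f x = \<alpha> x v))"

end

theory Submission
  imports Defs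
begin

text \<open>If \<open>f(x) = \<langle>v, \<alpha>(x)\<rangle>\<close>, then \<open>f S\<close> is the image of a bounded set under the operator \<open>w \<mapsto> \<langle>w, \<alpha>(\<cdot>)\<rangle>\<close>,
  so the Asplund property passes to \<open>f S\<close>: directly for an Asplund space, and for fragmented \<open>\<alpha>(X)\<close>
  because \<open>X\<close> is then separable for every \<open>\<rho>\<^sub>C\<close>, and separability of \<open>(X, \<rho>\<^sub>C)\<close> implies that of
  \<open>(C(X)\<^sup>*, \<rho>\<^sub>C)\<close>. The last implication replaces the Riesz representation by the countable additivity of
  the variation of a functional, which follows from Dini's theorem.

  Conversely, if \<open>M = f S \<union> {f}\<close> is an Asplund set, let \<open>W\<close> be its symmetric convex hull and let \<open>N\<^sub>n v\<close> be
  the infimum of \<open>2\<^sup>-\<^sup>n r + 2\<^sup>n \<parallel>v - r w\<parallel>\<close> over \<open>r \<ge> 0\<close> and \<open>w \<in> W\<close>. The space \<open>V\<close> of all \<open>v \<in> C(X)\<close>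
  with \<open>N\<^sub>n v \<longrightarrow> 0\<close>, normed by \<open>sup\<^sub>n N\<^sub>n v\<close>, is complete, contains \<open>f\<close> and is invariant under translations.
  By a gliding hump argument the restrictions of \<open>C(X)\<^sup>*\<close> are norm dense in \<open>V\<^sup>*\<close> and in the duals of its
  subspaces. Since the unit ball of \<open>V\<close> lies close to multiples of \<open>W\<close>, this gives separable duals, the
  weak continuity of the translations, and fragmentability of the point evaluations.\<close>

section \<open>Linear functionals below a sublinear functional\<close>

text \<open>\<open>S\<close> may lack an identity, so \<open>f\<close> need not belong to
  \<open>f S\<close>; adjoining it keeps the set Asplund and invariant under translations and puts
  \<open>f\<close> itself into \<open>V\<close>. The Asplund property speaks of countable subsets of
  \<open>M\<close>, fragmentability of all of \<open>M\<close> at once. The passage is a Cantor tree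
  argument: if every relevant piece oscillates too much, countably many functions already separate
  uncountably many points. It carries the gliding hump and the strong continuity. The gliding hump
  in turn reduces every question about the dual of \<open>V\<close> to functionals on
  \<open>C(X)\<close>, to which the Asplund property of \<open>M\<close> applies. A vector of the
  unit ball of \<open>V\<close> is, for every \<open>n\<close>, a multiple of order
  \<open>2 ^ n\<close> of an element of \<open>W\<close> plus a remainder of ambient norm of order
  \<open>1 / 2 ^ n\<close>. Hence \<open>n\<close> is always fixed before the tolerance on
  \<open>M\<close>, which has to absorb the factor \<open>2 ^ n\<close>.\<close>

definition sublinear :: "('a::real_vector \<Rightarrow> real) \<Rightarrow> bool" where
  "sublinear p \<longleftrightarrow> (\<forall>x y. p (x + y) \<le> p x + p y) \<and> (\<forall>t x. 0 \<le> t \<longrightarrow> p (t *\<^sub>R x) = t * p x)"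

lemma sublinear_add: "sublinear p \<Longrightarrow> p (x + y) \<le> p x + p y"
  and sublinear_scale: "sublinear p \<Longrightarrow> 0 \<le> t \<Longrightarrow> p (t *\<^sub>R x) = t * p x"
  by (auto simp: sublinear_def)

lemma sublinear_zero: "sublinear p \<Longrightarrow> p 0 = 0"
  using sublinear_scale[of p 0 0] by simp

lemma sublinear_minus_le: "sublinear p \<Longrightarrow> - p (- x) \<le> p x"
  using sublinear_add[of p x "- x"] sublinear_zero[of p] by simp

text \<open>Zorn's lemma for the reversed pointwise order. The infimum over a chain stays finite
  because every sublinear \<open>q\<close> below \<open>p\<close> satisfies
  \<open>- p (- x) \<le> q x\<close>, and it is subadditive because two members of a chain can be
  replaced by the smaller one.\<close>

lemma sublinear_minimal_exists:
  assumes "sublinear (p :: 'a::real_vector \<Rightarrow> real)"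
  obtains m where "sublinear m" "\<And>x. m x \<le> p x"
    "\<And>q. sublinear q \<Longrightarrow> (\<And>x. q x \<le> m x) \<Longrightarrow> q = m"
proof -
  let ?A = "{q. sublinear q \<and> (\<forall>x. q x \<le> p x)}"
  let ?P = "\<lambda>a b :: 'a \<Rightarrow> real. \<forall>x. b x \<le> a x"
  have "\<exists>m\<in>?A. \<forall>a\<in>?A. ?P m a \<longrightarrow> a = m"
  proof (rule predicate_Zorn)
    show "partial_order_on ?A (relation_of ?P ?A)"
      by (rule partial_order_on_relation_ofI) (auto intro: order.trans simp: fun_eq_iff order.antisym)
    fix C assume C: "C \<in> Chains (relation_of ?P ?A)"
    have CA: "C \<subseteq> ?A" and tot: "\<And>a b. a \<in> C \<Longrightarrow> b \<in> C \<Longrightarrow> ?P a b \<or> ?P b a"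
      using C by (auto simp: Chains_def relation_of_def)
    show "\<exists>u\<in>?A. \<forall>a\<in>C. ?P a u"
    proof (cases "C = {}")
      case True
      with assms show ?thesis by (intro bexI[of _ p]) simp_all
    next
      case False
      define u where "u x = (INF q\<in>C. q x)" for x
      have lo: "- p (- x) \<le> q x" if "q \<in> C" for q x
      proof -
        have "sublinear q" "q (- x) \<le> p (- x)" using that CA by auto
        then show ?thesis using sublinear_minus_le[of q x] by linarith
      qed
      have bdd: "bdd_below ((\<lambda>q. q x) ` C)" for x
        using lo by (auto intro!: bdd_belowI2[of _ "- p (- x)"])
      have ule: "u x \<le> q x" if "q \<in> C" for q x
        unfolding u_def using bdd that by (intro cINF_lower)
      have uge: "l \<le> u x" if "\<And>q. q \<in> C \<Longrightarrow> l \<le> q x" for l x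
        unfolding u_def using False that by (intro cINF_greatest)
      have "u (x + y) \<le> u x + u y" for x y
      proof -
        have *: "u (x + y) \<le> q x + r y" if qr: "q \<in> C" "r \<in> C" for q r
        proof -
          obtain k where "k \<in> C" "k x \<le> q x" "k y \<le> r y"
            using tot[OF qr] qr by blast
          moreover have "k (x + y) \<le> k x + k y"
            using \<open>k \<in> C\<close> CA by (auto intro: sublinear_add)
          ultimately show ?thesis using ule[of k "x + y"] by linarith
        qed
        have "u (x + y) - r y \<le> u x" if "r \<in> C" for r
          using *[OF _ that] by (intro uge) (simp add: algebra_simps)
        then have "u (x + y) - u x \<le> u y"
          by (intro uge) (simp add: algebra_simps)
        then show ?thesis by simp
      qed
      moreover have "u (t *\<^sub>R x) = t * u x" if t: "0 \<le> t" for t x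
      proof (cases "t = 0")
        case True
        have "\<And>q. q \<in> C \<Longrightarrow> q 0 = 0" using CA sublinear_zero by auto
        then have "(\<lambda>q. q 0) ` C = {0}" using False by force
        then show ?thesis using True by (simp add: u_def)
      next
        case False
        with t have t: "0 < t" by simp
        have sc: "\<And>q x. q \<in> C \<Longrightarrow> q (t *\<^sub>R x) = t * q x"
          using CA t by (auto simp: sublinear_scale)
        have "u (t *\<^sub>R x) / t \<le> u x"
          using t ule[of _ "t *\<^sub>R x"] by (intro uge) (simp add: sc field_simps)
        moreover have "t * u x \<le> u (t *\<^sub>R x)"
          using t by (intro uge) (simp add: sc ule)
        ultimately show ?thesis using t by (simp add: field_simps)
      qed
      ultimately have "sublinear u" by (simp add: sublinear_def)
      moreover have "\<forall>x. u x \<le> p x"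
      proof
        fix x
        obtain q where "q \<in> C" using False by blast
        with CA have "q x \<le> p x" by auto
        with ule[OF \<open>q \<in> C\<close>, of x] show "u x \<le> p x" by linarith
      qed
      ultimately show ?thesis using ule by (intro bexI[of _ u]) simp_all
    qed
  qed
  then obtain m where "m \<in> ?A" and min: "\<And>a. a \<in> ?A \<Longrightarrow> ?P m a \<Longrightarrow> a = m" by blast
  then have m: "sublinear m" and mp: "m x \<le> p x" for x by auto
  show thesis
  proof (rule that[OF m mp])
    fix q :: "'a \<Rightarrow> real" assume q: "sublinear q" "\<And>x. q x \<le> m x"
    have "q x \<le> p x" for x using q(2)[of x] mp[of x] by linarith
    then show "q = m" using q by (intro min) simp_all
  qed
qed

text \<open>A minimal sublinear functional \<open>m\<close> is linear because \<open>x \<mapsto> inf\<^sub>t (m (x + t a) - t m a)\<close>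
  is a sublinear functional below it.\<close>

lemma sublinear_dominates_linear:
  assumes "sublinear (p :: 'a::real_vector \<Rightarrow> real)"
  obtains l where "linear l" "\<And>x. l x \<le> p x"
proof -
  obtain m where m: "sublinear m" and mp: "\<And>x. m x \<le> p x"
    and min: "\<And>q. sublinear q \<Longrightarrow> (\<And>x. q x \<le> m x) \<Longrightarrow> q = m"
    using sublinear_minimal_exists[OF assms] by blast
  note add = sublinear_add[OF m] and scale = sublinear_scale[OF m]
  have super: "m x + m a \<le> m (x + a)" for x a
  proof -
    define q where "q x = (INF t\<in>{0..}. m (x + t *\<^sub>R a) - t * m a)" for x
    have lo: "- m (- x) \<le> m (x + t *\<^sub>R a) - t * m a" if "0 \<le> t" for x t
      using add[of "x + t *\<^sub>R a" "- x"] scale[OF that, of a] by simp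
    have qle: "q x \<le> m (x + t *\<^sub>R a) - t * m a" if "0 \<le> t" for x t
      unfolding q_def using that lo
      by (intro cINF_lower bdd_belowI2[of _ "- m (- x)"]) auto
    have qge: "l \<le> q x" if "\<And>t. 0 \<le> t \<Longrightarrow> l \<le> m (x + t *\<^sub>R a) - t * m a" for l x
      unfolding q_def using that by (intro cINF_greatest) auto
    have "q (x + y) \<le> q x + q y" for x y
    proof -
      have *: "q (x + y) \<le> (m (x + s *\<^sub>R a) - s * m a) + (m (y + t *\<^sub>R a) - t * m a)"
        if "0 \<le> s" "0 \<le> t" for s t
        using qle[of "s + t" "x + y"] add[of "x + s *\<^sub>R a" "y + t *\<^sub>R a"] that
        by (simp add: algebra_simps)
      have "q (x + y) - (m (y + t *\<^sub>R a) - t * m a) \<le> q x" if "0 \<le> t" for t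
        by (rule qge) (use *[OF _ that] in \<open>simp add: algebra_simps\<close>)
      then have "q (x + y) - q x \<le> q y"
        by (intro qge) (simp add: algebra_simps)
      then show ?thesis by simp
    qed
    moreover have "q (r *\<^sub>R x) = r * q x" if r: "0 \<le> r" for r x
    proof (cases "r = 0")
      case True
      have "q 0 = 0"
        using qle[of 0 0] qge[of 0 0] scale[of _ a] sublinear_zero[OF m] by fastforce
      then show ?thesis using True by simp
    next
      case False
      with r have r: "0 < r" by simp
      have *: "r * (m (x + t *\<^sub>R a) - t * m a) = m (r *\<^sub>R x + (r * t) *\<^sub>R a) - (r * t) * m a"
        if "0 \<le> t" for t
        using scale[of r "x + t *\<^sub>R a"] r by (simp add: algebra_simps)
      have "q (r *\<^sub>R x) / r \<le> q x"
      proof (rule qge)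
        fix t :: real assume t: "0 \<le> t"
        have "q (r *\<^sub>R x) \<le> r * (m (x + t *\<^sub>R a) - t * m a)"
          using *[OF t] qle[of "r * t" "r *\<^sub>R x"] r t by simp
        then show "q (r *\<^sub>R x) / r \<le> m (x + t *\<^sub>R a) - t * m a"
          using r by (simp add: field_simps)
      qed
      moreover have "r * q x \<le> q (r *\<^sub>R x)"
      proof (rule qge)
        fix t :: real assume t: "0 \<le> t"
        have rt: "0 \<le> t / r" "r * (t / r) = t" using r t by auto
        have "r * q x \<le> r * (m (x + (t / r) *\<^sub>R a) - (t / r) * m a)"
          using r t by (intro mult_left_mono qle) auto
        then show "r * q x \<le> m (r *\<^sub>R x + t *\<^sub>R a) - t * m a"
          using *[OF rt(1)] unfolding rt(2) by linarith
      qed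
      ultimately show ?thesis using r by (simp add: field_simps)
    qed
    ultimately have "sublinear q" by (simp add: sublinear_def)
    \<comment> \<open>The value \<open>t = 0\<close> puts \<open>q\<close> below \<open>m\<close>.
      Once minimality forces \<open>q = m\<close>, the value \<open>t = 1\<close> is the desired
      superadditivity.\<close>
    moreover have "q x \<le> m x" for x using qle[of 0 x] by simp
    ultimately have "q = m" by (rule min)
    then show ?thesis using qle[of 1 x] by simp
  qed
  have eq: "m (x + y) = m x + m y" for x y using add super by (intro antisym)
  have neg: "m (- x) = - m x" for x
    using eq[of x "- x"] sublinear_zero[OF m] by simp
  have "m (c *\<^sub>R x) = c * m x" for c x
    using scale[of c x] scale[of "- c" "- x"] neg[of "x"] by (cases "0 \<le> c") auto
  then have "linear m" using eq by (intro linearI) auto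
  then show thesis using mp that by blast
qed

section \<open>Separability and countable covers by small sets\<close>

text \<open>Covers by small sets stand in for dense subsets because they restrict and pull back
  without a choice of points. Only the traces of the cover sets on \<open>A\<close> are measured;
  the sequence may repeat sets or contain empty ones.\<close>

definition ctbl_small :: "'a set \<Rightarrow> ('a \<Rightarrow> 'a \<Rightarrow> real) \<Rightarrow> bool" where
  "ctbl_small A d \<longleftrightarrow> (\<forall>\<epsilon>>0. \<exists>G :: nat \<Rightarrow> 'a set.
     A \<subseteq> (\<Union>n. G n) \<and> (\<forall>n. \<forall>x\<in>G n \<inter> A. \<forall>y\<in>G n \<inter> A. d x y < \<epsilon>))"

lemma ctbl_smallI:
  assumes "\<And>\<epsilon>. 0 < \<epsilon> \<Longrightarrow> \<exists>G. countable G \<and> A \<subseteq> \<Union>G \<and> (\<forall>g\<in>G. \<forall>x\<in>g \<inter> A. \<forall>y\<in>g \<inter> A. d x y < \<epsilon>)"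
  shows "ctbl_small A d"
  unfolding ctbl_small_def
proof (intro allI impI)
  fix \<epsilon> :: real assume "0 < \<epsilon>"
  from assms[OF this] obtain G where G: "countable G" "A \<subseteq> \<Union>G"
    and small: "\<forall>g\<in>G. \<forall>x\<in>g \<inter> A. \<forall>y\<in>g \<inter> A. d x y < \<epsilon>"
    by (elim exE conjE) (rule that)
  show "\<exists>G :: nat \<Rightarrow> 'a set. A \<subseteq> (\<Union>n. G n) \<and> (\<forall>n. \<forall>x\<in>G n \<inter> A. \<forall>y\<in>G n \<inter> A. d x y < \<epsilon>)"
  proof (cases "G = {}")
    case True
    then show ?thesis using G(2) by (intro exI[of _ "\<lambda>_. {}"]) simp
  next
    case False
    then have "A \<subseteq> (\<Union>n. from_nat_into G n)"
      using G range_from_nat_into by metis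
    moreover have "\<forall>x\<in>from_nat_into G n \<inter> A. \<forall>y\<in>from_nat_into G n \<inter> A. d x y < \<epsilon>" for n
      using small from_nat_into[OF False] by blast
    ultimately show ?thesis by (intro exI[of _ "from_nat_into G"] conjI allI)
  qed
qed

lemma ctbl_smallE:
  assumes "ctbl_small A d" "0 < \<epsilon>"
  obtains G :: "nat \<Rightarrow> 'a set" where "A \<subseteq> (\<Union>n. G n)"
    "\<And>n x y. x \<in> G n \<Longrightarrow> y \<in> G n \<Longrightarrow> x \<in> A \<Longrightarrow> y \<in> A \<Longrightarrow> d x y < \<epsilon>"
proof -
  obtain G :: "nat \<Rightarrow> 'a set" where G: "A \<subseteq> (\<Union>n. G n)"
    and small: "\<forall>n. \<forall>x\<in>G n \<inter> A. \<forall>y\<in>G n \<inter> A. d x y < \<epsilon>"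
    using assms(1)[unfolded ctbl_small_def, rule_format, OF assms(2)]
    by (elim exE conjE) (rule that)
  show thesis by (rule that[OF G]) (use small in simp)
qed

text \<open>At each scale \<open>1 / (k + 1)\<close> one point is chosen from every nonempty trace;
  any \<open>x\<close> shares a cover set with the point chosen from it.\<close>

lemma ctbl_small_imp_separable_for:
  assumes "ctbl_small A d"
  shows "separable_for A d"
proof -
  define \<epsilon> where "\<epsilon> k = inverse (real (Suc k))" for k
  have "\<exists>G :: nat \<Rightarrow> 'a set. A \<subseteq> (\<Union>n. G n) \<and> (\<forall>n. \<forall>x\<in>G n \<inter> A. \<forall>y\<in>G n \<inter> A. d x y < \<epsilon> k)" for k
    using assms unfolding ctbl_small_def \<epsilon>_def by simp
  then obtain G :: "nat \<Rightarrow> nat \<Rightarrow> 'a set" where cov: "\<And>k. A \<subseteq> (\<Union>n. G k n)"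
    and small: "\<And>k n x y. x \<in> G k n \<inter> A \<Longrightarrow> y \<in> G k n \<inter> A \<Longrightarrow> d x y < \<epsilon> k"
    by metis
  define p where "p = (\<lambda>(k, n). SOME y. y \<in> G k n \<inter> A)"
  define D where "D = p ` {(k, n). G k n \<inter> A \<noteq> {}}"
  have p: "p (k, n) \<in> G k n \<inter> A" if "x \<in> G k n \<inter> A" for x k n
    unfolding p_def using someI[of "\<lambda>y. y \<in> G k n \<inter> A", OF that] by simp
  have "\<exists>y\<in>D. d x y < e" if x: "x \<in> A" and "0 < e" for x e
  proof -
    obtain k where k: "\<epsilon> k < e"
      using reals_Archimedean[OF \<open>0 < e\<close>] unfolding \<epsilon>_def by blast
    obtain n where n: "x \<in> G k n \<inter> A" using x cov[of k] by blast
    have "d x (p (k, n)) < e" using small[OF n p[OF n]] k by linarith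
    moreover have "p (k, n) \<in> D" using n unfolding D_def by blast
    ultimately show ?thesis by blast
  qed
  moreover have "D \<subseteq> A" using p unfolding D_def by blast
  moreover have "countable D" unfolding D_def by (intro countable_image) simp
  ultimately show ?thesis unfolding separable_for_def by (intro exI[of _ D]) simp
qed

lemma separable_for_imp_ctbl_small:
  assumes "separable_for A d"
    and sym: "\<And>x y. x \<in> A \<Longrightarrow> y \<in> A \<Longrightarrow> d x y = d y x"
    and tri: "\<And>x y z. x \<in> A \<Longrightarrow> y \<in> A \<Longrightarrow> z \<in> A \<Longrightarrow> d x z \<le> d x y + d y z"
  shows "ctbl_small A d"
proof (rule ctbl_smallI)
  fix \<epsilon> :: real assume \<epsilon>: "0 < \<epsilon>"
  obtain D where D: "countable D" "D \<subseteq> A" and dense: "\<forall>x\<in>A. \<forall>\<epsilon>>0. \<exists>y\<in>D. d x y < \<epsilon>"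
    using assms(1) unfolding separable_for_def by blast
  define g where "g y = {x. d x y < \<epsilon> / 2}" for y
  have small: "d x x' < \<epsilon>" if "y \<in> D" "x \<in> g y \<inter> A" "x' \<in> g y \<inter> A" for x x' y
  proof -
    have "y \<in> A" using that D by blast
    then show ?thesis using that tri[of x y x'] sym[of x' y] by (simp add: g_def)
  qed
  have "\<exists>y\<in>D. d x y < \<epsilon> / 2" if "x \<in> A" for x
    using dense that half_gt_zero[OF \<epsilon>] by blast
  then have "A \<subseteq> \<Union>(g ` D)" unfolding g_def by blast
  moreover have "countable (g ` D)" using D(1) by simp
  moreover have "\<forall>g'\<in>g ` D. \<forall>x\<in>g' \<inter> A. \<forall>y\<in>g' \<inter> A. d x y < \<epsilon>"
    using small by simp
  ultimately show "\<exists>G. countable G \<and> A \<subseteq> \<Union>G \<and> (\<forall>g\<in>G. \<forall>x\<in>g \<inter> A. \<forall>y\<in>g \<inter> A. d x y < \<epsilon>)"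
    by (intro exI[of _ "g ` D"] conjI)
qed

text \<open>Preimages of a cover. The map \<open>f\<close> may depend on \<open>\<epsilon>\<close>,
  so a map defined only by approximation up to \<open>\<epsilon>\<close> can be used, as happens
  when functionals on a subspace are replaced by ambient ones.\<close>

lemma ctbl_small_pullback:
  assumes "ctbl_small B e"
    and "\<And>\<epsilon>. 0 < \<epsilon> \<Longrightarrow> \<exists>f \<delta>. 0 < \<delta> \<and> (\<forall>x\<in>A. f x \<in> B) \<and>
      (\<forall>x\<in>A. \<forall>y\<in>A. e (f x) (f y) < \<delta> \<longrightarrow> d x y < \<epsilon>)"
  shows "ctbl_small A d"
  unfolding ctbl_small_def
proof (intro allI impI)
  fix \<epsilon> :: real assume "0 < \<epsilon>"
  from assms(2)[OF this] obtain f \<delta> where \<delta>: "0 < \<delta>" and f: "\<forall>x\<in>A. f x \<in> B"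
    and fd: "\<forall>x\<in>A. \<forall>y\<in>A. e (f x) (f y) < \<delta> \<longrightarrow> d x y < \<epsilon>"
    by (elim exE conjE) (rule that)
  obtain G :: "nat \<Rightarrow> 'a set" where cov: "B \<subseteq> (\<Union>n. G n)"
    and small: "\<And>n x y. x \<in> G n \<Longrightarrow> y \<in> G n \<Longrightarrow> x \<in> B \<Longrightarrow> y \<in> B \<Longrightarrow> e x y < \<delta>"
    using ctbl_smallE[OF assms(1) \<delta>] by metis
  have "d x y < \<epsilon>" if "x \<in> A" "y \<in> A" "f x \<in> G n" "f y \<in> G n" for n x y
    using fd small[OF that(3,4)] f that(1,2) by simp
  moreover have "A \<subseteq> (\<Union>n. f -` G n)" using cov f by fastforce
  ultimately show "\<exists>G :: nat \<Rightarrow> _ set. A \<subseteq> (\<Union>n. G n) \<and> (\<forall>n. \<forall>x\<in>G n \<inter> A. \<forall>y\<in>G n \<inter> A. d x y < \<epsilon>)"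
    by (intro exI[of _ "\<lambda>n. f -` G n"] conjI) blast+
qed

lemma ctbl_small_two:
  assumes "ctbl_small A d1" "ctbl_small A d2"
    and "\<And>\<epsilon>. 0 < \<epsilon> \<Longrightarrow> \<exists>\<delta>>0. \<forall>x\<in>A. \<forall>y\<in>A. d1 x y < \<delta> \<and> d2 x y < \<delta> \<longrightarrow> d x y < \<epsilon>"
  shows "ctbl_small A d"
  unfolding ctbl_small_def
proof (intro allI impI)
  fix \<epsilon> :: real assume "0 < \<epsilon>"
  then obtain \<delta> where \<delta>: "0 < \<delta>" "\<forall>x\<in>A. \<forall>y\<in>A. d1 x y < \<delta> \<and> d2 x y < \<delta> \<longrightarrow> d x y < \<epsilon>"
    using assms(3) by meson
  obtain G1 :: "nat \<Rightarrow> 'a set" where G1: "A \<subseteq> (\<Union>n. G1 n)"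
    "\<And>n x y. x \<in> G1 n \<Longrightarrow> y \<in> G1 n \<Longrightarrow> x \<in> A \<Longrightarrow> y \<in> A \<Longrightarrow> d1 x y < \<delta>"
    using ctbl_smallE[OF assms(1) \<delta>(1)] by metis
  obtain G2 :: "nat \<Rightarrow> 'a set" where G2: "A \<subseteq> (\<Union>n. G2 n)"
    "\<And>n x y. x \<in> G2 n \<Longrightarrow> y \<in> G2 n \<Longrightarrow> x \<in> A \<Longrightarrow> y \<in> A \<Longrightarrow> d2 x y < \<delta>"
    using ctbl_smallE[OF assms(2) \<delta>(1)] by metis
  define G where "G k = (case prod_decode k of (n, m) \<Rightarrow> G1 n \<inter> G2 m)" for k
  have "x \<in> (\<Union>k. G k)" if x: "x \<in> A" for x
  proof -
    obtain n m where "x \<in> G1 n" "x \<in> G2 m" using x G1(1) G2(1) by blast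
    then have "x \<in> G (prod_encode (n, m))" by (simp add: G_def)
    then show ?thesis by blast
  qed
  moreover have "d x y < \<epsilon>" if "x \<in> A" "y \<in> A" "x \<in> G k" "y \<in> G k" for k x y
    using that \<delta>(2) G1(2)[of x _ y] G2(2)[of x _ y] by (auto simp: G_def split: prod.splits)
  ultimately show "\<exists>G :: nat \<Rightarrow> _ set. A \<subseteq> (\<Union>n. G n) \<and> (\<forall>n. \<forall>x\<in>G n \<inter> A. \<forall>y\<in>G n \<inter> A. d x y < \<epsilon>)"
    by (intro exI[of _ G] conjI) blast+
qed

lemma ctbl_small_UN:
  assumes "\<And>k :: nat. ctbl_small (A k) d"
  shows "ctbl_small (\<Union>k. A k) d"
  unfolding ctbl_small_def
proof (intro allI impI)
  fix \<epsilon> :: real assume "0 < \<epsilon>"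
  then have "\<exists>G :: nat \<Rightarrow> 'a set. A k \<subseteq> (\<Union>n. G n) \<and>
      (\<forall>n. \<forall>x\<in>G n \<inter> A k. \<forall>y\<in>G n \<inter> A k. d x y < \<epsilon>)" for k
    using assms unfolding ctbl_small_def by presburger
  then obtain G :: "nat \<Rightarrow> nat \<Rightarrow> 'a set" where cov: "\<And>k. A k \<subseteq> (\<Union>n. G k n)"
    and small: "\<And>k n x y. x \<in> G k n \<inter> A k \<Longrightarrow> y \<in> G k n \<inter> A k \<Longrightarrow> d x y < \<epsilon>"
    by metis
  \<comment> \<open>The intersection with \<open>A k\<close> matters: \<open>G k n\<close> is known
    to be small only there.\<close>
  define H where "H i = (case prod_decode i of (k, n) \<Rightarrow> G k n \<inter> A k)" for i
  have "x \<in> (\<Union>i. H i)" if x: "x \<in> (\<Union>k. A k)" for x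
  proof -
    obtain k where k: "x \<in> A k" using x by blast
    obtain n where "x \<in> G k n" using k cov by blast
    then have "x \<in> H (prod_encode (k, n))" using k by (simp add: H_def)
    then show ?thesis by blast
  qed
  moreover have "d x y < \<epsilon>" if "x \<in> H i" "y \<in> H i" for i x y
    using that small[of x _ _ y] by (auto simp: H_def split: prod.splits)
  ultimately show "\<exists>G :: nat \<Rightarrow> _ set. (\<Union>k. A k) \<subseteq> (\<Union>n. G n) \<and>
      (\<forall>n. \<forall>x\<in>G n \<inter> (\<Union>k. A k). \<forall>y\<in>G n \<inter> (\<Union>k. A k). d x y < \<epsilon>)"
    by (intro exI[of _ H] conjI) blast+
qed

section \<open>Functionals on spaces of continuous functions\<close>

text \<open>The open sets \<open>\<psi> n x < \<eta>\<close> increase with \<open>n\<close> and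
  cover a compact space, so one of them is the whole space.\<close>

lemma Dini_uniformly_small:
  fixes \<psi> :: "nat \<Rightarrow> 'x::topological_space \<Rightarrow> real"
  assumes "compact (UNIV :: 'x set)" and cont: "\<And>n. continuous_on UNIV (\<psi> n)"
    and dec: "\<And>n m x. n \<le> m \<Longrightarrow> \<psi> m x \<le> \<psi> n x"
    and small: "\<And>x. \<exists>n. \<psi> n x < \<eta>"
  shows "\<exists>n. \<forall>x. \<psi> n x < \<eta>"
proof -
  have op: "open {x. \<psi> n x < \<eta>}" for n
    using cont by (intro open_Collect_less) auto
  obtain N where N: "finite N" "UNIV \<subseteq> (\<Union>n\<in>N. {x. \<psi> n x < \<eta>})"
    by (rule compactE_image[OF assms(1), of UNIV "\<lambda>n. {x. \<psi> n x < \<eta>}"])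
      (use op small in auto)
  have "\<psi> (Max N) x < \<eta>" for x
  proof -
    obtain n where n: "n \<in> N" "\<psi> n x < \<eta>" using N(2) by auto
    then show ?thesis using dec[of n "Max N" x] Max_ge[OF N(1) n(1)] by linarith
  qed
  then show ?thesis by blast
qed

text \<open>A bounded functional on \<open>C(X)\<close>, written on raw functions so that
  truncations, minima and products can be formed pointwise. Values of \<open>L\<close> at
  discontinuous functions are arbitrary, which is why each law is guarded.\<close>

locale continuous_functional =
  fixes L :: "('x::topological_space \<Rightarrow> real) \<Rightarrow> real" and B :: real
  assumes compact_UNIV: "compact (UNIV :: 'x set)"
    and L_add: "continuous_on UNIV g \<Longrightarrow> continuous_on UNIV h \<Longrightarrow>
      L (\<lambda>x. g x + h x) = L g + L h"
    and L_scale: "continuous_on UNIV g \<Longrightarrow> L (\<lambda>x. r * g x) = r * L g"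
    and L_bound: "continuous_on UNIV g \<Longrightarrow> (\<And>x. \<bar>g x\<bar> \<le> r) \<Longrightarrow> \<bar>L g\<bar> \<le> B * r"
begin

lemma L_zero: "L (\<lambda>_. 0) = 0"
  using L_scale[of "\<lambda>_. 0" 0] by simp

lemma B_nonneg: "0 \<le> B"
  using L_bound[of "\<lambda>_. 0" 1] by simp

lemma L_diff: "continuous_on UNIV g \<Longrightarrow> continuous_on UNIV h \<Longrightarrow> L (\<lambda>x. g x - h x) = L g - L h"
  using L_add[of g "\<lambda>x. (-1) * h x"] L_scale[of h "-1"] by (simp add: continuous_on_minus)

lemma L_sum:
  assumes "finite I" "\<And>i. i \<in> I \<Longrightarrow> continuous_on UNIV (g i)"
  shows "L (\<lambda>x. \<Sum>i\<in>I. g i x) = (\<Sum>i\<in>I. L (g i))"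
  using assms
proof (induction I)
  case (insert i I)
  have "L (\<lambda>x. g i x + (\<Sum>i\<in>I. g i x)) = L (g i) + L (\<lambda>x. \<Sum>i\<in>I. g i x)"
    using insert.prems by (intro L_add continuous_on_sum) auto
  with insert show ?case by simp
qed (simp add: L_zero)

text \<open>In terms of the Riesz representation this is the integral of \<open>g \<ge> 0\<close>
  against the total variation of the measure of \<open>L\<close>. If \<open>g\<close> takes a
  negative value, the set of competitors is empty and the supremum says nothing.\<close>

definition variation :: "('x \<Rightarrow> real) \<Rightarrow> real" where
  "variation g = (SUP h\<in>{h. continuous_on UNIV h \<and> (\<forall>x. \<bar>h x\<bar> \<le> g x)}. L h)"

lemma variation_upper:
  assumes "continuous_on UNIV g" "continuous_on UNIV h" "\<And>x. \<bar>h x\<bar> \<le> g x"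
  shows "L h \<le> variation g"
proof -
  have "compact (range g)"
    using assms(1) compact_UNIV by (rule compact_continuous_image)
  then obtain r where r: "\<And>x. \<bar>g x\<bar> \<le> r"
    using compact_imp_bounded[of "range g"] unfolding bounded_iff by auto
  have "L h \<le> B * r" if "continuous_on UNIV h" "\<forall>x. \<bar>h x\<bar> \<le> g x" for h
    using L_bound[of h r] that r by (meson abs_ge_self abs_le_D1 order.trans)
  then show ?thesis
    unfolding variation_def using assms
    by (intro cSUP_upper bdd_aboveI2[of _ _ "B * r"]) auto
qed

lemma abs_L_le_variation:
  assumes "continuous_on UNIV g" "continuous_on UNIV h" "\<And>x. \<bar>h x\<bar> \<le> g x"
  shows "\<bar>L h\<bar> \<le> variation g"
  using variation_upper[OF assms] variation_upper[of g "\<lambda>x. (-1) * h x"] L_scale[of h "-1"] assms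
  by (simp add: continuous_on_minus)

lemma variation_least:
  assumes "\<And>x. 0 \<le> g x"
    and "\<And>h. continuous_on UNIV h \<Longrightarrow> (\<And>x. \<bar>h x\<bar> \<le> g x) \<Longrightarrow> L h \<le> c"
  shows "variation g \<le> c"
proof -
  have "(\<lambda>_. 0) \<in> {h. continuous_on UNIV h \<and> (\<forall>x. \<bar>h x\<bar> \<le> g x)}"
    using assms(1) by simp
  then show ?thesis
    unfolding variation_def using assms(2) by (intro cSUP_least) blast+
qed

lemma variation_nonneg:
  assumes "continuous_on UNIV g" "\<And>x. 0 \<le> g x"
  shows "0 \<le> variation g"
  using variation_upper[of g "\<lambda>_. 0"] assms L_zero by simp

lemma variation_bound:
  assumes "\<And>x. 0 \<le> g x" "\<And>x. g x \<le> r"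
  shows "variation g \<le> B * r"
proof (rule variation_least)
  fix h :: "'x \<Rightarrow> real" assume h: "continuous_on UNIV h" "\<And>x. \<bar>h x\<bar> \<le> g x"
  have "\<bar>h x\<bar> \<le> r" for x using h(2)[of x] assms(2)[of x] by linarith
  then have "\<bar>L h\<bar> \<le> B * r" by (rule L_bound[OF h(1)])
  then show "L h \<le> B * r" by linarith
qed (rule assms(1))

lemma variation_mono:
  assumes "continuous_on UNIV g'" "\<And>x. 0 \<le> g x" "\<And>x. g x \<le> g' x"
  shows "variation g \<le> variation g'"
proof (rule variation_least)
  fix h :: "'x \<Rightarrow> real" assume h: "continuous_on UNIV h" "\<And>x. \<bar>h x\<bar> \<le> g x"
  have "\<bar>h x\<bar> \<le> g' x" for x using h(2)[of x] assms(3)[of x] by linarith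
  then show "L h \<le> variation g'" by (rule variation_upper[OF assms(1) h(1)])
qed (rule assms(2))

lemma variation_add:
  assumes c: "continuous_on UNIV g" "continuous_on UNIV g'" and pos: "\<And>x. 0 \<le> g x" "\<And>x. 0 \<le> g' x"
  shows "variation (\<lambda>x. g x + g' x) = variation g + variation g'"
proof (rule antisym)
  show "variation (\<lambda>x. g x + g' x) \<le> variation g + variation g'"
  proof (rule variation_least)
    fix h :: "'x \<Rightarrow> real" assume h: "continuous_on UNIV h" "\<And>x. \<bar>h x\<bar> \<le> g x + g' x"
    \<comment> \<open>Riesz decomposition: clipping \<open>h\<close> to the band between
      \<open>- g\<close> and \<open>g\<close> leaves a remainder bounded by
      \<open>g'\<close>.\<close>
    define u where "u x = max (- g x) (min (h x) (g x))" for x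
    have cu: "continuous_on UNIV u"
      unfolding u_def by (intro continuous_intros c h)
    have "\<bar>u x\<bar> \<le> g x" "\<bar>h x - u x\<bar> \<le> g' x" for x
      using pos[of x] h(2)[of x] by (auto simp: u_def max_def min_def abs_if split: if_splits)
    then have "L u \<le> variation g" "L (\<lambda>x. h x - u x) \<le> variation g'"
      using c h cu by (auto intro!: variation_upper continuous_on_diff)
    then show "L h \<le> variation g + variation g'" using L_diff[OF h(1) cu] by simp
  qed (simp add: pos add_nonneg_nonneg)
  have "L h + L h' \<le> variation (\<lambda>x. g x + g' x)"
    if "continuous_on UNIV h" "\<And>x. \<bar>h x\<bar> \<le> g x" "continuous_on UNIV h'" "\<And>x. \<bar>h' x\<bar> \<le> g' x" for h h'
  proof -
    have "\<bar>h x + h' x\<bar> \<le> g x + g' x" for x using that(2)[of x] that(4)[of x] by linarith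
    then show ?thesis
      using variation_upper[of "\<lambda>x. g x + g' x" "\<lambda>x. h x + h' x"] that c L_add[of h h']
      by (simp add: continuous_on_add)
  qed
  note le = this
  have "variation g \<le> variation (\<lambda>x. g x + g' x) - variation g'"
  proof (rule variation_least[OF pos(1)])
    fix h :: "'x \<Rightarrow> real" assume h: "continuous_on UNIV h" "\<And>x. \<bar>h x\<bar> \<le> g x"
    have "variation g' \<le> variation (\<lambda>x. g x + g' x) - L h"
    proof (rule variation_least[OF pos(2)])
      fix h' :: "'x \<Rightarrow> real" assume "continuous_on UNIV h'" "\<And>x. \<bar>h' x\<bar> \<le> g' x"
      from le[OF h this] show "L h' \<le> variation (\<lambda>x. g x + g' x) - L h" by simp
    qed
    then show "L h \<le> variation (\<lambda>x. g x + g' x) - variation g'" by simp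
  qed
  then show "variation g + variation g' \<le> variation (\<lambda>x. g x + g' x)" by simp
qed

lemma variation_diff:
  assumes "continuous_on UNIV g" "continuous_on UNIV g'" "\<And>x. 0 \<le> g x" "\<And>x. g x \<le> g' x"
  shows "variation (\<lambda>x. g' x - g x) = variation g' - variation g"
  using variation_add[of g "\<lambda>x. g' x - g x"] assms by (simp add: continuous_on_diff)

lemma abs_L_le_scaled_variation:
  assumes "continuous_on UNIV g" "continuous_on UNIV h" "0 \<le> r" "\<And>x. \<bar>h x\<bar> \<le> r * g x"
  shows "\<bar>L h\<bar> \<le> r * variation g"
proof (cases "r = 0")
  case True
  then have "h = (\<lambda>_. 0)" using assms(4) by fastforce
  then show ?thesis using True L_zero by simp
next
  case False
  with assms(3) have r: "0 < r" by simp
  have "\<bar>L (\<lambda>x. inverse r * h x)\<bar> \<le> variation g"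
    using assms r by (intro abs_L_le_variation continuous_intros) (auto simp: abs_mult field_simps)
  then have "\<bar>L h\<bar> / r \<le> variation g"
    using r L_scale[OF assms(2)] by (simp add: abs_mult divide_inverse_commute)
  then show ?thesis using r by (simp add: pos_divide_le_eq mult.commute)
qed

text \<open>This is the countable additivity of the variation: it plays the role of the statement that
  a measure is almost carried by finitely many members of a countable cover by closed sets.\<close>

lemma variation_vanishes:
  fixes \<phi> :: "nat \<Rightarrow> nat \<Rightarrow> 'x \<Rightarrow> real"
  assumes cont: "\<And>n m. continuous_on UNIV (\<phi> n m)"
    and pos: "\<And>n m x. 0 \<le> \<phi> n m x"
    and dec: "\<And>n m x. \<phi> (Suc n) m x \<le> \<phi> n m x"
    and inc: "\<And>n m m' x. m \<le> m' \<Longrightarrow> \<phi> n m x \<le> \<phi> n m' x"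
    and le1: "\<And>n m x. \<phi> n m x \<le> 1"
    and van: "\<And>x. \<exists>n. \<forall>m. \<phi> n m x = 0"
    and "0 < \<delta>"
  shows "\<exists>n. \<forall>m. variation (\<phi> n m) \<le> \<delta>"
proof -
  have vle: "variation (\<phi> n m) \<le> B" for n m
    using variation_bound[of "\<phi> n m" 1] pos le1 by simp
  have vinc: "variation (\<phi> n m) \<le> variation (\<phi> n m')" if "m \<le> m'" for n m m'
    using that by (intro variation_mono cont pos inc)
  \<comment> \<open>For fixed \<open>n\<close> the variations increase with \<open>m\<close> and are
    bounded by \<open>B\<close>, so some \<open>m\<close> comes close to their supremum. The
    geometric tolerances add up to at most \<open>\<delta> / 2\<close> over all
    \<open>n\<close>.\<close>
  have "\<exists>m. \<forall>m'\<ge>m. variation (\<phi> n m') - variation (\<phi> n m) \<le> \<delta> / 2 / 2 ^ Suc n" for n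
  proof -
    define a where "a = (SUP m. variation (\<phi> n m))"
    have bdd: "bdd_above (range (\<lambda>m. variation (\<phi> n m)))"
      using vle by (intro bdd_aboveI2[of _ _ B])
    obtain m where m: "a - \<delta> / 2 / 2 ^ Suc n < variation (\<phi> n m)"
      using less_cSUP_iff[of UNIV "\<lambda>m. variation (\<phi> n m)" "a - \<delta> / 2 / 2 ^ Suc n"] bdd \<open>0 < \<delta>\<close>
      unfolding a_def[symmetric] by auto
    have "variation (\<phi> n m') \<le> a" for m'
      unfolding a_def using bdd by (intro cSUP_upper) auto
    with m have "variation (\<phi> n m') - variation (\<phi> n m) \<le> \<delta> / 2 / 2 ^ Suc n" for m'
      by (smt (verit))
    then show ?thesis by blast
  qed
  then obtain m where
    m: "\<And>n m'. m n \<le> m' \<Longrightarrow> variation (\<phi> n m') - variation (\<phi> n (m n)) \<le> \<delta> / 2 / 2 ^ Suc n"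
    by metis
  \<comment> \<open>Since \<open>m\<close> varies with \<open>n\<close>, the functions
    \<open>\<phi> n (m n)\<close> need not decrease in \<open>n\<close>. Their running minima do,
    and Dini's theorem applies to these.\<close>
  define \<psi> where "\<psi> = rec_nat (\<phi> 0 (m 0)) (\<lambda>n p x. min (p x) (\<phi> (Suc n) (m (Suc n)) x))"
  have \<psi>_0: "\<psi> 0 = \<phi> 0 (m 0)" and \<psi>_Suc: "\<psi> (Suc n) = (\<lambda>x. min (\<psi> n x) (\<phi> (Suc n) (m (Suc n)) x))" for n
    by (simp_all add: \<psi>_def)
  have \<psi>_cont: "continuous_on UNIV (\<psi> n)" for n
    by (induction n) (auto simp: \<psi>_0 \<psi>_Suc intro!: cont continuous_on_min)
  have \<psi>_pos: "0 \<le> \<psi> n x" for n x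
    by (induction n) (auto simp: \<psi>_0 \<psi>_Suc pos)
  have \<psi>_le: "\<psi> n x \<le> \<phi> n (m n) x" for n x
    by (cases n) (auto simp: \<psi>_0 \<psi>_Suc)
  have \<psi>_dec: "\<psi> k x \<le> \<psi> n x" if "n \<le> k" for n k x
    using that by (induction k rule: dec_induct) (auto simp: \<psi>_Suc intro: order.trans[rotated])
  define \<eta> where "\<eta> = \<delta> / (2 * (B + 1))"
  have \<eta>: "0 < \<eta>" "B * \<eta> \<le> \<delta> / 2"
    using \<open>0 < \<delta>\<close> B_nonneg by (auto simp: \<eta>_def field_simps)
  have "\<exists>n. \<psi> n x < \<eta>" for x
  proof -
    obtain n where "\<forall>m. \<phi> n m x = 0" using van by blast
    then have "\<psi> n x \<le> 0" using \<psi>_le[of n x] by simp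
    then show ?thesis using \<eta>(1) by (intro exI[of _ n]) linarith
  qed
  then obtain n where n: "\<And>x. \<psi> n x < \<eta>"
    using Dini_uniformly_small[where \<psi> = \<psi> and \<eta> = \<eta>, OF compact_UNIV \<psi>_cont \<psi>_dec] by blast
  have v\<psi>: "variation (\<psi> n) \<le> \<delta> / 2"
    using variation_bound[of "\<psi> n" \<eta>] \<psi>_pos n \<eta>(2) by (fastforce intro: less_imp_le)
  define M where "M = Max (m ` {..n})"
  have mM: "m k \<le> M" if "k \<le> n" for k
    unfolding M_def using that by (intro Max_ge) auto
  have "variation (\<phi> n M') \<le> \<delta>" if M': "M \<le> M'" for M'
  proof -
    have mM': "m k \<le> M'" if "k \<le> n" for k using mM[OF that] M' by simp
    \<comment> \<open>The part of \<open>\<phi> k M'\<close> missed by the fixed choice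
      \<open>m k\<close>; its variation is within the \<open>k\<close>-th tolerance.\<close>
    define d where "d k x = \<phi> k M' x - \<phi> k (m k) x" for k x
    have d_pos: "0 \<le> d k x" if "k \<le> n" for k x
      using inc[OF mM'[OF that], of k x] by (simp add: d_def)
    have d_cont: "continuous_on UNIV (d k)" for k
      unfolding d_def by (intro continuous_on_diff cont)
    \<comment> \<open>If the running minimum drops to the new function, \<open>d (Suc k)\<close> is
      exactly the missing difference; otherwise monotonicity in the first index reduces to the
      previous stage.\<close>
    have le: "\<phi> k M' x \<le> \<psi> k x + (\<Sum>j\<le>k. d j x)" if "k \<le> n" for k x
      using that
    proof (induction k)
      case (Suc k)
      have "0 \<le> (\<Sum>j\<le>k. d j x)" using Suc.prems by (intro sum_nonneg d_pos) simp
      moreover have "0 \<le> d (Suc k) x" using Suc.prems by (rule d_pos)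
      ultimately show ?case
        using Suc dec[of k M' x] by (auto simp: \<psi>_Suc d_def min_def)
    qed (simp add: \<psi>_0 d_def)
    have vsum: "variation (\<lambda>x. \<Sum>j\<le>k. d j x) \<le> \<delta> / 2 * (1 - 1 / 2 ^ Suc k)" if "k \<le> n" for k
      using that
    proof (induction k)
      case 0
      have "variation (d 0) \<le> \<delta> / 2 / 2 ^ Suc 0"
        using variation_diff[of "\<phi> 0 (m 0)" "\<phi> 0 M'"] m[of 0 M'] cont pos inc mM'[of 0]
        by (simp add: d_def[abs_def])
      then show ?case by simp
    next
      case (Suc k)
      have "variation (d (Suc k)) \<le> \<delta> / 2 / 2 ^ Suc (Suc k)"
        using variation_diff[of "\<phi> (Suc k) (m (Suc k))" "\<phi> (Suc k) M'"] m[of "Suc k" M'] cont pos inc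
          mM'[OF Suc.prems] by (simp add: d_def[abs_def])
      moreover have "variation (\<lambda>x. (\<Sum>j\<le>k. d j x) + d (Suc k) x)
          = variation (\<lambda>x. \<Sum>j\<le>k. d j x) + variation (d (Suc k))"
        using Suc.prems by (intro variation_add continuous_on_sum d_cont sum_nonneg d_pos) auto
      ultimately show ?case using Suc by (simp add: field_simps)
    qed
    have "variation (\<phi> n M') \<le> variation (\<lambda>x. \<psi> n x + (\<Sum>j\<le>n. d j x))"
      using le by (intro variation_mono continuous_on_add continuous_on_sum d_cont \<psi>_cont pos) auto
    also have "\<dots> = variation (\<psi> n) + variation (\<lambda>x. \<Sum>j\<le>n. d j x)"
      by (intro variation_add continuous_on_sum d_cont \<psi>_cont \<psi>_pos sum_nonneg d_pos) auto
    also have "\<dots> \<le> \<delta> / 2 + \<delta> / 2 * (1 - 1 / 2 ^ Suc n)"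
      using v\<psi> vsum[of n] by linarith
    also have "\<dots> \<le> \<delta>" using \<open>0 < \<delta>\<close> by (simp add: field_simps)
    finally show ?thesis .
  qed
  \<comment> \<open>The bound is known only from \<open>M\<close> on; monotonicity in the second
    index extends it to smaller \<open>m\<close>.\<close>
  then have "variation (\<phi> n m) \<le> \<delta>" for m
    using vinc[of m "max m M" n] by (meson max.cobounded1 max.cobounded2 order.trans)
  then show ?thesis by blast
qed

text \<open>For a measure: the closed sets of those \<open>y\<close> with
  \<open>\<bar>c k y - c k (x i)\<bar> \<le> \<epsilon>\<close> for all \<open>k\<close> cover the
  space, finitely many carry all but variation \<open>\<delta>\<close>, and on the
  \<open>i\<close>-th disjointified piece each \<open>c k\<close> may be replaced by its value at
  \<open>x i\<close>. The discarded part costs \<open>M * \<delta>\<close>, the replacement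
  \<open>\<epsilon> * B\<close>. Continuous approximations take the place of the indicators of the
  pieces; a limit yields coefficients that do not depend on \<open>k\<close>.\<close>

lemma approximated_by_point_evaluations:
  fixes c :: "nat \<Rightarrow> 'x \<Rightarrow> real" and x :: "nat \<Rightarrow> 'x"
  assumes cont: "\<And>k. continuous_on UNIV (c k)" and bound: "\<And>k y. \<bar>c k y\<bar> \<le> M"
    and cover: "\<And>y. \<exists>i. \<forall>k. \<bar>c k y - c k (x i)\<bar> \<le> \<epsilon>"
    and "0 < \<delta>" "0 \<le> \<epsilon>"
  shows "\<exists>n a. \<forall>k. \<bar>L (c k) - (\<Sum>i<n. a i * c k (x i))\<bar> \<le> M * \<delta> + \<epsilon> * B"
proof -
  have M: "0 \<le> M" using bound[of 0 undefined] by linarith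
  \<comment> \<open>As \<open>m\<close> grows, \<open>q i m\<close> increases to the indicator of
    the complement of the \<open>i\<close>-th closed set, and \<open>\<phi> n m\<close> to that of
    the complement of the first \<open>n\<close> of them.\<close>
  define s where "s i m y = (\<Sum>k<m. max 0 (\<bar>c k y - c k (x i)\<bar> - \<epsilon>))" for i m y
  define q where "q i m y = min 1 (real m * s i m y)" for i m y
  define \<phi> where "\<phi> n m y = rec_nat 1 (\<lambda>i r. min r (q i m y)) n" for n m y
  have \<phi>_0: "\<phi> 0 m y = 1" and \<phi>_Suc: "\<phi> (Suc i) m y = min (\<phi> i m y) (q i m y)" for i m y
    by (simp_all add: \<phi>_def)
  have s_pos: "0 \<le> s i m y" for i m y
    unfolding s_def by (intro sum_nonneg) simp
  have s_mono: "s i m y \<le> s i m' y" if "m \<le> m'" for i m m' y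
    unfolding s_def using that by (intro sum_mono2) auto
  have q_cont: "continuous_on UNIV (q i m)" for i m
    unfolding q_def s_def by (intro continuous_intros cont)
  have q_pos: "0 \<le> q i m y" for i m y
    using s_pos by (simp add: q_def)
  have q_mono: "q i m y \<le> q i m' y" if "m \<le> m'" for i m m' y
  proof -
    have "real m * s i m y \<le> real m' * s i m' y"
      using that by (intro mult_mono s_mono s_pos) auto
    then show ?thesis by (auto simp: q_def)
  qed
  have \<phi>_cont: "continuous_on UNIV (\<phi> n m)" for n m
    by (induction n) (auto simp: \<phi>_0[abs_def] \<phi>_Suc[abs_def] intro!: continuous_on_min q_cont)
  have \<phi>_pos: "0 \<le> \<phi> n m y" for n m y
    by (induction n) (auto simp: \<phi>_0 \<phi>_Suc q_pos)
  have \<phi>_dec: "\<phi> (Suc n) m y \<le> \<phi> n m y" for n m y by (simp add: \<phi>_Suc)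
  have \<phi>_le1: "\<phi> n m y \<le> 1" for n m y
    by (induction n) (auto simp: \<phi>_0 \<phi>_Suc min_def)
  have \<phi>_inc: "\<phi> n m y \<le> \<phi> n m' y" if "m \<le> m'" for n m m' y
    using q_mono[OF that] by (induction n) (auto simp: \<phi>_0 \<phi>_Suc intro: min.coboundedI1 min.coboundedI2)
  have "\<exists>n. \<forall>m. \<phi> n m y = 0" for y
  proof -
    obtain i where i: "\<And>k. \<bar>c k y - c k (x i)\<bar> \<le> \<epsilon>" using cover by blast
    then have "s i m y = 0" for m unfolding s_def by (intro sum.neutral ballI max_absorb1) (simp add: i)
    then have "q i m y = 0" for m by (simp add: q_def)
    then have "\<phi> (Suc i) m y = 0" for m using \<phi>_pos[of i m y] by (simp add: \<phi>_Suc)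
    then show ?thesis by blast
  qed
  then obtain n where n: "\<And>m. variation (\<phi> n m) \<le> \<delta>"
    using variation_vanishes[where \<phi> = \<phi>, OF \<phi>_cont \<phi>_pos \<phi>_dec \<phi>_inc \<phi>_le1 _ \<open>0 < \<delta>\<close>] by blast
  \<comment> \<open>The increments of \<open>L (\<phi> i m)\<close> in \<open>m\<close> are
    dominated by those of the variations, which increase and are bounded by
    \<open>B\<close>.\<close>
  have "convergent (\<lambda>m. L (\<phi> i m))" for i
  proof -
    have mono: "incseq (\<lambda>m. variation (\<phi> i m))"
      by (intro incseq_SucI variation_mono \<phi>_cont \<phi>_pos \<phi>_inc) simp
    have "variation (\<phi> i m) \<le> B" for m
      using variation_bound[of "\<phi> i m" 1] \<phi>_pos \<phi>_le1 by simp
    with mono have "convergent (\<lambda>m. variation (\<phi> i m))"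
      by (meson convergentI incseq_convergent)
    then have cau: "Cauchy (\<lambda>m. variation (\<phi> i m))" by (rule convergent_Cauchy)
    have le: "\<bar>L (\<phi> i m') - L (\<phi> i m)\<bar> \<le> \<bar>variation (\<phi> i m') - variation (\<phi> i m)\<bar>"
      if "m \<le> m'" for m m'
    proof -
      have "\<bar>L (\<lambda>y. \<phi> i m' y - \<phi> i m y)\<bar> \<le> variation (\<lambda>y. \<phi> i m' y - \<phi> i m y)"
        using \<phi>_inc[OF that] by (intro abs_L_le_variation continuous_on_diff \<phi>_cont) auto
      then show ?thesis
        using L_diff[OF \<phi>_cont \<phi>_cont] variation_diff[OF \<phi>_cont \<phi>_cont \<phi>_pos \<phi>_inc[OF that]]
        by simp
    qed
    then have le': "\<bar>L (\<phi> i m') - L (\<phi> i m)\<bar> \<le> \<bar>variation (\<phi> i m') - variation (\<phi> i m)\<bar>" for m m'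
      using le[of m m'] le[of m' m] by (cases "m \<le> m'") (auto simp: abs_minus_commute)
    have "Cauchy (\<lambda>m. L (\<phi> i m))"
    proof (rule metric_CauchyI)
      fix e :: real assume "0 < e"
      then obtain N where "\<And>m m'. N \<le> m \<Longrightarrow> N \<le> m' \<Longrightarrow>
          dist (variation (\<phi> i m)) (variation (\<phi> i m')) < e"
        using metric_CauchyD[OF cau] by metis
      then show "\<exists>N. \<forall>m\<ge>N. \<forall>m'\<ge>N. dist (L (\<phi> i m)) (L (\<phi> i m')) < e"
        using le_less_trans[OF le'] unfolding dist_real_def by (intro exI[of _ N] allI impI) blast
    qed
    then show ?thesis by (rule Cauchy_convergent)
  qed
  then obtain l where l: "\<And>i. (\<lambda>m. L (\<phi> i m)) \<longlonglongrightarrow> l i"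
    unfolding convergent_def by metis
  \<comment> \<open>The limit of \<open>p i m\<close> is the indicator of the \<open>i\<close>-th
    closed set minus the earlier ones; together with \<open>\<phi> n m\<close> the first
    \<open>n\<close> of these functions form a partition of unity.\<close>
  define p where "p i m y = \<phi> i m y - \<phi> (Suc i) m y" for i m y
  have p_cont: "continuous_on UNIV (p i m)" for i m
    unfolding p_def by (intro continuous_on_diff \<phi>_cont)
  have p_pos: "0 \<le> p i m y" for i m y using \<phi>_dec by (simp add: p_def)
  have Lp: "L (p i m) = L (\<phi> i m) - L (\<phi> (Suc i) m)" for i m
    unfolding p_def by (intro L_diff \<phi>_cont)
  have vp: "variation (p i m) = variation (\<phi> i m) - variation (\<phi> (Suc i) m)" for i m
    unfolding p_def by (intro variation_diff \<phi>_cont \<phi>_pos \<phi>_dec)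
  have p_sum: "\<phi> n m y + (\<Sum>i<n. p i m y) = 1" for n m y
    using sum_lessThan_telescope'[of "\<lambda>i. \<phi> i m y" n] by (simp add: p_def \<phi>_0)
  have "(\<Sum>i<n. variation (p i m)) = variation (\<phi> 0 m) - variation (\<phi> n m)" for m
    unfolding vp by (rule sum_lessThan_telescope')
  moreover have "variation (\<phi> 0 m) \<le> B" for m
    using variation_bound[of "\<phi> 0 m" 1] \<phi>_pos \<phi>_le1 by simp
  ultimately have vp_sum: "(\<Sum>i<n. variation (p i m)) \<le> B" for m
    using variation_nonneg[OF \<phi>_cont \<phi>_pos, of n m] by (metis diff_ge_0_iff_ge diff_mono diff_zero)
  define a where "a i = l i - l (Suc i)" for i
  have approx: "\<bar>L (c k) - (\<Sum>i<n. L (p i m) * c k (x i))\<bar> \<le> M * \<delta> + (\<epsilon> + 1 / real m) * B"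
    if "k < m" for k m
  proof -
    have m: "0 < real m" using that by simp
    \<comment> \<open>Where \<open>p i m\<close> does not vanish, the minimum has dropped below its
      previous value, so \<open>q i m < 1\<close> and hence \<open>s i m < 1 / m\<close>. This
      bounds the excess over \<open>\<epsilon>\<close> of each of the first \<open>m\<close>
      functions, among them \<open>c k\<close>.\<close>
    have supp: "\<bar>(c k y - c k (x i)) * p i m y\<bar> \<le> (\<epsilon> + 1 / real m) * p i m y" for i y
    proof (cases "p i m y = 0")
      case False
      then have "q i m y < \<phi> i m y" by (simp add: p_def \<phi>_Suc min_def split: if_splits)
      then have "q i m y < 1" using \<phi>_le1[of i m y] by linarith
      then have "real m * s i m y < 1" by (simp add: q_def split: if_splits)
      then have "s i m y < 1 / real m" using m by (simp add: field_simps)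
      moreover have "max 0 (\<bar>c k y - c k (x i)\<bar> - \<epsilon>) \<le> s i m y"
        unfolding s_def using that by (intro member_le_sum) auto
      ultimately have "\<bar>c k y - c k (x i)\<bar> \<le> \<epsilon> + 1 / real m" by linarith
      then show ?thesis using p_pos[of i m y] by (simp add: abs_mult mult_right_mono)
    qed simp
    have "L (c k) = L (\<lambda>y. c k y * \<phi> n m y + (\<Sum>i<n. c k y * p i m y))"
      using p_sum[of n m] by (simp add: sum_distrib_left[symmetric] distrib_left[symmetric])
    also have "\<dots> = L (\<lambda>y. c k y * \<phi> n m y) + (\<Sum>i<n. L (\<lambda>y. c k y * p i m y))"
      by (subst L_add, intro continuous_intros cont \<phi>_cont, intro continuous_intros cont p_cont,
          subst L_sum, simp, intro continuous_intros cont p_cont, rule refl)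
    finally have "L (c k) - (\<Sum>i<n. L (p i m) * c k (x i)) =
        L (\<lambda>y. c k y * \<phi> n m y) + (\<Sum>i<n. L (\<lambda>y. c k y * p i m y) - c k (x i) * L (p i m))"
      by (simp add: sum_subtractf mult.commute)
    also have "(\<Sum>i<n. L (\<lambda>y. c k y * p i m y) - c k (x i) * L (p i m)) =
        (\<Sum>i<n. L (\<lambda>y. (c k y - c k (x i)) * p i m y))"
    proof (rule sum.cong[OF refl])
      fix i
      have "L (\<lambda>y. c k y * p i m y - c k (x i) * p i m y) =
          L (\<lambda>y. c k y * p i m y) - L (\<lambda>y. c k (x i) * p i m y)"
        by (intro L_diff continuous_intros cont p_cont)
      then show "L (\<lambda>y. c k y * p i m y) - c k (x i) * L (p i m) =
          L (\<lambda>y. (c k y - c k (x i)) * p i m y)"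
        using L_scale[OF p_cont, of "c k (x i)" i m] by (simp add: left_diff_distrib)
    qed
    finally have eq: "L (c k) - (\<Sum>i<n. L (p i m) * c k (x i)) =
        L (\<lambda>y. c k y * \<phi> n m y) + (\<Sum>i<n. L (\<lambda>y. (c k y - c k (x i)) * p i m y))" .
    have "\<bar>L (\<lambda>y. c k y * \<phi> n m y)\<bar> \<le> M * variation (\<phi> n m)"
      using M bound \<phi>_pos
      by (intro abs_L_le_scaled_variation continuous_intros cont \<phi>_cont)
        (auto simp: abs_mult mult_right_mono)
    also have "\<dots> \<le> M * \<delta>" using M n by (intro mult_left_mono)
    finally have 1: "\<bar>L (\<lambda>y. c k y * \<phi> n m y)\<bar> \<le> M * \<delta>" .
    have "\<bar>\<Sum>i<n. L (\<lambda>y. (c k y - c k (x i)) * p i m y)\<bar> \<le>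
        (\<Sum>i<n. \<bar>L (\<lambda>y. (c k y - c k (x i)) * p i m y)\<bar>)"
      by (rule sum_abs)
    also have "\<dots> \<le> (\<Sum>i<n. (\<epsilon> + 1 / real m) * variation (p i m))"
      using supp m \<open>0 \<le> \<epsilon>\<close>
      by (intro sum_mono abs_L_le_scaled_variation continuous_intros cont p_cont) auto
    also have "\<dots> \<le> (\<epsilon> + 1 / real m) * B"
      unfolding sum_distrib_left[symmetric] using vp_sum m \<open>0 \<le> \<epsilon>\<close> by (intro mult_left_mono) auto
    finally show ?thesis unfolding eq using 1 by linarith
  qed
  have "\<bar>L (c k) - (\<Sum>i<n. a i * c k (x i))\<bar> \<le> M * \<delta> + \<epsilon> * B" for k
  proof (rule LIMSEQ_le)
    show "(\<lambda>m. \<bar>L (c k) - (\<Sum>i<n. L (p i m) * c k (x i))\<bar>) \<longlonglongrightarrow>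
        \<bar>L (c k) - (\<Sum>i<n. a i * c k (x i))\<bar>"
      unfolding Lp a_def by (intro tendsto_intros l)
    have "(\<lambda>m. M * \<delta> + (\<epsilon> + 1 / real m) * B) \<longlonglongrightarrow> M * \<delta> + (\<epsilon> + 0) * B"
      by (intro tendsto_intros lim_1_over_n)
    then show "(\<lambda>m. M * \<delta> + (\<epsilon> + 1 / real m) * B) \<longlonglongrightarrow> M * \<delta> + \<epsilon> * B" by simp
    show "\<exists>N. \<forall>m\<ge>N. \<bar>L (c k) - (\<Sum>i<n. L (p i m) * c k (x i))\<bar> \<le> M * \<delta> + (\<epsilon> + 1 / real m) * B"
      using approx by (intro exI[of _ "Suc k"]) auto
  qed
  then show ?thesis by blast
qed

end

section \<open>Fragmentability and countable covers\<close>

text \<open>A minimal closed set \<open>Z\<close> whose image contains \<open>P\<close> transfers fragmentability from \<open>X\<close> to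
  the metrizable image \<open>P\<close>: if \<open>Q\<close> is open and meets \<open>Z\<close>, then the image of \<open>Q \<inter> Z\<close> contains a
  nonempty relatively open subset of \<open>P\<close>.\<close>

lemma minimal_closed_lift:
  fixes \<Phi> :: "'x::t2_space \<Rightarrow> 'y::t2_space"
  assumes comp: "compact (UNIV :: 'x set)" and cont: "continuous_on UNIV \<Phi>" and P: "P \<subseteq> range \<Phi>"
  obtains Z where "closed Z" "P \<subseteq> \<Phi> ` Z"
    "\<And>Z'. closed Z' \<Longrightarrow> Z' \<subseteq> Z \<Longrightarrow> P \<subseteq> \<Phi> ` Z' \<Longrightarrow> Z' = Z"
proof -
  let ?A = "{Z. closed Z \<and> P \<subseteq> \<Phi> ` Z}"
  let ?R = "\<lambda>a b :: 'x set. b \<subseteq> a"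
  have "\<exists>m\<in>?A. \<forall>a\<in>?A. ?R m a \<longrightarrow> a = m"
  proof (rule predicate_Zorn)
    show "partial_order_on ?A (relation_of ?R ?A)"
      by (rule partial_order_on_relation_ofI) auto
    fix C assume C: "C \<in> Chains (relation_of ?R ?A)"
    have CA: "C \<subseteq> ?A" and tot: "\<And>a b. a \<in> C \<Longrightarrow> b \<in> C \<Longrightarrow> a \<subseteq> b \<or> b \<subseteq> a"
      using C by (auto simp: Chains_def relation_of_def)
    \<comment> \<open>The fibre over \<open>p\<close> is compact and meets every member of the
      chain. It meets finite intersections as well, since a nonempty finite subfamily of a chain has
      a least member.\<close>
    have "p \<in> \<Phi> ` \<Inter>C" if p: "p \<in> P" for p
    proof -
      have cl: "closed (\<Phi> -` {p})"
        using cont by (simp add: continuous_closed_vimage continuous_on_eq_continuous_at)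
      have "\<Phi> -` {p} \<inter> \<Inter>C \<noteq> {}"
      proof (rule compact_imp_fip)
        show "compact (\<Phi> -` {p})"
          using compact_Int_closed[OF comp cl] by simp
        show "closed T" if "T \<in> C" for T using that CA by auto
        fix F' assume F': "finite F'" "F' \<subseteq> C"
        show "\<Phi> -` {p} \<inter> \<Inter>F' \<noteq> {}"
        proof (cases "F' = {}")
          case True
          then show ?thesis using p P by auto
        next
          case False
          have "subset.chain C F'" using F'(2) tot by (auto simp: subset_chain_def)
          then have "\<Inter>F' \<in> C" using Inter_in_chain[OF F'(1) False] F'(2) by blast
          then have "P \<subseteq> \<Phi> ` \<Inter>F'" using CA by blast
          then show ?thesis using p by blast
        qed
      qed
      then show ?thesis by blast
    qed
    moreover have "closed (\<Inter>C)" using CA by (intro closed_Inter) auto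
    ultimately have "\<Inter>C \<in> ?A" by blast
    then show "\<exists>u\<in>?A. \<forall>a\<in>C. u \<subseteq> a" by blast
  qed
  then obtain Z where "Z \<in> ?A" and min: "\<forall>a\<in>?A. a \<subseteq> Z \<longrightarrow> a = Z"
    by (elim bexE) (rule that)
  then have "closed Z" "P \<subseteq> \<Phi> ` Z" by simp_all
  then show thesis
  proof (rule that)
    fix Z' assume "closed Z'" "Z' \<subseteq> Z" "P \<subseteq> \<Phi> ` Z'"
    with min[rule_format, of Z'] show "Z' = Z" by simp
  qed
qed

text \<open>A Lindeloef argument in the second countable space of sequences, where
  \<open>\<Phi>\<close> sends a point to all its values \<open>c k\<close>. The basic open sets with
  coverable preimage have a union \<open>W\<close> with coverable preimage; if \<open>W\<close>
  missed part of the image, a minimal closed lift of that part and fragmentability would produce one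
  more such basic set meeting it.\<close>

lemma fragmented_imp_countable_cover:
  fixes c :: "nat \<Rightarrow> 'x::t2_space \<Rightarrow> real"
  assumes comp: "compact (UNIV :: 'x set)" and cont: "\<And>k. continuous_on UNIV (c k)"
    and frag: "\<And>Z. closed Z \<Longrightarrow> Z \<noteq> {} \<Longrightarrow>
      \<exists>Q. open Q \<and> Q \<inter> Z \<noteq> {} \<and> (\<forall>x\<in>Q \<inter> Z. \<forall>y\<in>Q \<inter> Z. \<forall>k. \<bar>c k x - c k y\<bar> \<le> \<epsilon>)"
  shows "\<exists>G. countable G \<and> UNIV \<subseteq> \<Union>G \<and> (\<forall>g\<in>G. \<forall>x\<in>g. \<forall>y\<in>g. \<forall>k. \<bar>c k x - c k y\<bar> \<le> \<epsilon>)"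
proof -
  define small where "small g \<longleftrightarrow> (\<forall>x\<in>g. \<forall>y\<in>g. \<forall>k. \<bar>c k x - c k y\<bar> \<le> \<epsilon>)" for g
  define coverable where "coverable S \<longleftrightarrow> (\<exists>G. countable G \<and> S \<subseteq> \<Union>G \<and> (\<forall>g\<in>G. small g))" for S
  have coverable_UN: "coverable (\<Union>S)" if S: "countable S" "\<And>s. s \<in> S \<Longrightarrow> coverable s" for S
  proof -
    obtain G where G: "\<And>s. s \<in> S \<Longrightarrow> countable (G s)" "\<And>s. s \<in> S \<Longrightarrow> s \<subseteq> \<Union>(G s)"
      "\<And>s. s \<in> S \<Longrightarrow> \<forall>g\<in>G s. small g"
      using S(2) unfolding coverable_def by metis
    have "countable (\<Union>s\<in>S. G s)" using S(1) G(1) by blast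
    moreover have "\<Union>S \<subseteq> \<Union>(\<Union>s\<in>S. G s)" using G(2) by blast
    ultimately show ?thesis unfolding coverable_def using G(3) by blast
  qed
  have coverable_mono: "coverable T" if "coverable S" "T \<subseteq> S" for S T
    using that unfolding coverable_def by blast
  have coverable_small: "coverable g" if "small g" for g
    unfolding coverable_def using that by (intro exI[of _ "{g}"]) simp
  define \<Phi> where "\<Phi> x = (\<lambda>k. c k x)" for x
  have \<Phi>: "continuous_on UNIV \<Phi>"
    using cont unfolding \<Phi>_def by (intro continuous_on_coordinatewise_then_product)
  obtain B :: "(nat \<Rightarrow> real) set set" where B: "countable B" "topological_basis B"
    using ex_countable_basis by blast
  define W where "W = \<Union>{b \<in> B. coverable (\<Phi> -` b)}"
  have W_cov: "coverable (\<Phi> -` W)"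
  proof -
    have "coverable (\<Union>((\<lambda>b. \<Phi> -` b) ` {b \<in> B. coverable (\<Phi> -` b)}))"
      using B(1) by (intro coverable_UN) auto
    then show ?thesis by (rule coverable_mono) (auto simp: W_def)
  qed
  have W_open: "open W"
    unfolding W_def using topological_basis_open[OF B(2)] by blast
  define P where "P = range \<Phi> - W"
  have "P = {}"
  proof (rule ccontr)
    assume "P \<noteq> {}"
    obtain Z where Z: "closed Z" "P \<subseteq> \<Phi> ` Z"
      and min: "\<And>Z'. closed Z' \<Longrightarrow> Z' \<subseteq> Z \<Longrightarrow> P \<subseteq> \<Phi> ` Z' \<Longrightarrow> Z' = Z"
      using minimal_closed_lift[OF comp \<Phi>, of P] unfolding P_def by (metis Diff_subset)
    have "Z \<noteq> {}" using Z \<open>P \<noteq> {}\<close> by auto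
    then obtain Q where Q: "open Q" "Q \<inter> Z \<noteq> {}"
      and Qs: "\<forall>x\<in>Q \<inter> Z. \<forall>y\<in>Q \<inter> Z. \<forall>k. \<bar>c k x - c k y\<bar> \<le> \<epsilon>"
      using frag[OF Z(1)] by blast
    have ZQ: "closed (Z - Q)" using Z Q by (intro closed_Diff)
    then have "compact (Z - Q)" using compact_Int_closed[OF comp] by simp
    then have "compact (\<Phi> ` (Z - Q))"
      by (intro compact_continuous_image continuous_on_subset[OF \<Phi>]) auto
    then have R: "open (- \<Phi> ` (Z - Q))" by (simp add: compact_imp_closed open_Compl)
    \<comment> \<open>\<open>Z - Q\<close> is a strictly smaller closed set, so by minimality its
      image misses some \<open>p\<close> in \<open>P\<close>; that image is compact, hence closed,
      and leaves room for a basic neighbourhood of \<open>p\<close>.\<close>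
    have "\<not> P \<subseteq> \<Phi> ` (Z - Q)" using min[OF ZQ] Q(2) by blast
    then obtain p where p: "p \<in> P" "p \<in> - \<Phi> ` (Z - Q)" by blast
    obtain b where b: "b \<in> B" "p \<in> b" "b \<subseteq> - \<Phi> ` (Z - Q)"
      using topological_basisE[OF B(2) R p(2)] by blast
    \<comment> \<open>Over \<open>b \<inter> P\<close> all values of \<open>\<Phi>\<close> are
      attained in \<open>Q \<inter> Z\<close>, and \<open>c k\<close> depends on
      \<open>\<Phi>\<close> alone; so the whole preimage is small, although only
      \<open>Q \<inter> Z\<close> was assumed to be.\<close>
    have "b \<inter> P \<subseteq> \<Phi> ` (Q \<inter> Z)" using b(3) Z(2) by blast
    then have sm: "small (\<Phi> -` (b \<inter> P))"
      unfolding small_def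
    proof (intro ballI allI)
      fix x y k assume *: "b \<inter> P \<subseteq> \<Phi> ` (Q \<inter> Z)" "x \<in> \<Phi> -` (b \<inter> P)" "y \<in> \<Phi> -` (b \<inter> P)"
      have "\<Phi> x \<in> \<Phi> ` (Q \<inter> Z)" "\<Phi> y \<in> \<Phi> ` (Q \<inter> Z)" using * by blast+
      then obtain x' y' where x': "x' \<in> Q \<inter> Z" "\<Phi> x = \<Phi> x'" and y': "y' \<in> Q \<inter> Z" "\<Phi> y = \<Phi> y'"
        by (elim imageE) (rule that)
      have "c k x = c k x'" "c k y = c k y'"
        using fun_cong[OF x'(2), of k] fun_cong[OF y'(2), of k] by (simp_all add: \<Phi>_def)
      then show "\<bar>c k x - c k y\<bar> \<le> \<epsilon>" using Qs x'(1) y'(1) by simp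
    qed
    have "coverable (\<Union>{\<Phi> -` (b \<inter> P), \<Phi> -` W})"
      using coverable_small[OF sm] W_cov by (intro coverable_UN) auto
    then have "coverable (\<Phi> -` b)" by (rule coverable_mono) (auto simp: P_def)
    then have "p \<in> W" using b by (auto simp: W_def)
    then show False using p(1) by (simp add: P_def)
  qed
  then have "\<Phi> -` W = UNIV" by (auto simp: P_def)
  then show ?thesis using W_cov unfolding coverable_def small_def by simp
qed

text \<open>If \<open>A\<close> is nowhere small, splitting open sets repeatedly yields a Cantor tree whose
  branches are separated by the countably many functions attached to its nodes.\<close>

lemma countably_small_imp_fragmented:
  fixes M :: "('x::topological_space \<Rightarrow>\<^sub>C real) set"
  assumes comp: "compact (UNIV :: 'x set)"
    and small: "\<And>C \<epsilon>. countable C \<Longrightarrow> C \<subseteq> M \<Longrightarrow> C \<noteq> {} \<Longrightarrow> 0 < \<epsilon> \<Longrightarrow>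
      \<exists>G :: nat \<Rightarrow> 'x set. (\<Union>n. G n) = UNIV \<and> (\<forall>n. \<forall>x\<in>G n. \<forall>y\<in>G n. \<forall>c\<in>C. \<bar>c x - c y\<bar> < \<epsilon>)"
    and U: "UNIV \<in> \<U>"
      "\<And>Q c t e. Q \<in> \<U> \<Longrightarrow> c \<in> M \<Longrightarrow> Q \<inter> {z. \<bar>apply_bcontfun c z - t\<bar> < e} \<in> \<U>"
    and "A \<noteq> {}" "0 < \<epsilon>"
  shows "\<exists>Q\<in>\<U>. Q \<inter> A \<noteq> {} \<and> (\<forall>x\<in>Q \<inter> A. \<forall>y\<in>Q \<inter> A. \<forall>c\<in>M. \<bar>c x - c y\<bar> \<le> \<epsilon>)"
proof (rule ccontr)
  assume contr: "\<not> ?thesis"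
  \<comment> \<open>\<open>\<U>\<close> is a class of sets closed under the cuts of the tree and not
    a topology, so that it can later consist of preimages of weak-star open sets.\<close>
  define N where "N = {Q \<in> \<U>. Q \<inter> A \<noteq> {}}"
  \<comment> \<open>Two points with values more than \<open>\<epsilon>\<close> apart: cutting at
    radius \<open>\<epsilon> / 3\<close> around either value leaves a gap of at least
    \<open>\<epsilon> / 3\<close>, even between the closures, where compactness will place the limit
    points.\<close>
  have step: "\<exists>c u. c \<in> M \<and> (\<forall>b::bool. u b \<in> N \<and> u b \<subseteq> Q) \<and>
      (\<forall>x\<in>closure (u True). \<forall>y\<in>closure (u False). \<epsilon> / 3 \<le> \<bar>apply_bcontfun c x - c y\<bar>)" if Q: "Q \<in> N" for Q
  proof -
    obtain x y c where xy: "x \<in> Q \<inter> A" "y \<in> Q \<inter> A" "c \<in> M" "\<epsilon> < \<bar>apply_bcontfun c x - c y\<bar>"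
      using contr Q unfolding N_def bex_simps ball_simps not_le[symmetric] by blast
    define u where "u b = Q \<inter> {z. \<bar>apply_bcontfun c z - c (if b then x else y)\<bar> < \<epsilon> / 3}" for b :: bool
    have "u b \<in> N \<and> u b \<subseteq> Q" for b
    proof -
      have "(if b then x else y) \<in> u b \<inter> A" using xy \<open>0 < \<epsilon>\<close> by (simp add: u_def)
      moreover have "u b \<in> \<U>" using Q xy(3) unfolding N_def u_def by (intro U(2)) auto
      ultimately show ?thesis unfolding N_def u_def by blast
    qed
    moreover have cl: "\<bar>apply_bcontfun c z - c (if b then x else y)\<bar> \<le> \<epsilon> / 3" if "z \<in> closure (u b)" for z b
    proof -
      have "closed {z. \<bar>apply_bcontfun c z - c (if b then x else y)\<bar> \<le> \<epsilon> / 3}"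
        by (intro closed_Collect_le continuous_intros) auto
      then have "closure (u b) \<subseteq> {z. \<bar>apply_bcontfun c z - c (if b then x else y)\<bar> \<le> \<epsilon> / 3}"
        by (intro closure_minimal) (auto simp: u_def)
      then show ?thesis using that by blast
    qed
    have "\<epsilon> / 3 \<le> \<bar>apply_bcontfun c z - c z'\<bar>" if "z \<in> closure (u True)" "z' \<in> closure (u False)" for z z'
      using cl[OF that(1)] cl[OF that(2)] xy(4) by (simp only: if_True if_False)
    ultimately show ?thesis using xy(3) by blast
  qed
  then obtain cc g where cc: "\<And>Q. Q \<in> N \<Longrightarrow> cc Q \<in> M"
    and g: "\<And>Q b. Q \<in> N \<Longrightarrow> g Q (b::bool) \<in> N" "\<And>Q b. Q \<in> N \<Longrightarrow> g Q b \<subseteq> Q"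
    and sep: "\<And>Q x y. Q \<in> N \<Longrightarrow> x \<in> closure (g Q True) \<Longrightarrow> y \<in> closure (g Q False) \<Longrightarrow>
      \<epsilon> / 3 \<le> \<bar>apply_bcontfun (cc Q) x - cc Q y\<bar>"
    by metis
  \<comment> \<open>Nodes are bit lists with the newest bit at the head, so \<open>pre b n\<close>
    below is the reversed prefix of length \<open>n\<close> of the branch \<open>b\<close>.\<close>
  define T where "T = rec_list UNIV (\<lambda>b l Q. g Q b)"
  have T_Nil: "T [] = UNIV" and T_Cons: "T (b # l) = g (T l) b" for b l
    by (simp_all add: T_def)
  have TN: "T l \<in> N" for l
    by (induction l) (use U(1) \<open>A \<noteq> {}\<close> g(1) in \<open>auto simp: T_Nil T_Cons N_def\<close>)
  define pre where "pre b = rec_nat [] (\<lambda>n l. b n # l)" for b :: "nat \<Rightarrow> bool"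
  have pre_0: "pre b 0 = []" and pre_Suc: "pre b (Suc n) = b n # pre b n" for b n
    by (simp_all add: pre_def)
  have pre_cong: "pre b n = pre b' n" if "\<And>k. k < n \<Longrightarrow> b k = b' k" for b b' n
    using that by (induction n) (auto simp: pre_0 pre_Suc)
  have T_dec: "T (pre b m) \<subseteq> T (pre b n)" if "n \<le> m" for b n m
    using that
  proof (induction m rule: dec_induct)
    case (step m)
    then show ?case using g(2)[OF TN] by (auto simp: pre_Suc T_Cons)
  qed simp
  have "\<exists>x. \<forall>n. x \<in> closure (T (pre b n))" for b
  proof -
    have "UNIV \<inter> \<Inter>(range (\<lambda>n. closure (T (pre b n)))) \<noteq> {}"
    proof (rule compact_imp_fip[OF comp])
      show "closed K" if "K \<in> range (\<lambda>n. closure (T (pre b n)))" for K using that by auto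
      fix F' assume F': "finite F'" "F' \<subseteq> range (\<lambda>n. closure (T (pre b n)))"
      obtain I where I: "finite I" "F' = (\<lambda>n. closure (T (pre b n))) ` I"
        using finite_subset_image[OF F'] by blast
      define m where "m = Max (insert 0 I)"
      have "T (pre b m) \<subseteq> T (pre b n)" if "n \<in> I" for n
        using that I(1) by (intro T_dec) (simp add: m_def)
      then have "T (pre b m) \<subseteq> \<Inter>F'" using I(2) closure_subset by blast
      moreover have "T (pre b m) \<noteq> {}" using TN[of "pre b m"] by (auto simp: N_def)
      ultimately show "UNIV \<inter> \<Inter>F' \<noteq> {}" by auto
    qed
    then show ?thesis by blast
  qed
  then obtain x where x: "\<And>b n. x b \<in> closure (T (pre b n))" by metis
  \<comment> \<open>The tree has only countably many nodes, so countable smallness applies to the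
    functions attached to them. Two branches split at a first node, whose function keeps their
    points \<open>\<epsilon> / 3\<close> apart; no cover set contains both.\<close>
  define C where "C = range (\<lambda>l. cc (T l))"
  have "countable C" "C \<subseteq> M" "C \<noteq> {}" unfolding C_def using cc[OF TN] by auto
  then obtain G :: "nat \<Rightarrow> 'x set" where G: "(\<Union>n. G n) = UNIV"
    "\<forall>n. \<forall>x\<in>G n. \<forall>y\<in>G n. \<forall>c\<in>C. \<bar>c x - c y\<bar> < \<epsilon> / 3"
    using small[of C "\<epsilon> / 3"] \<open>0 < \<epsilon>\<close> by auto
  have "\<exists>k. x b \<in> G k" for b using G(1) by blast
  then obtain k where k: "\<And>b. x b \<in> G (k b)" by metis
  have "b = b'" if kk: "k b = k b'" for b b'
  proof (rule ccontr)
    assume "b \<noteq> b'"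
    then have ex: "\<exists>n. b n \<noteq> b' n" by blast
    define n where "n = (LEAST n. b n \<noteq> b' n)"
    have n: "b n \<noteq> b' n" and "\<And>i. i < n \<Longrightarrow> b i = b' i"
      using LeastI_ex[OF ex] not_less_Least unfolding n_def by blast+
    then have l: "pre b' n = pre b n" by (intro pre_cong) simp
    let ?Q = "T (pre b n)"
    have "x b \<in> closure (g ?Q (b n))" "x b' \<in> closure (g ?Q (b' n))"
      using x[of b "Suc n"] x[of b' "Suc n"] by (simp_all add: pre_Suc T_Cons l)
    then have "\<epsilon> / 3 \<le> \<bar>apply_bcontfun (cc ?Q) (x b) - cc ?Q (x b')\<bar>"
      using sep[OF TN, of "x b" "pre b n" "x b'"] sep[OF TN, of "x b'" "pre b n" "x b"] n
      by (cases "b n"; cases "b' n") (auto simp: abs_minus_commute)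
    moreover have "\<bar>apply_bcontfun (cc ?Q) (x b) - cc ?Q (x b')\<bar> < \<epsilon> / 3"
      using G(2) k[of b] k[of b'] kk unfolding C_def by simp
    ultimately show False by linarith
  qed
  then have "inj k" by (rule injI)
  \<comment> \<open>Cantor's diagonal: \<open>k\<close> would inject the bit sequences into
    \<open>nat\<close>.\<close>
  define d where "d n = (\<not> inv k n n)" for n
  have "inv k (k d) = d" using \<open>inj k\<close> by (rule inv_f_f)
  then show False using d_def[of "k d"] by simp
qed

section \<open>Functionals on \<open>C(X)\<close> and the pseudometrics given by sets of
  functions\<close>

lemma bounded_linear_apply_bcontfun:
  "bounded_linear (\<lambda>f :: 'x::topological_space \<Rightarrow>\<^sub>C real. apply_bcontfun f x)"
proof (rule bounded_linear_intro[of _ 1])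
  show "norm (apply_bcontfun f x) \<le> norm f * 1" for f :: "'x \<Rightarrow>\<^sub>C real"
    using norm_bounded[of f x] by simp
qed simp_all

lemma bcontfun_compact:
  assumes "compact (UNIV :: 'x::topological_space set)" "continuous_on UNIV (g :: 'x \<Rightarrow> 'a::metric_space)"
  shows "g \<in> bcontfun"
  unfolding bcontfun_def using assms compact_imp_bounded[OF compact_continuous_image[of UNIV g]] by simp

lemma apply_Bcontfun_compact:
  assumes "compact (UNIV :: 'x::topological_space set)" "continuous_on UNIV (g :: 'x \<Rightarrow> 'a::metric_space)"
  shows "apply_bcontfun (Bcontfun g) = g"
  using bcontfun_compact[OF assms] by (rule Bcontfun_inverse)

lemma continuous_functional_of_dual:
  fixes \<xi> :: "('x::topological_space \<Rightarrow>\<^sub>C real) \<Rightarrow> real"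
  assumes comp: "compact (UNIV :: 'x set)" and \<xi>: "bounded_linear \<xi>" and B: "\<And>g. \<bar>\<xi> g\<bar> \<le> B * norm g" "0 \<le> B"
  shows "continuous_functional (\<lambda>g. \<xi> (Bcontfun g)) B"
proof
  interpret bounded_linear \<xi> by (rule \<xi>)
  note ap = apply_Bcontfun_compact[OF comp]
  show "compact (UNIV :: 'x set)" by (rule comp)
  fix g h :: "'x \<Rightarrow> real" and r :: real assume g: "continuous_on UNIV g"
  show "\<xi> (Bcontfun (\<lambda>x. g x + h x)) = \<xi> (Bcontfun g) + \<xi> (Bcontfun h)" if h: "continuous_on UNIV h"
  proof -
    have "Bcontfun (\<lambda>x. g x + h x) = Bcontfun g + Bcontfun h"
      using g h by (intro bcontfun_eqI) (simp add: ap continuous_on_add)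
    then show ?thesis by (simp add: add)
  qed
  have "Bcontfun (\<lambda>x. r * g x) = r *\<^sub>R Bcontfun g"
    using g by (intro bcontfun_eqI) (simp add: ap continuous_on_mult_left)
  then show "\<xi> (Bcontfun (\<lambda>x. r * g x)) = r * \<xi> (Bcontfun g)" by (simp add: scale)
  show "\<bar>\<xi> (Bcontfun g)\<bar> \<le> B * r" if "\<And>x. \<bar>g x\<bar> \<le> r"
  proof -
    have "norm (Bcontfun g) \<le> r" by (rule norm_bound) (use that g in \<open>simp add: ap\<close>)
    then show ?thesis using B(1)[of "Bcontfun g"] mult_left_mono[OF _ B(2)] order.trans by blast
  qed
qed

abbreviation sup_dist :: "'a set \<Rightarrow> ('a \<Rightarrow> real) \<Rightarrow> ('a \<Rightarrow> real) \<Rightarrow> real" where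
  "sup_dist C \<xi> \<eta> \<equiv> (SUP c\<in>C. \<bar>\<xi> c - \<eta> c\<bar>)"

text \<open>This is \<open>sup_dist C\<close> between the evaluation functionals at \<open>x\<close>
  and \<open>y\<close>.\<close>

abbreviation point_dist :: "('x::topological_space \<Rightarrow>\<^sub>C real) set \<Rightarrow> 'x \<Rightarrow> 'x \<Rightarrow> real" where
  "point_dist C x y \<equiv> (SUP c\<in>C. \<bar>apply_bcontfun c x - apply_bcontfun c y\<bar>)"

lemma bdd_above_bounded_functional_diff:
  fixes \<xi> \<eta> :: "'a::real_normed_vector \<Rightarrow> real"
  assumes "bounded_linear \<xi>" "bounded_linear \<eta>" "\<And>c. c \<in> C \<Longrightarrow> norm c \<le> K"
  shows "bdd_above ((\<lambda>c. \<bar>\<xi> c - \<eta> c\<bar>) ` C)"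
proof -
  obtain b where b: "0 \<le> b" "\<And>x. norm (\<xi> x - \<eta> x) \<le> norm x * b"
    using bounded_linear.nonneg_bounded[OF bounded_linear_sub[OF assms(1,2)]] by blast
  have "\<bar>\<xi> c - \<eta> c\<bar> \<le> K * b" if "c \<in> C" for c
    using b(2)[of c] mult_right_mono[OF assms(3)[OF that] b(1)] by simp
  then show ?thesis by (rule bdd_aboveI2)
qed

lemma bdd_above_bcontfun_diff:
  assumes "\<And>c. c \<in> C \<Longrightarrow> norm (c :: 'x::topological_space \<Rightarrow>\<^sub>C real) \<le> K"
  shows "bdd_above ((\<lambda>c. \<bar>apply_bcontfun c x - c y\<bar>) ` C)"
proof (rule bdd_aboveI2)
  fix c assume "c \<in> C"
  then show "\<bar>apply_bcontfun c x - c y\<bar> \<le> K + K"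
    using assms[of c] norm_bounded[of c x] norm_bounded[of c y] by (simp add: abs_le_iff)
qed

text \<open>Rational combinations of evaluations along a dense sequence of points form the countable
  dense set: approximation by point evaluations supplies real coefficients, which are then
  rounded.\<close>

lemma separable_points_imp_separable_dual:
  fixes C :: "('x::topological_space \<Rightarrow>\<^sub>C real) set"
  assumes comp: "compact (UNIV :: 'x set)" and C: "countable C" "C \<noteq> {}" and K: "\<And>c. c \<in> C \<Longrightarrow> norm c \<le> K"
    and sep: "separable_for UNIV (point_dist C)"
  shows "separable_for (dual UNIV norm) (sup_dist C)"
proof -
  have K0: "0 \<le> K" using C(2) K by (meson all_not_in_conv norm_ge_zero order.trans)
  obtain D where D: "countable D"
    "\<And>x \<epsilon>. 0 < \<epsilon> \<Longrightarrow> \<exists>y\<in>D. point_dist C x y < \<epsilon>"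
    using sep unfolding separable_for_def by (metis UNIV_I)
  have "D \<noteq> {}" using D(2)[of 1] by force
  define x where "x = from_nat_into D"
  have x: "range x = D" unfolding x_def using D(1) \<open>D \<noteq> {}\<close> by (rule range_from_nat_into[rotated])
  define c where "c = from_nat_into C"
  have c: "range c = C" unfolding c_def using C by (intro range_from_nat_into)
  have cK: "norm (c k) \<le> K" for k using K c by blast
  have cb: "\<bar>apply_bcontfun (c k) y\<bar> \<le> K" for k y
    using norm_bounded[of "c k" y] cK[of k] by simp
  define ev where "ev q = (\<lambda>f :: 'x \<Rightarrow>\<^sub>C real. \<Sum>i<length q. real_of_rat (q ! i) * f (x i))" for q
  have bl_ev: "bounded_linear (ev q)" for q
  proof -
    show ?thesis unfolding ev_def
      by (intro bounded_linear_sum bounded_linear_const_mult bounded_linear_apply_bcontfun)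
  qed
  have "\<exists>\<eta>\<in>range ev. sup_dist C \<xi> \<eta> < \<epsilon>" if \<xi>: "\<xi> \<in> dual UNIV norm" and "0 < \<epsilon>" for \<xi> \<epsilon>
  proof -
    have bl: "bounded_linear \<xi>" using \<xi> by (simp add: dual_UNIV)
    obtain B where B: "0 \<le> B" "\<And>g. \<bar>\<xi> g\<bar> \<le> B * norm g"
      using bounded_linear.nonneg_bounded[OF bl] by (metis mult.commute real_norm_def)
    interpret continuous_functional "\<lambda>g. \<xi> (Bcontfun g)" B
      by (rule continuous_functional_of_dual[OF comp bl B(2) B(1)])
    \<comment> \<open>Three errors of at most \<open>\<epsilon> / 8\<close> each: the discarded
      variation (\<open>\<delta>\<close>), the oscillation on the cover (\<open>\<epsilon>'\<close>)
      and the rounding of coefficients (\<open>\<mu>\<close>). The added ones keep denominators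
      positive.\<close>
    define \<epsilon>' where "\<epsilon>' = \<epsilon> / (8 * (B + 1))"
    define \<delta> where "\<delta> = \<epsilon> / (8 * (K + 1))"
    have pos: "0 < \<epsilon>'" "0 < \<delta>" using \<open>0 < \<epsilon>\<close> B(1) K0 by (auto simp: \<epsilon>'_def \<delta>_def)
    have small: "K * \<delta> \<le> \<epsilon> / 8" "\<epsilon>' * B \<le> \<epsilon> / 8"
      using \<open>0 < \<epsilon>\<close> B(1) K0 by (auto simp: \<epsilon>'_def \<delta>_def field_simps)
    have cover: "\<exists>i. \<forall>k. \<bar>apply_bcontfun (c k) y - c k (x i)\<bar> \<le> \<epsilon>'" for y
    proof -
      obtain i where i: "point_dist C y (x i) < \<epsilon>'"
        using D(2)[OF pos(1), of y] unfolding x[symmetric] by blast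
      have "\<bar>apply_bcontfun (c k) y - c k (x i)\<bar> \<le> point_dist C y (x i)" for k
        using K c by (intro cSUP_upper bdd_above_bcontfun_diff) auto
      then show ?thesis using i by (meson less_imp_le order.trans)
    qed
    obtain n a where na: "\<And>k. \<bar>\<xi> (Bcontfun (c k)) - (\<Sum>i<n. a i * c k (x i))\<bar> \<le> K * \<delta> + \<epsilon>' * B"
      using approximated_by_point_evaluations[where c = "\<lambda>k. apply_bcontfun (c k)" and x = x and M = K,
          OF _ cb cover pos(2) less_imp_le[OF pos(1)]] by auto
    define \<mu> where "\<mu> = \<epsilon> / (8 * (real n + 1) * (K + 1))"
    have \<mu>: "0 < \<mu>" "real n * (\<mu> * K) \<le> \<epsilon> / 8"
    proof -
      show "0 < \<mu>" using \<open>0 < \<epsilon>\<close> K0 by (simp add: \<mu>_def)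
      have "real n * (\<mu> * K) = \<epsilon> / 8 * (real n / (real n + 1)) * (K / (K + 1))"
        by (simp add: \<mu>_def)
      also have "\<dots> \<le> \<epsilon> / 8 * 1 * 1"
        using \<open>0 < \<epsilon>\<close> K0 by (intro mult_mono) (auto simp: field_simps)
      finally show "real n * (\<mu> * K) \<le> \<epsilon> / 8" by simp
    qed
    have "\<exists>q. \<bar>a i - real_of_rat q\<bar> \<le> \<mu>" for i
    proof -
      obtain q where "a i - \<mu> < real_of_rat q" "real_of_rat q < a i + \<mu>"
        using of_rat_dense[of "a i - \<mu>" "a i + \<mu>"] \<mu>(1) by auto
      then show ?thesis by (intro exI[of _ q]) (simp add: abs_le_iff)
    qed
    then obtain q where q: "\<And>i. \<bar>a i - real_of_rat (q i)\<bar> \<le> \<mu>" by metis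
    let ?q = "map q [0..<n]"
    have "\<bar>\<xi> (c k) - ev ?q (c k)\<bar> \<le> \<epsilon> / 2" for k
    proof -
      have "\<bar>(\<Sum>i<n. a i * c k (x i)) - ev ?q (c k)\<bar> = \<bar>\<Sum>i<n. (a i - real_of_rat (q i)) * c k (x i)\<bar>"
        by (simp add: ev_def sum_subtractf left_diff_distrib)
      also have "\<dots> \<le> (\<Sum>i<n. \<bar>(a i - real_of_rat (q i)) * c k (x i)\<bar>)" by (rule sum_abs)
      also have "\<dots> \<le> (\<Sum>i<n. \<mu> * K)"
        unfolding abs_mult using q cb \<mu>(1) by (intro sum_mono mult_mono) auto
      also have "\<dots> \<le> \<epsilon> / 8" using \<mu>(2) by simp
      finally have "\<bar>(\<Sum>i<n. a i * c k (x i)) - ev ?q (c k)\<bar> \<le> \<epsilon> / 8" .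
      moreover have "\<bar>\<xi> (c k) - (\<Sum>i<n. a i * c k (x i))\<bar> \<le> \<epsilon> / 8 + \<epsilon> / 8"
        using na[of k] small by (simp add: apply_bcontfun_inverse)
      ultimately show ?thesis using \<open>0 < \<epsilon>\<close> by linarith
    qed
    then have "sup_dist C \<xi> (ev ?q) \<le> \<epsilon> / 2"
      using c C(2) by (intro cSUP_least) auto
    then show ?thesis using \<open>0 < \<epsilon>\<close> by (intro bexI[of _ "ev ?q"]) auto
  qed
  moreover have "countable (range ev)" "range ev \<subseteq> dual UNIV norm"
    using bl_ev by (auto simp: dual_UNIV)
  ultimately show ?thesis unfolding separable_for_def by blast
qed

section \<open>Normed spaces with explicit carrier\<close>

lemma normed_onD:
  assumes "normed_on V N"
  shows "subspace V" "\<And>x. x \<in> V \<Longrightarrow> 0 \<le> N x" "\<And>x. x \<in> V \<Longrightarrow> N x = 0 \<Longrightarrow> x = 0"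
    "\<And>x y. x \<in> V \<Longrightarrow> y \<in> V \<Longrightarrow> N (x + y) \<le> N x + N y"
    "\<And>c x. x \<in> V \<Longrightarrow> N (c *\<^sub>R x) = \<bar>c\<bar> * N x"
    "N 0 = 0"
  using assms by (auto simp: normed_on_def subspace_0)

lemma normed_on_minus_commute:
  assumes "normed_on V N" "x \<in> V" "y \<in> V"
  shows "N (x - y) = N (y - x)"
  using normed_onD(5)[OF assms(1), of "x - y" "-1"] normed_onD(1)[OF assms(1)] assms
  by (simp add: subspace_diff)

lemma banach_on_iff:
  "banach_on V N \<longleftrightarrow> normed_on V N \<and> (\<forall>\<sigma> :: nat \<Rightarrow> _. (\<forall>n. \<sigma> n \<in> V) \<longrightarrow>
     (\<forall>e>0. \<exists>M. \<forall>m n. M \<le> m \<longrightarrow> M \<le> n \<longrightarrow> N (\<sigma> m - \<sigma> n) < e) \<longrightarrow>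
     (\<exists>x\<in>V. \<forall>e>0. \<exists>M. \<forall>n\<ge>M. N (\<sigma> n - x) < e))"
proof (cases "normed_on V N")
  case True
  interpret Metric_space V "norm_dist V N" by (rule Metric_space_norm_dist[OF True])
  have cau: "MCauchy \<sigma> \<longleftrightarrow> (\<forall>n. \<sigma> n \<in> V) \<and>
      (\<forall>e>0. \<exists>M. \<forall>m n. M \<le> m \<longrightarrow> M \<le> n \<longrightarrow> N (\<sigma> m - \<sigma> n) < e)" for \<sigma> :: "nat \<Rightarrow> 'a"
    unfolding MCauchy_def norm_dist_def by (auto simp: image_subset_iff)
  have "limitin mtopology \<sigma> x sequentially \<longleftrightarrow>
      x \<in> V \<and> (\<forall>e>0. \<exists>M. \<forall>n\<ge>M. N (\<sigma> n - x) < e)" if "\<forall>n. \<sigma> n \<in> V" for \<sigma> x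
    using that by (auto simp: limit_metric_sequentially norm_dist_def)
  then have lim': "(\<exists>x. limitin mtopology \<sigma> x sequentially) \<longleftrightarrow>
      (\<exists>x\<in>V. \<forall>e>0. \<exists>M. \<forall>n\<ge>M. N (\<sigma> n - x) < e)" if "\<forall>n. \<sigma> n \<in> V" for \<sigma> :: "nat \<Rightarrow> 'a"
    using that unfolding Bex_def by presburger
  then have "(MCauchy \<sigma> \<longrightarrow> (\<exists>x. limitin mtopology \<sigma> x sequentially)) \<longleftrightarrow> ((\<forall>n. \<sigma> n \<in> V) \<longrightarrow>
     (\<forall>e>0. \<exists>M. \<forall>m n. M \<le> m \<longrightarrow> M \<le> n \<longrightarrow> N (\<sigma> m - \<sigma> n) < e) \<longrightarrow>
     (\<exists>x\<in>V. \<forall>e>0. \<exists>M. \<forall>n\<ge>M. N (\<sigma> n - x) < e))" for \<sigma>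
    unfolding cau imp_conjL using lim'[of \<sigma>] by (cases "\<forall>n. \<sigma> n \<in> V") (simp_all only: simp_thms)
  then show ?thesis
    unfolding banach_on_def mcomplete_def by (simp only:)
qed (simp add: banach_on_def)

lemma op_norm_bound:
  assumes V: "normed_on V N" and W: "normed_on W M" and \<sigma>: "\<sigma> \<in> bounded_ops V N W M" and x: "x \<in> V"
  shows "M (\<sigma> x) \<le> op_norm V N M \<sigma> * N x"
proof (cases "N x = 0")
  case True
  then have "x = 0" using normed_onD(3)[OF V x] by simp
  moreover have "\<sigma> (0 *\<^sub>R x) = 0 *\<^sub>R \<sigma> x" using \<sigma> x unfolding bounded_ops_def by blast
  ultimately show ?thesis using True normed_onD(6)[OF W] by simp
next
  case False
  then have N: "0 < N x" using normed_onD(2)[OF V x] by simp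
  obtain K where K: "\<And>y. y \<in> V \<Longrightarrow> M (\<sigma> y) \<le> K * N y" using \<sigma> unfolding bounded_ops_def by blast
  have bdd: "bdd_above ((\<lambda>y. M (\<sigma> y)) ` {y \<in> V. N y \<le> 1})"
  proof (rule bdd_aboveI2)
    fix y assume y: "y \<in> {y \<in> V. N y \<le> 1}"
    then have "K * N y \<le> \<bar>K\<bar> * 1" using normed_onD(2)[OF V] by (intro mult_mono) auto
    then show "M (\<sigma> y) \<le> \<bar>K\<bar>" using K[of y] y by simp
  qed
  let ?y = "inverse (N x) *\<^sub>R x"
  have "?y \<in> V" using x normed_onD(1)[OF V] by (simp add: subspace_scale)
  moreover have "N ?y = 1" using normed_onD(5)[OF V x, of "inverse (N x)"] N by simp
  ultimately have "M (\<sigma> ?y) \<le> op_norm V N M \<sigma>"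
    unfolding op_norm_def using bdd by (intro cSUP_upper) auto
  moreover have "\<sigma> ?y = inverse (N x) *\<^sub>R \<sigma> x" using \<sigma> x unfolding bounded_ops_def by blast
  moreover have "\<sigma> x \<in> W" using \<sigma> x unfolding bounded_ops_def by blast
  ultimately have "M (\<sigma> x) / N x \<le> op_norm V N M \<sigma>"
    using normed_onD(5)[OF W, of "\<sigma> x" "inverse (N x)"] N by (simp add: divide_inverse_commute)
  then show ?thesis using N by (simp add: pos_divide_le_eq)
qed

lemma op_norm_le:
  assumes V: "normed_on V N" and "\<And>x. x \<in> V \<Longrightarrow> N x \<le> 1 \<Longrightarrow> M (\<sigma> x) \<le> c"
  shows "op_norm V N M \<sigma> \<le> c"
proof -
  have "0 \<in> {x \<in> V. N x \<le> 1}" using normed_onD(1,6)[OF V] by (simp add: subspace_0)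
  then show ?thesis unfolding op_norm_def using assms(2) by (intro cSUP_least) auto
qed

lemma normed_on_abs: "normed_on (UNIV :: real set) abs"
  by (simp add: normed_on_def abs_mult abs_triangle_ineq)

lemma normed_on_subspace: "normed_on V N \<Longrightarrow> subspace W \<Longrightarrow> W \<subseteq> V \<Longrightarrow> normed_on W N"
  by (simp add: normed_on_def subset_eq)

section \<open>Interpolation between a convex set and the unit ball\<close>

text \<open>A \<open>c\<^sub>0\<close>-version of the Davis-Figiel-Johnson-Pelczynski construction.\<close>

locale interpolation =
  fixes W :: "'a::real_normed_vector set"
  assumes complete_UNIV: "complete (UNIV :: 'a set)"
    and convex_W: "convex W" and W_nonempty: "W \<noteq> {}"
    and W_minus: "w \<in> W \<Longrightarrow> - w \<in> W" and norm_W: "w \<in> W \<Longrightarrow> norm w \<le> 1"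
begin

text \<open>Up to a factor of two, the Minkowski gauge of \<open>2 ^ n\<close> times
  \<open>W\<close> plus the ball of radius \<open>1 / 2 ^ n\<close>. In this additive form,
  subadditivity amounts to adding two decompositions.\<close>

definition cost :: "nat \<Rightarrow> 'a \<Rightarrow> real" where
  "cost n v = (INF (r, w)\<in>{0..} \<times> W. r / 2 ^ n + 2 ^ n * norm (v - r *\<^sub>R w))"

lemma zero_W: "0 \<in> W"
proof -
  obtain w where "w \<in> W" using W_nonempty by blast
  then have "(1/2) *\<^sub>R w + (1/2) *\<^sub>R (- w) \<in> W"
    using convexD[OF convex_W, of w "- w" "1/2" "1/2"] W_minus by simp
  then show ?thesis by simp
qed

lemma cost_le: "0 \<le> r \<Longrightarrow> w \<in> W \<Longrightarrow> cost n v \<le> r / 2 ^ n + 2 ^ n * norm (v - r *\<^sub>R w)"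
  unfolding cost_def
  by (rule order.trans[OF cINF_lower[of _ _ "(r, w)"]]) (auto intro!: bdd_belowI2[of _ 0])

lemma cost_ge:
  assumes "\<And>r w. 0 \<le> r \<Longrightarrow> w \<in> W \<Longrightarrow> l \<le> r / 2 ^ n + 2 ^ n * norm (v - r *\<^sub>R w)"
  shows "l \<le> cost n v"
  unfolding cost_def using zero_W assms by (intro cINF_greatest) auto

lemma cost_lessE:
  assumes "cost n v < s"
  obtains r w where "0 \<le> r" "w \<in> W" "r / 2 ^ n + 2 ^ n * norm (v - r *\<^sub>R w) < s"
  using assms cost_ge[of s n v] by (meson not_le)

lemma cost_nonneg: "0 \<le> cost n v"
  by (rule cost_ge) simp

lemma cost_le_norm: "cost n v \<le> 2 ^ n * norm v"
  using cost_le[of 0 0 n v] zero_W by simp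

lemma norm_le_cost: "norm v \<le> 2 ^ n * cost n v"
proof -
  have "norm v / 2 ^ n \<le> cost n v"
  proof (rule cost_ge)
    fix r :: real and w assume r: "0 \<le> r" and w: "w \<in> W"
    have "norm v \<le> norm (v - r *\<^sub>R w) + norm (r *\<^sub>R w)" using norm_triangle_sub[of v "r *\<^sub>R w"] by simp
    also have "norm (r *\<^sub>R w) \<le> r" using r norm_W[OF w] by (simp add: mult_left_le)
    also have "norm (v - r *\<^sub>R w) \<le> 2 ^ n * (2 ^ n * norm (v - r *\<^sub>R w))"
    proof -
      have "1 \<le> (2 ^ n * 2 ^ n :: real)" using mult_mono[of 1 "2 ^ n" 1 "2 ^ n :: real"] by simp
      then show ?thesis using mult_right_mono[of 1 "2 ^ n * 2 ^ n" "norm (v - r *\<^sub>R w)"]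
        by (simp add: mult.assoc)
    qed
    finally show "norm v / 2 ^ n \<le> r / 2 ^ n + 2 ^ n * norm (v - r *\<^sub>R w)"
      by (simp add: field_simps)
  qed
  then show ?thesis by (simp add: field_simps)
qed

lemma cost_W: "w \<in> W \<Longrightarrow> cost n w \<le> 1 / 2 ^ n"
  using cost_le[of 1 w n w] by simp

lemma cost_add: "cost n (u + v) \<le> cost n u + cost n v"
proof -
  have *: "cost n (u + v) \<le> (r / 2 ^ n + 2 ^ n * norm (u - r *\<^sub>R w)) + (s / 2 ^ n + 2 ^ n * norm (v - s *\<^sub>R z))"
    if rs: "0 \<le> r" "0 \<le> s" and wz: "w \<in> W" "z \<in> W" for r s :: real and w z
  proof -
    obtain y where y: "y \<in> W" "(r + s) *\<^sub>R y = r *\<^sub>R w + s *\<^sub>R z"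
    proof (cases "r + s = 0")
      case True
      then have "r = 0" "s = 0" using rs by auto
      then show thesis using that[of 0] zero_W by simp
    next
      case False
      have "(r / (r + s)) *\<^sub>R w + (s / (r + s)) *\<^sub>R z \<in> W"
        using rs False by (intro convexD[OF convex_W] wz) (auto simp: add_divide_distrib[symmetric])
      then show thesis
        by (rule that) (use False in \<open>simp add: scaleR_add_right\<close>)
    qed
    have "norm (u + v - (r + s) *\<^sub>R y) \<le> norm (u - r *\<^sub>R w) + norm (v - s *\<^sub>R z)"
      unfolding y(2) using norm_triangle_ineq[of "u - r *\<^sub>R w" "v - s *\<^sub>R z"]
      by (simp add: algebra_simps)
    then have "2 ^ n * norm (u + v - (r + s) *\<^sub>R y) \<le>
        2 ^ n * (norm (u - r *\<^sub>R w) + norm (v - s *\<^sub>R z))" by simp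
    then show ?thesis
      using cost_le[of "r + s" y n "u + v"] rs y(1) by (simp add: add_divide_distrib distrib_left)
  qed
  have "cost n (u + v) - cost n v \<le> cost n u"
  proof (rule cost_ge)
    fix r :: real and w assume r: "0 \<le> r" "w \<in> W"
    have "cost n (u + v) - (r / 2 ^ n + 2 ^ n * norm (u - r *\<^sub>R w)) \<le> cost n v"
    proof (rule cost_ge)
      fix s :: real and z assume "0 \<le> s" "z \<in> W"
      with * r show "cost n (u + v) - (r / 2 ^ n + 2 ^ n * norm (u - r *\<^sub>R w)) \<le>
          s / 2 ^ n + 2 ^ n * norm (v - s *\<^sub>R z)" by (simp add: diff_le_eq add.commute)
    qed
    then show "cost n (u + v) - cost n v \<le> r / 2 ^ n + 2 ^ n * norm (u - r *\<^sub>R w)" by simp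
  qed
  then show ?thesis by simp
qed

lemma cost_zero: "cost n 0 = 0"
  using cost_le_norm[of n 0] cost_nonneg[of n 0] by simp

lemma cost_scale: "cost n (c *\<^sub>R v) = \<bar>c\<bar> * cost n v"
proof -
  have le: "cost n (c *\<^sub>R v) \<le> \<bar>c\<bar> * cost n v" if "c \<noteq> 0" for c v
  proof -
    have "cost n (c *\<^sub>R v) / \<bar>c\<bar> \<le> cost n v"
    proof (rule cost_ge)
      fix r :: real and w assume r: "0 \<le> r" and w: "w \<in> W"
      \<comment> \<open>The sign of \<open>c\<close> is moved into the symmetric set
        \<open>W\<close>, which leaves the nonnegative multiple
        \<open>\<bar>c\<bar> * r\<close>.\<close>
      have "sgn c *\<^sub>R w \<in> W" using w W_minus that by (auto simp: sgn_if)
      then have "cost n (c *\<^sub>R v) \<le> (\<bar>c\<bar> * r) / 2 ^ n + 2 ^ n * norm (c *\<^sub>R v - (\<bar>c\<bar> * r) *\<^sub>R sgn c *\<^sub>R w)"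
        using r by (intro cost_le) auto
      also have "c *\<^sub>R v - (\<bar>c\<bar> * r) *\<^sub>R sgn c *\<^sub>R w = c *\<^sub>R (v - r *\<^sub>R w)"
        using abs_mult_sgn[of c] by (simp add: scaleR_diff_right mult.commute mult.left_commute)
      also have "norm (c *\<^sub>R (v - r *\<^sub>R w)) = \<bar>c\<bar> * norm (v - r *\<^sub>R w)" by simp
      finally show "cost n (c *\<^sub>R v) / \<bar>c\<bar> \<le> r / 2 ^ n + 2 ^ n * norm (v - r *\<^sub>R w)"
        using that by (simp add: field_simps)
    qed
    then show ?thesis using that by (simp add: field_simps)
  qed
  show ?thesis
  proof (cases "c = 0")
    case False
    then have "cost n (inverse c *\<^sub>R c *\<^sub>R v) \<le> \<bar>inverse c\<bar> * cost n (c *\<^sub>R v)" by (intro le) simp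
    then have "\<bar>c\<bar> * cost n v \<le> cost n (c *\<^sub>R v)" using False by (simp add: field_simps)
    then show ?thesis using le[OF False, of v] by simp
  qed (simp add: cost_zero)
qed

text \<open>A linear contraction preserving \<open>W\<close> carries each decomposition of
  \<open>v\<close> to one of \<open>T v\<close> that is no more expensive. This is how translations
  become contractions of \<open>V\<close>.\<close>

lemma cost_contraction:
  assumes T: "linear T" "\<And>x. norm (T x) \<le> norm x" "T ` W \<subseteq> W"
  shows "cost n (T v) \<le> cost n v"
proof (rule cost_ge)
  fix r :: real and w assume r: "0 \<le> r" and w: "w \<in> W"
  have "cost n (T v) \<le> r / 2 ^ n + 2 ^ n * norm (T v - r *\<^sub>R T w)"
    using r w T(3) by (intro cost_le) auto
  also have "T v - r *\<^sub>R T w = T (v - r *\<^sub>R w)"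
    by (simp add: linear_diff[OF T(1)] linear_scale[OF T(1)])
  also have "r / 2 ^ n + 2 ^ n * norm (T (v - r *\<^sub>R w)) \<le> r / 2 ^ n + 2 ^ n * norm (v - r *\<^sub>R w)"
    using T(2) by simp
  finally show "cost n (T v) \<le> r / 2 ^ n + 2 ^ n * norm (v - r *\<^sub>R w)" .
qed

section \<open>The interpolation space and its dual\<close>

definition V :: "'a set" where "V = {v. (\<lambda>n. cost n v) \<longlonglongrightarrow> 0}"

definition N :: "'a \<Rightarrow> real" where "N v = (SUP n. cost n v)"

lemma V_I:
  assumes "g \<longlonglongrightarrow> 0" "\<And>n. cost n v \<le> g n"
  shows "v \<in> V"
proof -
  from assms(1) have "(\<lambda>n. cost n v) \<longlonglongrightarrow> 0"
    by (rule tendsto_sandwich[OF always_eventually always_eventually tendsto_const, rotated 2])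
      (auto simp: cost_nonneg assms(2))
  then show ?thesis by (simp add: V_def)
qed

lemma cost_le_N: "v \<in> V \<Longrightarrow> cost n v \<le> N v"
proof -
  assume "v \<in> V"
  then have "Bseq (\<lambda>n. cost n v)" by (intro convergent_imp_Bseq) (auto simp: V_def convergent_def)
  then have "bdd_above (range (\<lambda>n. cost n v))" by (rule Bseq_bdd_above)
  then show ?thesis unfolding N_def by (intro cSUP_upper) auto
qed

lemma N_least: "(\<And>n. cost n v \<le> c) \<Longrightarrow> N v \<le> c"
  unfolding N_def by (intro cSUP_least) auto

lemma norm_le_N: "v \<in> V \<Longrightarrow> norm v \<le> N v"
  using norm_le_cost[of v 0] cost_le_N[of v 0] by simp

lemma N_nonneg: "v \<in> V \<Longrightarrow> 0 \<le> N v"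
  using norm_le_N[of v] norm_ge_zero[of v] by linarith

lemma subspace_V: "subspace V"
proof (rule subspaceI)
  show "0 \<in> V" by (simp add: V_def cost_zero)
  show "u + v \<in> V" if "u \<in> V" "v \<in> V" for u v
  proof -
    have "(\<lambda>n. cost n u + cost n v) \<longlonglongrightarrow> 0" using tendsto_add[of _ 0 _ _ 0] that by (simp add: V_def)
    then show ?thesis by (rule V_I) (rule cost_add)
  qed
  show "c *\<^sub>R v \<in> V" if "v \<in> V" for c v
    using that tendsto_mult_left[of "\<lambda>n. cost n v" 0 _ "\<bar>c\<bar>"] by (simp add: V_def cost_scale)
qed

lemma W_subset_V: "W \<subseteq> V"
proof
  fix w assume w: "w \<in> W"
  have "(\<lambda>n. 1 / 2 ^ n :: real) \<longlonglongrightarrow> 0"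
    using LIMSEQ_realpow_zero[of "1/2 :: real"] by (simp add: power_divide)
  then show "w \<in> V" by (rule V_I) (rule cost_W[OF w])
qed

lemma normed_on_V: "normed_on V N"
  unfolding normed_on_def
proof (intro conjI ballI allI)
  show "subspace V" by (rule subspace_V)
  show "0 \<le> N x" if "x \<in> V" for x using that by (rule N_nonneg)
  show "N x = 0 \<longleftrightarrow> x = 0" if "x \<in> V" for x
    using norm_le_N[OF that] by (auto simp: N_def cost_zero)
  show "N (x + y) \<le> N x + N y" if "x \<in> V" "y \<in> V" for x y
    using cost_add[of _ x y] cost_le_N that by (intro N_least) (meson add_mono order.trans)
  show "N (c *\<^sub>R x) = \<bar>c\<bar> * N x" if x: "x \<in> V" for c x
  proof (rule antisym)
    show "N (c *\<^sub>R x) \<le> \<bar>c\<bar> * N x"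
      by (rule N_least) (simp add: cost_scale cost_le_N x mult_left_mono)
    show "\<bar>c\<bar> * N x \<le> N (c *\<^sub>R x)"
    proof (cases "c = 0")
      case False
      have "cost n x \<le> N (c *\<^sub>R x) / \<bar>c\<bar>" for n
        using cost_le_N[of "c *\<^sub>R x" n] x subspace_V False
        by (simp add: subspace_scale cost_scale field_simps)
      then have "N x \<le> N (c *\<^sub>R x) / \<bar>c\<bar>" by (rule N_least)
      then show ?thesis using False by (simp add: field_simps)
    qed (simp add: N_def cost_zero)
  qed
qed

text \<open>The candidate is the limit in the ambient norm. Each \<open>cost k\<close> is at most
  \<open>2 ^ k\<close> times that norm, so the Cauchy estimate, uniform in \<open>k\<close>,
  survives the limit; a uniform limit of null sequences is again null.\<close>

lemma banach_on_V: "banach_on V N"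
  unfolding banach_on_iff
proof (intro conjI normed_on_V allI impI)
  fix \<sigma> :: "nat \<Rightarrow> 'a"
  assume \<sigma>: "\<forall>n. \<sigma> n \<in> V"
    and cau: "\<forall>e>0. \<exists>M. \<forall>m n. M \<le> m \<longrightarrow> M \<le> n \<longrightarrow> N (\<sigma> m - \<sigma> n) < e"
  have diff: "\<sigma> m - \<sigma> n \<in> V" for m n using \<sigma> subspace_V by (simp add: subspace_diff)
  have "Cauchy \<sigma>"
  proof (rule metric_CauchyI)
    fix e :: real assume "0 < e"
    then obtain M where "\<forall>m n. M \<le> m \<longrightarrow> M \<le> n \<longrightarrow> N (\<sigma> m - \<sigma> n) < e" using cau by blast
    then show "\<exists>M. \<forall>m\<ge>M. \<forall>n\<ge>M. dist (\<sigma> m) (\<sigma> n) < e"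
      unfolding dist_norm using norm_le_N[OF diff] le_less_trans by blast
  qed
  then obtain x where x: "\<sigma> \<longlonglongrightarrow> x" using complete_UNIV unfolding complete_def by blast
  have close: "\<exists>M. \<forall>n\<ge>M. \<forall>k. cost k (\<sigma> n - x) \<le> e" if "0 < e" for e
  proof -
    obtain M where M: "\<And>m n. M \<le> m \<Longrightarrow> M \<le> n \<Longrightarrow> N (\<sigma> m - \<sigma> n) < e" using cau \<open>0 < e\<close> by blast
    have "cost k (\<sigma> n - x) \<le> e" if n: "M \<le> n" for n k
    proof (rule LIMSEQ_le_const)
      have "(\<lambda>m. e + 2 ^ k * norm (\<sigma> m - x)) \<longlonglongrightarrow> e + 2 ^ k * norm (x - x)"
        by (intro tendsto_intros x)
      then show "(\<lambda>m. e + 2 ^ k * norm (\<sigma> m - x)) \<longlonglongrightarrow> e" by simp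
      have "cost k (\<sigma> n - x) \<le> e + 2 ^ k * norm (\<sigma> m - x)" if "M \<le> m" for m
        using cost_add[of k "\<sigma> n - \<sigma> m" "\<sigma> m - x"] cost_le_N[OF diff, of k n m] M[OF n that]
          cost_le_norm[of k "\<sigma> m - x"] by simp
      then show "\<exists>N. \<forall>m\<ge>N. cost k (\<sigma> n - x) \<le> e + 2 ^ k * norm (\<sigma> m - x)" by blast
    qed
    then show ?thesis by blast
  qed
  have "(\<lambda>k. cost k x) \<longlonglongrightarrow> 0"
  proof (rule LIMSEQ_I)
    fix e :: real assume "0 < e"
    then obtain M where M: "\<And>n k. M \<le> n \<Longrightarrow> cost k (\<sigma> n - x) \<le> e / 2" using close[of "e / 2"] by auto
    have "(\<lambda>k. cost k (\<sigma> M)) \<longlonglongrightarrow> 0" using \<sigma> by (simp add: V_def)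
    then obtain k0 where k0: "\<And>k. k0 \<le> k \<Longrightarrow> cost k (\<sigma> M) < e / 2"
      using LIMSEQ_D[of _ 0 "e / 2"] \<open>0 < e\<close> by (metis abs_of_nonneg cost_nonneg diff_zero half_gt_zero real_norm_def)
    have "norm (cost k x - 0) < e" if "k0 \<le> k" for k
      using cost_add[of k "\<sigma> M" "x - \<sigma> M"] cost_scale[of k "-1" "\<sigma> M - x"] M[of M k] k0[OF that] cost_nonneg[of k x]
      by simp
    then show "\<exists>k0. \<forall>k\<ge>k0. norm (cost k x - 0) < e" by blast
  qed
  then have "x \<in> V" by (simp add: V_def)
  moreover have "\<exists>M. \<forall>n\<ge>M. N (\<sigma> n - x) < e" if "0 < e" for e
  proof -
    obtain M where "\<And>n k. M \<le> n \<Longrightarrow> cost k (\<sigma> n - x) \<le> e / 2" using close[of "e / 2"] \<open>0 < e\<close> by auto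
    then have "N (\<sigma> n - x) \<le> e / 2" if "M \<le> n" for n using that by (intro N_least)
    then show ?thesis using \<open>0 < e\<close> by (intro exI[of _ M]) fastforce
  qed
  ultimately show "\<exists>x\<in>V. \<forall>e>0. \<exists>M. \<forall>n\<ge>M. N (\<sigma> n - x) < e" by blast
qed

text \<open>A gliding hump: since \<open>cost n u \<longrightarrow> 0\<close>, adding to \<open>u\<close> a unit vector that is small in the
  ambient norm does not push \<open>N\<close> beyond \<open>2\<close>, so a functional that is not small on such vectors would
  be unbounded.\<close>

lemma functional_bound_split:
  assumes V1: "subspace V1" "V1 \<subseteq> V"
    and add: "\<And>u v. u \<in> V1 \<Longrightarrow> v \<in> V1 \<Longrightarrow> \<phi> (u + v) = \<phi> u + \<phi> v"
    and scale: "\<And>c v. v \<in> V1 \<Longrightarrow> \<phi> (c *\<^sub>R v) = c * \<phi> v"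
    and bound: "\<And>v. v \<in> V1 \<Longrightarrow> \<bar>\<phi> v\<bar> \<le> b * N v" and "0 < e"
  shows "\<exists>K\<ge>0. \<forall>v\<in>V1. \<bar>\<phi> v\<bar> \<le> K * norm v + e * N v"
proof (rule ccontr)
  assume contr: "\<not> ?thesis"
  have b: "\<bar>\<phi> v\<bar> \<le> (\<bar>b\<bar> + 1) * N v" if "v \<in> V1" for v
  proof -
    have "b * N v \<le> (\<bar>b\<bar> + 1) * N v" using that V1(2) N_nonneg by (intro mult_right_mono) auto
    then show ?thesis using bound[OF that] by linarith
  qed
  have small: "\<exists>v\<in>V1. N v \<le> 1 \<and> norm v \<le> \<eta> \<and> e \<le> \<phi> v" if "0 < \<eta>" for \<eta>
  proof -
    \<comment> \<open>A vector violating the estimate for this \<open>K\<close>, divided by its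
      \<open>N\<close> and multiplied by the sign of its value, has ambient norm at most
      \<open>\<eta>\<close>, since \<open>\<phi>\<close> cannot exceed
      \<open>\<bar>b\<bar> + 1\<close> on the unit sphere.\<close>
    define K where "K = (\<bar>b\<bar> + 1) / \<eta>"
    have K: "0 < K" using that by (simp add: K_def)
    obtain v where v: "v \<in> V1" "K * norm v + e * N v < \<bar>\<phi> v\<bar>"
      using contr less_imp_le[OF K] by (meson not_le)
    have vV: "v \<in> V" using v V1 by blast
    have "N v \<noteq> 0"
    proof
      assume "N v = 0"
      then show False using b[OF v(1)] v(2) K norm_ge_zero[of v] by (simp add: mult_less_0_iff)
    qed
    then have Nv: "0 < N v" using N_nonneg[OF vV] by simp
    define u where "u = (sgn (\<phi> v) / N v) *\<^sub>R v"
    have "\<phi> v \<noteq> 0" using v(2) K Nv \<open>0 < e\<close> norm_ge_zero[of v] by (smt (verit) mult_nonneg_nonneg)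
    then have sgn: "\<bar>sgn (\<phi> v)\<bar> = 1" by (simp add: abs_sgn_eq)
    have u1: "u \<in> V1" unfolding u_def by (intro subspace_scale V1 v)
    have \<phi>u: "\<phi> u = \<bar>\<phi> v\<bar> / N v" unfolding u_def scale[OF v(1)] by (simp add: abs_sgn mult.commute)
    have Nu: "N u = 1" unfolding u_def using normed_onD(5)[OF normed_on_V vV] sgn Nv by simp
    have nu: "norm u = norm v / N v" unfolding u_def using sgn Nv by simp
    have "K * norm u + e < \<phi> u" 
      using divide_strict_right_mono[OF v(2) Nv] Nv unfolding \<phi>u nu by (simp add: add_divide_distrib)
    moreover have "\<phi> u \<le> \<bar>b\<bar> + 1" using b[OF u1] Nu by simp
    moreover have "0 \<le> K * norm u" using K by simp
    ultimately have "K * norm u \<le> \<bar>b\<bar> + 1" "e \<le> \<phi> u" using \<open>0 < e\<close> by linarith+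
    moreover have "K * norm u = (\<bar>b\<bar> + 1) * (norm u / \<eta>)" by (simp add: K_def)
    ultimately have "(\<bar>b\<bar> + 1) * (norm u / \<eta>) \<le> (\<bar>b\<bar> + 1) * 1" "e \<le> \<phi> u" by simp_all
    moreover from this(1) have "norm u / \<eta> \<le> 1" by (rule mult_left_le_imp_le) simp
    ultimately show ?thesis using u1 Nu that by (intro bexI[of _ u]) (auto simp: pos_divide_le_eq)
  qed
  have "\<exists>u\<in>V1. N u < 2 \<and> real m * e \<le> \<phi> u" for m
  proof (induction m)
    case 0
    have "\<phi> (0 *\<^sub>R 0) = 0" using scale[of 0 0] V1(1) by (simp add: subspace_0)
    then show ?case using V1(1) normed_onD(6)[OF normed_on_V]
      by (intro bexI[of _ 0]) (auto simp: subspace_0)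
  next
    case (Suc m)
    then obtain u where u: "u \<in> V1" "N u < 2" "real m * e \<le> \<phi> u" by blast
    have uV: "u \<in> V" using u V1 by blast
    then have "(\<lambda>n. cost n u) \<longlonglongrightarrow> 0" by (simp add: V_def)
    then obtain n0 where n0: "\<And>n. n0 \<le> n \<Longrightarrow> norm (cost n u - 0) < 1 / 2"
      using LIMSEQ_D[of _ 0 "1/2"] by (metis half_gt_zero zero_less_one)
    \<comment> \<open>Half of the room left below 2. Coordinates before \<open>n0\<close> grow by at
      most \<open>\<delta>\<close> because \<open>v\<close> is tiny in the ambient norm; later ones
      stay below \<open>1 / 2 + 1\<close>.\<close>
    define \<delta> where "\<delta> = (2 - N u) / 2"
    have \<delta>: "0 < \<delta>" "N u + \<delta> < 2" using u(2) by (auto simp: \<delta>_def field_simps)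
    obtain v where v: "v \<in> V1" "N v \<le> 1" "norm v \<le> \<delta> / 2 ^ n0" "e \<le> \<phi> v"
      using small[of "\<delta> / 2 ^ n0"] \<delta>(1) by auto
    have vV: "v \<in> V" using v V1 by blast
    have "cost n (u + v) \<le> max (N u + \<delta>) (3 / 2)" for n
    proof (cases "n0 \<le> n")
      case True
      then have "cost n u < 1 / 2" using n0[OF True] by simp
      then show ?thesis using cost_add[of n u v] cost_le_N[OF vV, of n] v(2) by simp
    next
      case False
      have "cost n v \<le> 2 ^ n * norm v" by (rule cost_le_norm)
      also have "\<dots> \<le> 2 ^ n0 * (\<delta> / 2 ^ n0)"
        using False v(3) by (intro mult_mono power_increasing) auto
      finally show ?thesis using cost_add[of n u v] cost_le_N[OF uV, of n] by simp
    qed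
    then have "N (u + v) \<le> max (N u + \<delta>) (3 / 2)" by (rule N_least)
    then have "N (u + v) < 2" using \<delta>(2) by linarith
    moreover have "real (Suc m) * e \<le> \<phi> (u + v)"
      using add[OF u(1) v(1)] u(3) v(4) by (simp add: algebra_simps)
    ultimately show ?case using u(1) v(1) V1(1) by (blast intro: subspace_add)
  qed
  then obtain u where u: "\<And>m. u m \<in> V1" "\<And>m. N (u m) < 2" "\<And>m. real m * e \<le> \<phi> (u m)" by metis
  obtain m where m: "(\<bar>b\<bar> + 1) * 2 < real m * e" using reals_Archimedean3[OF \<open>0 < e\<close>] by blast
  have "\<phi> (u m) \<le> (\<bar>b\<bar> + 1) * N (u m)" using b[OF u(1)[of m]] by linarith
  also have "\<dots> \<le> (\<bar>b\<bar> + 1) * 2" using u(2)[of m] by (intro mult_left_mono) auto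
  finally show False using u(3)[of m] m by linarith
qed

text \<open>Hahn-Banach with the extension built into the sublinear functional: \<open>p x\<close>
  is the infimum over \<open>v\<close> in \<open>V1\<close> of
  \<open>K * norm (x + v) + e * N v - \<phi> v\<close>, bounded below by the split estimate. For a
  linear \<open>l\<close> below \<open>p\<close>, the choice \<open>v = 0\<close> bounds
  \<open>l\<close> in the ambient norm, and evaluation at \<open>- v\<close> gives
  \<open>\<phi> v - l v \<le> e * N v\<close>.\<close>

lemma functional_approximated:
  assumes V1: "subspace V1" "V1 \<subseteq> V"
    and add: "\<And>u v. u \<in> V1 \<Longrightarrow> v \<in> V1 \<Longrightarrow> \<phi> (u + v) = \<phi> u + \<phi> v"
    and scale: "\<And>c v. v \<in> V1 \<Longrightarrow> \<phi> (c *\<^sub>R v) = c * \<phi> v"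
    and bound: "\<And>v. v \<in> V1 \<Longrightarrow> \<bar>\<phi> v\<bar> \<le> b * N v" and "0 < e"
  obtains \<xi> where "bounded_linear \<xi>" "\<And>v. v \<in> V1 \<Longrightarrow> \<bar>\<phi> v - \<xi> v\<bar> \<le> e * N v"
proof -
  obtain K where K: "0 \<le> K" "\<And>v. v \<in> V1 \<Longrightarrow> \<bar>\<phi> v\<bar> \<le> K * norm v + e * N v"
    using functional_bound_split[OF assms] by blast
  have 0: "0 \<in> V1" using V1(1) by (rule subspace_0)
  have \<phi>0: "\<phi> 0 = 0" using scale[OF 0, of 0] by simp
  have N0: "N 0 = 0" by (rule normed_onD(6)[OF normed_on_V])
  define q where "q x v = K * norm (x + v) + e * N v - \<phi> v" for x v
  define p where "p x = (INF v\<in>V1. q x v)" for x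
  have lo: "- K * norm x \<le> q x v" if "v \<in> V1" for x v
  proof -
    have "K * norm v \<le> K * (norm (x + v) + norm x)"
      using K(1) norm_triangle_ineq4[of "x + v" x] by (intro mult_left_mono) auto
    then show ?thesis using K(2)[OF that] by (simp add: q_def algebra_simps)
  qed
  have ple: "p x \<le> q x v" if "v \<in> V1" for x v
    unfolding p_def using that lo by (intro cINF_lower bdd_belowI2[of _ "- K * norm x"])
  have pge: "l \<le> p x" if "\<And>v. v \<in> V1 \<Longrightarrow> l \<le> q x v" for l x
    unfolding p_def using that 0 by (intro cINF_greatest) auto
  have "p (x + y) \<le> p x + p y" for x y
  proof -
    have *: "p (x + y) \<le> q x u + q y v" if "u \<in> V1" "v \<in> V1" for u v
    proof -
      have "q (x + y) (u + v) \<le> q x u + q y v"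
      proof -
        have "K * norm (x + y + (u + v)) \<le> K * (norm (x + u) + norm (y + v))"
          using K(1) norm_triangle_ineq[of "x + u" "y + v"] by (intro mult_left_mono) (auto simp: algebra_simps)
        moreover have "e * N (u + v) \<le> e * (N u + N v)"
          using \<open>0 < e\<close> that V1 by (intro mult_left_mono normed_onD(4)[OF normed_on_V]) auto
        ultimately show ?thesis using add[OF that] by (simp add: q_def distrib_left)
      qed
      then show ?thesis using ple[of "u + v" "x + y"] that V1(1) by (simp add: subspace_add)
    qed
    have "p (x + y) - q y v \<le> p x" if "v \<in> V1" for v
      by (rule pge) (use *[OF _ that] in \<open>simp add: algebra_simps\<close>)
    then have "p (x + y) - p x \<le> p y" by (intro pge) (simp add: algebra_simps)
    then show ?thesis by simp
  qed
  moreover have "p (t *\<^sub>R x) = t * p x" if t: "0 \<le> t" for t x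
  proof (cases "t = 0")
    case True
    have "p 0 = 0" using ple[OF 0, of 0] pge[of 0 0] lo[of _ 0] by (intro antisym) (auto simp: q_def \<phi>0 N0)
    then show ?thesis using True by simp
  next
    case False
    with t have t: "0 < t" by simp
    have le: "p (t *\<^sub>R x) \<le> t * p x" if t: "0 < t" for t x
    proof -
      have "p (t *\<^sub>R x) / t \<le> p x"
      proof (rule pge)
        fix v assume v: "v \<in> V1"
        have "q (t *\<^sub>R x) (t *\<^sub>R v) = t * q x v"
        proof -
          have "N (t *\<^sub>R v) = t * N v" using normed_onD(5)[OF normed_on_V, of v t] v V1(2) t by auto
          moreover have "norm (t *\<^sub>R x + t *\<^sub>R v) = t * norm (x + v)"
            unfolding scaleR_add_right[symmetric] using t by simp
          ultimately show ?thesis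
            by (simp add: q_def scale[OF v] right_diff_distrib distrib_left mult.left_commute)
        qed
        then show "p (t *\<^sub>R x) / t \<le> q x v"
          using ple[of "t *\<^sub>R v" "t *\<^sub>R x"] v V1(1) t by (simp add: subspace_scale field_simps)
      qed
      then show ?thesis using t by (simp add: field_simps)
    qed
    have "p (inverse t *\<^sub>R t *\<^sub>R x) \<le> inverse t * p (t *\<^sub>R x)" using t by (intro le) simp
    then have "t * p x \<le> p (t *\<^sub>R x)" using t by (simp add: field_simps)
    then show ?thesis using le[OF t, of x] by simp
  qed
  ultimately have "sublinear p" by (simp add: sublinear_def)
  then obtain l where l: "linear l" "\<And>x. l x \<le> p x" using sublinear_dominates_linear by blast
  have lK: "l x \<le> K * norm x" for x
    using l(2)[of x] ple[OF 0, of x] by (simp add: q_def \<phi>0 N0)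
  have "bounded_linear l"
  proof (rule bounded_linear_intro[of _ K])
    show "l (x + y) = l x + l y" for x y by (rule linear_add[OF l(1)])
    show "l (r *\<^sub>R x) = r *\<^sub>R l x" for r x by (rule linear_scale[OF l(1)])
    show "norm (l x) \<le> norm x * K" for x
      using lK[of x] lK[of "- x"] linear_neg[OF l(1), of x] by (simp add: abs_le_iff mult.commute)
  qed
  moreover have le: "\<phi> v - l v \<le> e * N v" if "v \<in> V1" for v
    using l(2)[of "- v"] ple[OF that, of "- v"] linear_neg[OF l(1), of v] by (simp add: q_def)
  have "\<bar>\<phi> v - l v\<bar> \<le> e * N v" if v: "v \<in> V1" for v
  proof -
    have "\<phi> (- v) = - \<phi> v" "N (- v) = N v" "- v \<in> V1"
      using scale[OF v, of "-1"] normed_onD(5)[OF normed_on_V, of v "-1"] v V1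
      by (auto simp: subspace_neg)
    then show ?thesis using le[OF v] le[of "- v"] linear_neg[OF l(1), of v] by (simp add: abs_le_iff)
  qed
  ultimately show thesis by (rule that)
qed

lemma dual_approximated:
  assumes V1: "subspace V1" "V1 \<subseteq> V" and \<phi>: "\<phi> \<in> dual V1 N" and "0 < e"
  obtains \<xi> where "bounded_linear \<xi>" "\<And>v. v \<in> V1 \<Longrightarrow> \<bar>\<phi> v - \<xi> v\<bar> \<le> e * N v"
proof -
  obtain b where "\<And>v. v \<in> V1 \<Longrightarrow> \<bar>\<phi> v\<bar> \<le> b * N v"
    using \<phi> unfolding dual_def bounded_ops_def by blast
  then show thesis
    using functional_approximated[OF V1, of \<phi> b e] \<phi> \<open>0 < e\<close> that
    unfolding dual_def bounded_ops_def by auto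
qed

end

section \<open>Pseudometrics on duals and operator topologies\<close>

lemma SUP_abs_diff_triangle:
  assumes "C \<noteq> {}" "bdd_above ((\<lambda>c. \<bar>\<xi> c - \<eta> c\<bar> :: real) ` C)" "bdd_above ((\<lambda>c. \<bar>\<eta> c - \<zeta> c\<bar>) ` C)"
  shows "sup_dist C \<xi> \<zeta> \<le> sup_dist C \<xi> \<eta> + sup_dist C \<eta> \<zeta>"
proof (rule cSUP_least[OF assms(1)])
  fix c assume "c \<in> C"
  then have "\<bar>\<xi> c - \<eta> c\<bar> \<le> sup_dist C \<xi> \<eta>" "\<bar>\<eta> c - \<zeta> c\<bar> \<le> sup_dist C \<eta> \<zeta>"
    using assms(2,3) by (auto intro!: cSUP_upper)
  then show "\<bar>\<xi> c - \<zeta> c\<bar> \<le> sup_dist C \<xi> \<eta> + sup_dist C \<eta> \<zeta>"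
    by linarith
qed

lemma ctbl_small_dual:
  fixes C :: "'a::real_normed_vector set"
  assumes "separable_for (dual UNIV norm) (sup_dist C)"
    and C: "C \<noteq> {}" "\<And>c. c \<in> C \<Longrightarrow> norm c \<le> K"
  shows "ctbl_small (dual UNIV norm) (sup_dist C)"
  using assms(1)
proof (rule separable_for_imp_ctbl_small)
  fix \<xi> \<eta> \<zeta> :: "'a \<Rightarrow> real"
  assume "\<xi> \<in> dual UNIV norm" "\<eta> \<in> dual UNIV norm" "\<zeta> \<in> dual UNIV norm"
  then show "sup_dist C \<xi> \<zeta> \<le> sup_dist C \<xi> \<eta> + sup_dist C \<eta> \<zeta>"
    using C by (intro SUP_abs_diff_triangle bdd_above_bounded_functional_diff) (auto simp: dual_UNIV)
qed (simp add: abs_minus_commute)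

lemma topspace_weak_topology: "topspace (weak_topology V N) = V"
  unfolding weak_topology_def by (rule topspace_initial_topology) simp

lemma topspace_norm_topology: "normed_on V N \<Longrightarrow> topspace (norm_topology V N) = V"
  unfolding norm_topology_def using Metric_space.topspace_mtopology[OF Metric_space_norm_dist] .

lemma bounded_ops_evaluation: "v \<in> V \<Longrightarrow> (\<lambda>\<sigma>. \<sigma> v) ` bounded_ops V N W M \<subseteq> W"
  by (auto simp: bounded_ops_def)

lemma weakly_continuous_iff:
  assumes "\<And>s. h s \<in> bounded_ops V N V N"
  shows "weakly_continuous V N h \<longleftrightarrow>
    (\<forall>v\<in>V. continuous_map euclidean (weak_topology V N) (\<lambda>s. h s v))"
  unfolding weakly_continuous_def weak_operator_topology_def
  using assms bounded_ops_evaluation[of _ V N V N]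
  by (subst continuous_map_initial_topology) (force simp: topspace_weak_topology o_def)+

lemma strongly_continuous_iff:
  assumes "normed_on V N" "\<And>s. h s \<in> bounded_ops V N V N"
  shows "strongly_continuous V N h \<longleftrightarrow>
    (\<forall>v\<in>V. continuous_map euclidean (norm_topology V N) (\<lambda>s. h s v))"
  unfolding strongly_continuous_def strong_operator_topology_def
  using assms bounded_ops_evaluation[of _ V N V N]
  by (subst continuous_map_initial_topology) (force simp: topspace_norm_topology o_def)+

lemma continuous_on_uniformly_approximated:
  fixes g :: "'s::topological_space \<Rightarrow> real"
  assumes "\<And>e. 0 < e \<Longrightarrow> \<exists>k. continuous_on UNIV k \<and> (\<forall>s. \<bar>g s - k s\<bar> \<le> e)"
  shows "continuous_on UNIV g"
  unfolding continuous_on_def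
proof (intro ballI tendstoI)
  fix s :: 's and e :: real assume "0 < e"
  then obtain k where k: "continuous_on UNIV k" "\<And>s. \<bar>g s - k s\<bar> \<le> e / 4"
    using assms[of "e / 4"] by auto
  have "(k \<longlongrightarrow> k s) (at s)" using k(1) by (simp add: continuous_on_def)
  then have "\<forall>\<^sub>F s' in at s. dist (k s') (k s) < e / 4" using \<open>0 < e\<close> by (intro tendstoD) auto
  then show "\<forall>\<^sub>F s' in at s. dist (g s') (g s) < e"
  proof eventually_elim
    case (elim s')
    then show ?case using k(2)[of s] k(2)[of s'] \<open>0 < e\<close> unfolding dist_real_def by linarith
  qed
qed

section \<open>Continuity of operator families on the interpolation space\<close>

context interpolation
begin

text \<open>The value 0 off \<open>V\<close> is the normalization demanded by
  \<open>bounded_ops\<close>.\<close>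

definition restr :: "('a \<Rightarrow> 'a) \<Rightarrow> 'a \<Rightarrow> 'a" where
  "restr T v = (if v \<in> V then T v else 0)"

lemma contraction_in_V:
  assumes "linear T" "\<And>x. norm (T x) \<le> norm x" "T ` W \<subseteq> W" "v \<in> V"
  shows "T v \<in> V"
proof (rule V_I)
  show "(\<lambda>n. cost n v) \<longlonglongrightarrow> 0" using assms(4) by (simp add: V_def)
qed (rule cost_contraction[OF assms(1-3)])

lemma N_contraction:
  assumes "linear T" "\<And>x. norm (T x) \<le> norm x" "T ` W \<subseteq> W" "v \<in> V"
  shows "N (T v) \<le> N v"
  by (rule N_least) (rule order.trans[OF cost_contraction[OF assms(1-3)] cost_le_N[OF assms(4)]])

lemma restr_contraction:
  assumes T: "linear T" "\<And>x. norm (T x) \<le> norm x" "T ` W \<subseteq> W"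
  shows "restr T \<in> contractions V N"
proof -
  have le: "N (restr T v) \<le> N v" if "v \<in> V" for v
    using N_contraction[OF T that] that by (simp add: restr_def)
  have "restr T \<in> bounded_ops V N V N"
    unfolding bounded_ops_def
  proof (intro CollectI conjI ballI allI impI)
    show "restr T x \<in> V" if "x \<in> V" for x using contraction_in_V[OF T that] that by (simp add: restr_def)
    show "restr T (x + y) = restr T x + restr T y" if "x \<in> V" "y \<in> V" for x y
      using that subspace_V linear_add[OF T(1)] by (simp add: restr_def subspace_add)
    show "restr T (c *\<^sub>R x) = c *\<^sub>R restr T x" if "x \<in> V" for c x
      using that subspace_V linear_scale[OF T(1)] by (simp add: restr_def subspace_scale)
    show "\<exists>K. \<forall>x\<in>V. N (restr T x) \<le> K * N x" using le by (intro exI[of _ 1]) simp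
    show "restr T x = 0" if "x \<notin> V" for x using that by (simp add: restr_def)
  qed
  moreover have "op_norm V N N (restr T) \<le> 1"
    using le order.trans by (intro op_norm_le[OF normed_on_V]) blast
  ultimately show ?thesis by (simp add: contractions_def)
qed

text \<open>All \<open>T s v\<close> have \<open>N\<close> at most \<open>N v\<close>, so an ambient
  functional close to \<open>\<phi>\<close> in the dual norm is uniformly close to it along the
  orbit of \<open>v\<close>; continuity passes to the uniform limit.\<close>

lemma weakly_continuous_restr:
  fixes T :: "'s::topological_space \<Rightarrow> 'a \<Rightarrow> 'a"
  assumes T: "\<And>s. linear (T s)" "\<And>s x. norm (T s x) \<le> norm x" "\<And>s. T s ` W \<subseteq> W"
    and cont: "\<And>v. continuous_map euclidean (weak_topology UNIV norm) (\<lambda>s. T s v)"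
  shows "weakly_continuous V N (\<lambda>s. restr (T s))"
proof -
  have ops: "restr (T s) \<in> bounded_ops V N V N" for s
    using restr_contraction[OF T] by (simp add: contractions_def)
  have "continuous_map euclidean (weak_topology V N) (\<lambda>s. restr (T s) v)" if v: "v \<in> V" for v
    unfolding weak_topology_def
  proof (subst continuous_map_initial_topology, simp, intro conjI ballI)
    show "(\<lambda>s. restr (T s) v) \<in> topspace euclidean \<rightarrow> V"
      using contraction_in_V[OF T v] v by (simp add: restr_def)
    fix \<phi> assume \<phi>: "\<phi> \<in> dual V N"
    have "continuous_on UNIV (\<lambda>s. \<phi> (restr (T s) v))"
    proof (rule continuous_on_uniformly_approximated)
      fix e :: real assume "0 < e"
      define e' where "e' = e / (N v + 1)"
      have e': "0 < e'" "e' * N v \<le> e"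
        using \<open>0 < e\<close> N_nonneg[OF v] by (auto simp: e'_def field_simps)
      obtain \<xi> where \<xi>: "bounded_linear \<xi>" "\<And>v. v \<in> V \<Longrightarrow> \<bar>\<phi> v - \<xi> v\<bar> \<le> e' * N v"
        using dual_approximated[OF subspace_V subset_refl \<phi> e'(1)] by blast
      have "continuous_map euclidean euclideanreal (\<xi> \<circ> (\<lambda>s. T s v))"
        using cont[of v] \<xi>(1) unfolding weak_topology_def
        by (subst (asm) continuous_map_initial_topology) (auto simp: dual_UNIV)
      then have "continuous_on UNIV (\<lambda>s. \<xi> (T s v))" by (simp add: o_def)
      moreover have "\<bar>\<phi> (restr (T s) v) - \<xi> (T s v)\<bar> \<le> e" for s
      proof -
        have "N (T s v) \<le> N v" by (rule N_contraction[OF T v])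
        then have "e' * N (T s v) \<le> e"
          using e' mult_left_mono[of "N (T s v)" "N v" e'] by linarith
        then show ?thesis using \<xi>(2)[OF contraction_in_V[OF T v], of s] v by (simp add: restr_def)
      qed
      ultimately show "\<exists>k. continuous_on UNIV k \<and> (\<forall>s. \<bar>\<phi> (restr (T s) v) - k s\<bar> \<le> e)" by blast
    qed
    then show "continuous_map euclidean euclideanreal (\<phi> \<circ> (\<lambda>s. restr (T s) v))" by (simp add: o_def)
  qed
  then show ?thesis using ops by (simp add: weakly_continuous_iff)
qed

text \<open>For large \<open>n\<close> the costs of all \<open>T s v\<close> are at most the small
  number \<open>cost n v\<close>, uniformly in \<open>s\<close>. The remaining coordinates are
  bounded by \<open>2 ^ n0\<close> times the ambient norm, where continuity is assumed.\<close>

lemma strongly_continuous_restr: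
  fixes T :: "'s::topological_space \<Rightarrow> 'a \<Rightarrow> 'a"
  assumes T: "\<And>s. linear (T s)" "\<And>s x. norm (T s x) \<le> norm x" "\<And>s. T s ` W \<subseteq> W"
    and cont: "\<And>v. continuous_on UNIV (\<lambda>s. T s v)"
  shows "strongly_continuous V N (\<lambda>s. restr (T s))"
proof -
  interpret Metric_space V "norm_dist V N" by (rule Metric_space_norm_dist[OF normed_on_V])
  have ops: "restr (T s) \<in> bounded_ops V N V N" for s
    using restr_contraction[OF T] by (simp add: contractions_def)
  have "continuous_map euclidean (norm_topology V N) (\<lambda>s. restr (T s) v)" if v: "v \<in> V" for v
    unfolding norm_topology_def continuous_map_to_metric
  proof (intro ballI allI impI)
    fix s :: 's and e :: real assume "0 < e"
    have inV: "T s v \<in> V" for s by (rule contraction_in_V[OF T v])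
    have "(\<lambda>n. cost n v) \<longlonglongrightarrow> 0" using v by (simp add: V_def)
    then obtain n0 where n0: "\<And>n. n0 \<le> n \<Longrightarrow> norm (cost n v - 0) < e / 4"
      using LIMSEQ_D[of _ 0 "e / 4"] \<open>0 < e\<close> by (metis divide_pos_pos zero_less_numeral)
    define U where "U = {s'. norm (T s' v - T s v) < e / 2 / 2 ^ n0}"
    have "open U" unfolding U_def
      by (intro open_Collect_less continuous_intros cont)
    moreover have "s \<in> U" using \<open>0 < e\<close> by (simp add: U_def)
    moreover have "restr (T s') v \<in> mball (restr (T s) v) e" if "s' \<in> U" for s'
    proof -
      have "cost n (T s' v - T s v) \<le> e / 2" for n
      proof (cases "n0 \<le> n")
        case True
        have "cost n (T s' v - T s v) \<le> cost n (T s' v) + cost n (T s v)"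
          using cost_add[of n "T s' v" "- T s v"] cost_scale[of n "-1" "T s v"] by simp
        also have "\<dots> \<le> cost n v + cost n v" by (intro add_mono cost_contraction[OF T])
        finally show ?thesis using n0[OF True] by simp
      next
        case False
        have "cost n (T s' v - T s v) \<le> 2 ^ n * norm (T s' v - T s v)" by (rule cost_le_norm)
        also have "\<dots> \<le> 2 ^ n0 * (e / 2 / 2 ^ n0)"
          using False that by (intro mult_mono power_increasing) (auto simp: U_def)
        finally show ?thesis by simp
      qed
      then have "N (T s' v - T s v) \<le> e / 2" by (rule N_least)
      then show ?thesis
        using inV v \<open>0 < e\<close> normed_on_minus_commute[OF normed_on_V inV inV, of s s']
        by (simp add: restr_def norm_dist_def)
    qed
    ultimately show "\<exists>U. openin euclidean U \<and> s \<in> U \<and> (\<forall>y\<in>U. restr (T y) v \<in> mball (restr (T s) v) e)"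
      by (intro exI[of _ U]) simp
  qed
  then show ?thesis using ops by (simp add: strongly_continuous_iff[OF normed_on_V])
qed

end

section \<open>Separable duals from an Asplund set\<close>

locale asplund_interpolation =
  fixes M :: "'a::real_normed_vector set"
  assumes complete_space: "complete (UNIV :: 'a set)"
    and M_asplund: "asplund_set UNIV norm M" and norm_M: "c \<in> M \<Longrightarrow> norm c \<le> 1"
begin

definition hull_M :: "'a set" where "hull_M = convex hull (M \<union> uminus ` M)"

lemma M_nonempty: "M \<noteq> {}"
  using M_asplund by (simp add: asplund_set_def)

lemma M_subset_hull_M: "M \<subseteq> hull_M"
  unfolding hull_M_def using hull_subset by fastforce

lemma hull_M_minus: "w \<in> hull_M \<Longrightarrow> - w \<in> hull_M"
proof -
  have "linear (uminus :: 'a \<Rightarrow> 'a)" by (simp add: linear_iff)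
  then have "uminus ` hull_M = convex hull (uminus ` (M \<union> uminus ` M))"
    unfolding hull_M_def by (rule convex_hull_linear_image)
  also have "uminus ` (M \<union> uminus ` M) = M \<union> uminus ` M" by (auto simp: image_Un image_image)
  finally show "w \<in> hull_M \<Longrightarrow> - w \<in> hull_M" unfolding hull_M_def by blast
qed

end

sublocale asplund_interpolation \<subseteq> interpolation hull_M
proof
  show "complete (UNIV :: 'a set)" by (rule complete_space)
  show "convex hull_M" by (simp add: hull_M_def convex_convex_hull)
  show "hull_M \<noteq> {}" using M_nonempty M_subset_hull_M by blast
  show "norm w \<le> 1" if "w \<in> hull_M" for w
  proof -
    have "hull_M \<subseteq> cball 0 1"
      unfolding hull_M_def using norm_M by (intro hull_minimal convex_cball) auto
    then show ?thesis using that by auto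
  qed
qed (rule hull_M_minus)

context asplund_interpolation
begin

text \<open>A convex combination involves finitely many members of \<open>M\<close>. Only the
  domination of functionals is kept and the coefficients are dropped; this is what brings estimates
  on the hull down to countable subsets of \<open>M\<close>.\<close>

lemma hull_M_finitely_dominated:
  assumes "w \<in> hull_M"
  obtains F where "finite F" "F \<subseteq> M" "F \<noteq> {}"
    "\<And>(\<zeta> :: 'a \<Rightarrow> real) t. linear \<zeta> \<Longrightarrow> (\<And>c. c \<in> F \<Longrightarrow> \<bar>\<zeta> c\<bar> \<le> t) \<Longrightarrow> \<bar>\<zeta> w\<bar> \<le> t"
proof -
  define P where "P F w \<longleftrightarrow> finite F \<and> F \<subseteq> M \<and> F \<noteq> {} \<and>
    (\<forall>(\<zeta> :: 'a \<Rightarrow> real) t. linear \<zeta> \<longrightarrow> (\<forall>c\<in>F. \<bar>\<zeta> c\<bar> \<le> t) \<longrightarrow> \<bar>\<zeta> w\<bar> \<le> t)" for F w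
  have "hull_M \<subseteq> {w. \<exists>F. P F w}"
    unfolding hull_M_def
  proof (rule hull_minimal)
    have "P {c} c" "P {c} (- c)" if "c \<in> M" for c
      using that by (auto simp: P_def linear_neg)
    then show "M \<union> uminus ` M \<subseteq> {w. \<exists>F. P F w}" by blast
    show "convex {w. \<exists>F. P F w}"
    proof (rule convexI)
      fix x y and u v :: real
      assume "x \<in> {w. \<exists>F. P F w}" "y \<in> {w. \<exists>F. P F w}" and uv: "0 \<le> u" "0 \<le> v" "u + v = 1"
      then obtain F G where F: "P F x" and G: "P G y" by blast
      have "\<bar>\<zeta> (u *\<^sub>R x + v *\<^sub>R y)\<bar> \<le> t" if \<zeta>: "linear \<zeta>" "\<forall>c\<in>F \<union> G. \<bar>\<zeta> c\<bar> \<le> t" for \<zeta> :: "'a \<Rightarrow> real" and t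
      proof -
        have "\<bar>\<zeta> x\<bar> \<le> t" "\<bar>\<zeta> y\<bar> \<le> t" using F G \<zeta> unfolding P_def by auto
        then have "u * \<bar>\<zeta> x\<bar> + v * \<bar>\<zeta> y\<bar> \<le> u * t + v * t" using uv by (intro add_mono mult_left_mono)
        moreover have "\<bar>u * \<zeta> x + v * \<zeta> y\<bar> \<le> u * \<bar>\<zeta> x\<bar> + v * \<bar>\<zeta> y\<bar>"
          using uv abs_triangle_ineq[of "u * \<zeta> x" "v * \<zeta> y"] by (simp add: abs_mult)
        moreover have "u * t + v * t = t" using uv(3) by (simp add: distrib_right[symmetric])
        ultimately show ?thesis by (simp add: linear_add[OF \<zeta>(1)] linear_scale[OF \<zeta>(1)])
      qed
      then have "P (F \<union> G) (u *\<^sub>R x + v *\<^sub>R y)" using F G unfolding P_def by auto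
      then show "u *\<^sub>R x + v *\<^sub>R y \<in> {w. \<exists>F. P F w}" by blast
    qed
  qed
  then obtain F where "P F w" using assms by blast
  then show thesis using that[of F] unfolding P_def by blast
qed

text \<open>A decomposition cheaper than \<open>s\<close> has \<open>r \<le> s * 2 ^ n\<close> and a
  remainder of norm at most \<open>s / 2 ^ n\<close>. Smallness of \<open>\<zeta>\<close> on
  \<open>F\<close> handles the first part, its norm bound \<open>b\<close> the second.\<close>

lemma cost_less_estimate:
  assumes "cost n d < s"
  obtains F where "finite F" "F \<subseteq> M" "F \<noteq> {}"
    "\<And>(\<zeta> :: 'a \<Rightarrow> real) b t. linear \<zeta> \<Longrightarrow> (\<And>x. \<bar>\<zeta> x\<bar> \<le> b * norm x) \<Longrightarrow> (\<And>c. c \<in> F \<Longrightarrow> \<bar>\<zeta> c\<bar> \<le> t) \<Longrightarrow>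
       0 \<le> b \<Longrightarrow> 0 \<le> t \<Longrightarrow> \<bar>\<zeta> d\<bar> \<le> s * 2 ^ n * t + s / 2 ^ n * b"
proof -
  obtain r w where rw: "0 \<le> r" "w \<in> hull_M" "r / 2 ^ n + 2 ^ n * norm (d - r *\<^sub>R w) < s"
    using cost_lessE[OF assms] by metis
  have "0 \<le> r / 2 ^ n" "0 \<le> 2 ^ n * norm (d - r *\<^sub>R w)" using rw(1) by auto
  then have "r / 2 ^ n \<le> s" "2 ^ n * norm (d - r *\<^sub>R w) \<le> s" using rw(3) by linarith+
  then have r: "r \<le> s * 2 ^ n" and nd: "norm (d - r *\<^sub>R w) \<le> s / 2 ^ n" by (auto simp: field_simps)
  obtain F where F: "finite F" "F \<subseteq> M" "F \<noteq> {}"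
    and dom: "\<And>(\<zeta> :: 'a \<Rightarrow> real) t. linear \<zeta> \<Longrightarrow> (\<And>c. c \<in> F \<Longrightarrow> \<bar>\<zeta> c\<bar> \<le> t) \<Longrightarrow> \<bar>\<zeta> w\<bar> \<le> t"
    using hull_M_finitely_dominated[OF rw(2)] by metis
  have "\<bar>\<zeta> d\<bar> \<le> s * 2 ^ n * t + s / 2 ^ n * b"
    if \<zeta>: "linear \<zeta>" and b: "\<And>x. \<bar>\<zeta> x\<bar> \<le> b * norm x" "0 \<le> b"
      and t: "\<And>c. c \<in> F \<Longrightarrow> \<bar>\<zeta> c\<bar> \<le> t" "0 \<le> t" for \<zeta> :: "'a \<Rightarrow> real" and b t
  proof -
    have "\<zeta> d = r * \<zeta> w + \<zeta> (d - r *\<^sub>R w)"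
      by (simp add: linear_diff[OF \<zeta>] linear_scale[OF \<zeta>])
    also have "\<bar>\<dots>\<bar> \<le> r * \<bar>\<zeta> w\<bar> + \<bar>\<zeta> (d - r *\<^sub>R w)\<bar>"
      using abs_triangle_ineq[of "r * \<zeta> w"] rw(1) by (simp add: abs_mult)
    also have "r * \<bar>\<zeta> w\<bar> \<le> s * 2 ^ n * t"
      using r rw(1) dom[OF \<zeta> t(1)] t(2) by (intro mult_mono) auto
    also have "\<bar>\<zeta> (d - r *\<^sub>R w)\<bar> \<le> s / 2 ^ n * b"
      using b(1)[of "d - r *\<^sub>R w"] mult_right_mono[OF nd b(2)] by (simp add: mult.commute)
    finally show ?thesis by simp
  qed
  with F show thesis by (rule that)
qed

text \<open>Finite sets \<open>F d n\<close> for a countable dense set of vectors \<open>d\<close>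
  and all \<open>n\<close> unite to a countable \<open>C\<close> inside \<open>M\<close>. On
  norm-bounded sets of ambient functionals, closeness for \<open>sup_dist C\<close> gives uniform
  closeness on the unit ball of \<open>V1\<close>; these functionals are dense in the dual of
  \<open>V1\<close>.\<close>

lemma separable_dual_subspace:
  assumes V1: "subspace V1" "V1 \<subseteq> V" and sep: "separable_for V1 (norm_dist V1 N)"
  shows "separable_for (dual V1 N) (dual_dist V1 N)"
proof -
  note normed = normed_on_subspace[OF normed_on_V V1]
  define Ball where "Ball = {v \<in> V1. N v \<le> 1}"
  have 0: "0 \<in> V1" using V1(1) by (rule subspace_0)
  have Ball_nonempty: "Ball \<noteq> {}" unfolding Ball_def using 0 normed_onD(6)[OF normed] by auto
  have norm_Ball: "norm v \<le> 1" if "v \<in> Ball" for v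
    using that norm_le_N[of v] V1(2) unfolding Ball_def by fastforce
  obtain D where D: "countable D" "D \<subseteq> V1"
    and dense: "\<forall>x\<in>V1. \<forall>\<epsilon>>0. \<exists>y\<in>D. norm_dist V1 N x y < \<epsilon>"
    using sep unfolding separable_for_def by blast
  have close: "\<exists>d\<in>D. N (x - d) < \<epsilon>" if "x \<in> V1" "0 < \<epsilon>" for x \<epsilon>
  proof -
    obtain d where "d \<in> D" "norm_dist V1 N x d < \<epsilon>" using dense \<open>x \<in> V1\<close> \<open>0 < \<epsilon>\<close> by blast
    moreover have "d \<in> V1" using \<open>d \<in> D\<close> D(2) by blast
    ultimately show ?thesis using \<open>x \<in> V1\<close> by (auto simp: norm_dist_def)
  qed
  \<comment> \<open>Approximants of unit vectors may leave the unit ball; as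
    \<open>\<mu> \<le> 1\<close> below, radius 2 suffices.\<close>
  define D2 where "D2 = {d \<in> D. N d < 2}"
  define controls where "controls d n F \<longleftrightarrow> (\<forall>(\<zeta> :: 'a \<Rightarrow> real) b t. linear \<zeta> \<longrightarrow>
      (\<forall>x. \<bar>\<zeta> x\<bar> \<le> b * norm x) \<longrightarrow> (\<forall>c\<in>F. \<bar>\<zeta> c\<bar> \<le> t) \<longrightarrow> 0 \<le> b \<longrightarrow> 0 \<le> t \<longrightarrow>
      \<bar>\<zeta> d\<bar> \<le> 2 * 2 ^ n * t + 2 / 2 ^ n * b)" for d n F
  have "\<exists>F. finite F \<and> F \<subseteq> M \<and> F \<noteq> {} \<and> controls d n F" if "d \<in> D2" for d n
  proof -
    have "d \<in> V" "N d < 2" using that D(2) V1(2) by (auto simp: D2_def)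
    then have cost: "cost n d < 2" using cost_le_N[of d n] by linarith
    obtain F where "finite F" "F \<subseteq> M" "F \<noteq> {}"
      "\<And>(\<zeta> :: 'a \<Rightarrow> real) b t. linear \<zeta> \<Longrightarrow> (\<And>x. \<bar>\<zeta> x\<bar> \<le> b * norm x) \<Longrightarrow> (\<And>c. c \<in> F \<Longrightarrow> \<bar>\<zeta> c\<bar> \<le> t) \<Longrightarrow>
         0 \<le> b \<Longrightarrow> 0 \<le> t \<Longrightarrow> \<bar>\<zeta> d\<bar> \<le> 2 * 2 ^ n * t + 2 / 2 ^ n * b"
      by (fact cost_less_estimate[OF cost])
    then show ?thesis unfolding controls_def by (intro exI[of _ F]) simp
  qed
  then obtain F where F: "\<And>d n. d \<in> D2 \<Longrightarrow> finite (F d n)" "\<And>d n. d \<in> D2 \<Longrightarrow> F d n \<subseteq> M"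
      "\<And>d n. d \<in> D2 \<Longrightarrow> F d n \<noteq> {}" "\<And>d n. d \<in> D2 \<Longrightarrow> controls d n (F d n)"
    by metis
  have est: "\<bar>\<zeta> d\<bar> \<le> 2 * 2 ^ n * t + 2 / 2 ^ n * b" if "d \<in> D2" "linear \<zeta>"
    "\<forall>x. \<bar>\<zeta> x\<bar> \<le> b * norm x" "\<forall>c\<in>F d n. \<bar>\<zeta> c\<bar> \<le> t" "0 \<le> b" "0 \<le> t"
    for d n b t and \<zeta> :: "'a \<Rightarrow> real"
    using F(4)[OF that(1), of n] that(2-) unfolding controls_def by blast
  define C where "C = (\<Union>d\<in>D2. \<Union>n. F d n)"
  have "countable D2" unfolding D2_def using D(1) by simp
  then have "countable C" unfolding C_def using F(1) by (intro countable_UN) (auto intro: countable_finite)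
  moreover have CM: "C \<subseteq> M" unfolding C_def using F(2) by blast
  moreover have C_nonempty: "C \<noteq> {}"
  proof -
    obtain d where "d \<in> D" "N (0 - d) < 2" using close[OF 0, of 2] by auto
    moreover then have "N d = N (0 - d)" using normed_on_minus_commute[OF normed, of d 0] D(2) 0 by auto
    ultimately have "d \<in> D2" by (simp add: D2_def)
    then show ?thesis unfolding C_def using F(3)[of d 0] by blast
  qed
  ultimately have "separable_for (dual UNIV norm) (sup_dist C)"
    using M_asplund by (simp add: asplund_set_def)
  then have C_small: "ctbl_small (dual UNIV norm) (sup_dist C)"
    using C_nonempty CM norm_M by (intro ctbl_small_dual) auto
  \<comment> \<open>The remainder term of the estimate needs a common norm bound, so the ambient
    dual is exhausted by its bounded parts.\<close>
  define E where "E k = {\<xi> :: 'a \<Rightarrow> real. bounded_linear \<xi> \<and> (\<forall>x. \<bar>\<xi> x\<bar> \<le> real k * norm x)}" for k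
  have E_UN: "(\<Union>k. E k) = {\<xi>. bounded_linear \<xi>}"
  proof -
    have "\<exists>k. \<forall>x. \<bar>\<xi> x\<bar> \<le> real k * norm x" if bl: "bounded_linear \<xi>" for \<xi> :: "'a \<Rightarrow> real"
    proof -
      obtain b where b: "\<And>x. norm (\<xi> x) \<le> norm x * b" using bounded_linear.bounded[OF bl] by blast
      obtain k where k: "b \<le> real k" using real_arch_simple by blast
      have "\<bar>\<xi> x\<bar> \<le> real k * norm x" for x
        using b[of x] mult_left_mono[OF k norm_ge_zero[of x]] by (simp add: mult.commute)
      then show ?thesis by blast
    qed
    then show ?thesis by (auto simp: E_def)
  qed
  have "ctbl_small (E k) (sup_dist Ball)" for k
  proof (rule ctbl_small_pullback[OF C_small])
    fix \<epsilon> :: real assume "0 < \<epsilon>"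
    \<comment> \<open>Three shares of \<open>\<epsilon> / 4\<close>: the remainder
      (\<open>n\<close>), the part in the hull, equal to \<open>2 * 2 ^ n * \<delta>\<close>, and
      the approximation of unit vectors by members of \<open>D2\<close> (\<open>\<mu>\<close>). The
      bound \<open>2 * real k\<close> is that of a difference of two functionals in
      \<open>E k\<close>.\<close>
    obtain n where n: "16 * real k / \<epsilon> < 2 ^ n" using real_arch_pow[of 2] by auto
    then have n': "2 / 2 ^ n * (2 * real k) \<le> \<epsilon> / 4" using \<open>0 < \<epsilon>\<close> by (simp add: field_simps)
    define \<delta> where "\<delta> = \<epsilon> / (8 * 2 ^ n)"
    define \<mu> where "\<mu> = min 1 (\<epsilon> / (8 * (real k + 1)))"
    have pos: "0 < \<delta>" "0 < \<mu>" using \<open>0 < \<epsilon>\<close> by (auto simp: \<delta>_def \<mu>_def)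
    have \<mu>: "2 * real k * \<mu> \<le> \<epsilon> / 4" "\<mu> \<le> 1"
    proof -
      have "2 * real k * \<mu> \<le> 2 * real k * (\<epsilon> / (8 * (real k + 1)))"
        by (intro mult_left_mono) (auto simp: \<mu>_def)
      also have "\<dots> \<le> \<epsilon> / 4" using \<open>0 < \<epsilon>\<close> by (simp add: field_simps)
      finally show "2 * real k * \<mu> \<le> \<epsilon> / 4" .
    qed (simp add: \<mu>_def)
    have "sup_dist Ball \<xi> \<eta> < \<epsilon>"
      if \<xi>\<eta>: "\<xi> \<in> E k" "\<eta> \<in> E k" and less: "sup_dist C \<xi> \<eta> < \<delta>" for \<xi> \<eta>
    proof -
      define \<zeta> where "\<zeta> x = \<xi> x - \<eta> x" for x
      have bl: "bounded_linear \<xi>" "bounded_linear \<eta>" using \<xi>\<eta> by (auto simp: E_def)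
      then have lin: "linear \<zeta>"
        unfolding \<zeta>_def using bounded_linear_sub bounded_linear.linear by blast
      have bnd: "\<bar>\<zeta> x\<bar> \<le> (2 * real k) * norm x" for x
      proof -
        have "\<bar>\<xi> x\<bar> \<le> real k * norm x" "\<bar>\<eta> x\<bar> \<le> real k * norm x" using \<xi>\<eta> by (auto simp: E_def)
        then show ?thesis unfolding \<zeta>_def by linarith
      qed
      have "\<bar>\<zeta> c\<bar> \<le> \<delta>" if "c \<in> C" for c
      proof -
        have "\<bar>\<zeta> c\<bar> \<le> sup_dist C \<xi> \<eta>"
          unfolding \<zeta>_def using that CM norm_M
          by (intro cSUP_upper bdd_above_bounded_functional_diff[OF bl, of _ 1]) auto
        then show ?thesis using less by linarith
      qed
      then have "\<forall>c\<in>F d n. \<bar>\<zeta> c\<bar> \<le> \<delta>" if "d \<in> D2" for d using that unfolding C_def by blast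
      then have d: "\<bar>\<zeta> d\<bar> \<le> \<epsilon> / 2" if "d \<in> D2" for d
        using est[OF that lin, of "2 * real k" n \<delta>] bnd that n' pos by (simp add: \<delta>_def)
      have "\<bar>\<zeta> v\<bar> \<le> 3 / 4 * \<epsilon>" if v: "v \<in> Ball" for v
      proof -
        have v1: "v \<in> V1" "N v \<le> 1" using v by (auto simp: Ball_def)
        obtain e where e: "e \<in> D" "N (v - e) < \<mu>" using close[OF v1(1) pos(2)] by blast
        have e1: "e \<in> V1" using e D(2) by blast
        have "N e \<le> N v + N (e - v)" using normed_onD(4)[OF normed, of v "e - v"] v1 e1 V1(1)
          by (simp add: subspace_diff)
        also have "N (e - v) = N (v - e)" by (rule normed_on_minus_commute[OF normed e1 v1(1)])
        finally have "e \<in> D2" using e v1(2) \<mu>(2) by (simp add: D2_def)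
        then have "\<bar>\<zeta> e\<bar> \<le> \<epsilon> / 2" by (rule d)
        moreover have "\<bar>\<zeta> (v - e)\<bar> \<le> \<epsilon> / 4"
        proof -
          have "v - e \<in> V" using v1 e1 V1 by (blast intro: subspace_diff)
          then have "norm (v - e) \<le> \<mu>" using norm_le_N[of "v - e"] e(2) by linarith
          then have "(2 * real k) * norm (v - e) \<le> (2 * real k) * \<mu>" by (intro mult_left_mono) auto
          then show ?thesis using bnd[of "v - e"] \<mu>(1) by linarith
        qed
        ultimately show ?thesis using linear_diff[OF lin, of v e] by linarith
      qed
      then have "sup_dist Ball \<xi> \<eta> \<le> 3 / 4 * \<epsilon>"
        unfolding \<zeta>_def using Ball_nonempty by (intro cSUP_least)
      then show ?thesis using \<open>0 < \<epsilon>\<close> by linarith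
    qed
    then show "\<exists>f \<delta>. 0 < \<delta> \<and> (\<forall>x\<in>E k. f x \<in> dual UNIV norm) \<and> (\<forall>x\<in>E k. \<forall>y\<in>E k.
        sup_dist C (f x) (f y) < \<delta> \<longrightarrow> sup_dist Ball x y < \<epsilon>)"
      using pos(1) by (intro exI[of _ "\<lambda>x. x"] exI[of _ \<delta>]) (auto simp: E_def dual_UNIV)
  qed
  then have "ctbl_small (\<Union>k. E k) (sup_dist Ball)" by (rule ctbl_small_UN)
  then have "ctbl_small (dual V1 N) (dual_dist V1 N)"
    unfolding E_UN
  proof (rule ctbl_small_pullback)
    fix \<epsilon> :: real assume "0 < \<epsilon>"
    have "\<exists>\<xi>. bounded_linear \<xi> \<and> (\<forall>v\<in>V1. \<bar>\<phi> v - \<xi> v\<bar> \<le> \<epsilon> / 4 * N v)" if \<phi>: "\<phi> \<in> dual V1 N" for \<phi>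
    proof -
      have "0 < \<epsilon> / 4" using \<open>0 < \<epsilon>\<close> by simp
      then obtain \<xi> where "bounded_linear \<xi>" "\<And>v. v \<in> V1 \<Longrightarrow> \<bar>\<phi> v - \<xi> v\<bar> \<le> \<epsilon> / 4 * N v"
        using dual_approximated[OF V1 \<phi>] by metis
      then show ?thesis by blast
    qed
    then obtain f where f: "\<And>\<phi>. \<phi> \<in> dual V1 N \<Longrightarrow> bounded_linear (f \<phi>)"
      "\<And>\<phi> v. \<phi> \<in> dual V1 N \<Longrightarrow> v \<in> V1 \<Longrightarrow> \<bar>\<phi> v - f \<phi> v\<bar> \<le> \<epsilon> / 4 * N v" by metis
    have "dual_dist V1 N \<phi> \<psi> < \<epsilon>"
      if \<phi>: "\<phi> \<in> dual V1 N" and \<psi>: "\<psi> \<in> dual V1 N" and less: "sup_dist Ball (f \<phi>) (f \<psi>) < \<epsilon> / 4" for \<phi> \<psi>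
    proof -
      have "dual_dist V1 N \<phi> \<psi> \<le> 3 / 4 * \<epsilon>"
        unfolding dual_dist_def dual_norm_def
      proof (rule op_norm_le[OF normed])
        fix v assume v: "v \<in> V1" "N v \<le> 1"
        have "\<bar>f \<phi> v - f \<psi> v\<bar> \<le> sup_dist Ball (f \<phi>) (f \<psi>)"
          using v norm_Ball
          by (intro cSUP_upper bdd_above_bounded_functional_diff[OF f(1)[OF \<phi>] f(1)[OF \<psi>], of _ 1])
            (auto simp: Ball_def)
        moreover have "\<epsilon> / 4 * N v \<le> \<epsilon> / 4" using v(2) \<open>0 < \<epsilon>\<close> by simp
        ultimately show "\<bar>\<phi> v - \<psi> v\<bar> \<le> 3 / 4 * \<epsilon>"
          using f(2)[OF \<phi> v(1)] f(2)[OF \<psi> v(1)] less by linarith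
      qed
      then show ?thesis using \<open>0 < \<epsilon>\<close> by linarith
    qed
    then show "\<exists>(f :: _ \<Rightarrow> _ \<Rightarrow> real) \<delta>. 0 < \<delta> \<and> (\<forall>x\<in>dual V1 N. f x \<in> {\<xi>. bounded_linear \<xi>}) \<and> (\<forall>x\<in>dual V1 N. \<forall>y\<in>dual V1 N.
        sup_dist Ball (f x) (f y) < \<delta> \<longrightarrow> dual_dist V1 N x y < \<epsilon>)"
      using \<open>0 < \<epsilon>\<close> f(1) by (intro exI[of _ f] exI[of _ "\<epsilon> / 4"]) simp
  qed
  then show ?thesis by (rule ctbl_small_imp_separable_for)
qed

lemma asplund_space_V: "asplund_space V N"
  unfolding asplund_space_def
proof (intro conjI allI impI)
  show "banach_on V N" by (rule banach_on_V)
  fix V1 assume "V1 \<subseteq> V \<and> banach_on V1 N \<and> separable_for V1 (norm_dist V1 N)"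
  then show "separable_for (dual V1 N) (dual_dist V1 N)"
    by (intro separable_dual_subspace) (auto simp: banach_on_def normed_on_def)
qed

end

section \<open>Representable functions are Asplund\<close>

lemma dual_boundedE:
  assumes "\<phi> \<in> dual V N"
  obtains K where "\<And>x. x \<in> V \<Longrightarrow> \<bar>\<phi> x\<bar> \<le> K * N x"
  using assms unfolding dual_def bounded_ops_def by blast

lemma dual_diff:
  assumes "\<xi> \<in> dual V N" "\<eta> \<in> dual V N"
  shows "(\<lambda>x. \<xi> x - \<eta> x) \<in> dual V N"
proof -
  obtain K where K: "\<And>x. x \<in> V \<Longrightarrow> \<bar>\<xi> x\<bar> \<le> K * N x" using dual_boundedE[OF assms(1)] by blast
  obtain L where L: "\<And>x. x \<in> V \<Longrightarrow> \<bar>\<eta> x\<bar> \<le> L * N x" using dual_boundedE[OF assms(2)] by blast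
  have "\<bar>\<xi> x - \<eta> x\<bar> \<le> (K + L) * N x" if "x \<in> V" for x
    using K[OF that] L[OF that] by (simp add: distrib_right)
  then have "\<exists>K. \<forall>x\<in>V. \<bar>\<xi> x - \<eta> x\<bar> \<le> K * N x" by blast
  then show ?thesis using assms by (simp add: dual_def bounded_ops_def right_diff_distrib)
qed

lemma dual_dist_bound:
  assumes "normed_on V N" "\<xi> \<in> dual V N" "\<eta> \<in> dual V N" "x \<in> V"
  shows "\<bar>\<xi> x - \<eta> x\<bar> \<le> dual_dist V N \<xi> \<eta> * N x"
  unfolding dual_dist_def dual_norm_def
  using op_norm_bound[OF assms(1) normed_on_abs _ assms(4), of "\<lambda>x. \<xi> x - \<eta> x"] dual_diff[OF assms(2,3)]
  by (simp add: dual_def)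

lemma dual_dist_le:
  assumes "normed_on V N" "\<And>x. x \<in> V \<Longrightarrow> N x \<le> 1 \<Longrightarrow> \<bar>\<xi> x - \<eta> x\<bar> \<le> c"
  shows "dual_dist V N \<xi> \<eta> \<le> c"
  unfolding dual_dist_def dual_norm_def using assms by (intro op_norm_le)

lemma dual_dist_nonneg:
  assumes "normed_on V N" "\<xi> \<in> dual V N" "\<eta> \<in> dual V N"
  shows "0 \<le> dual_dist V N \<xi> \<eta>"
proof -
  have bdd: "bdd_above ((\<lambda>x. \<bar>\<xi> x - \<eta> x\<bar>) ` {x \<in> V. N x \<le> 1})"
  proof (rule bdd_aboveI2)
    fix x assume x: "x \<in> {x \<in> V. N x \<le> 1}"
    then have "dual_dist V N \<xi> \<eta> * N x \<le> \<bar>dual_dist V N \<xi> \<eta>\<bar> * 1"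
      using normed_onD(2)[OF assms(1), of x] by (intro mult_mono) auto
    then show "\<bar>\<xi> x - \<eta> x\<bar> \<le> \<bar>dual_dist V N \<xi> \<eta>\<bar>"
      using dual_dist_bound[OF assms, of x] x by simp
  qed
  have "0 \<in> {x \<in> V. N x \<le> 1}" using normed_onD(1,6)[OF assms(1)] by (simp add: subspace_0)
  then have "\<bar>\<xi> 0 - \<eta> 0\<bar> \<le> dual_dist V N \<xi> \<eta>"
    unfolding dual_dist_def dual_norm_def op_norm_def using bdd by (intro cSUP_upper)
  then show ?thesis by linarith
qed

lemma ctbl_small_dual_dist:
  assumes V: "normed_on V N" and sep: "separable_for (dual V N) (dual_dist V N)"
  shows "ctbl_small (dual V N) (dual_dist V N)"
  using sep
proof (rule separable_for_imp_ctbl_small)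
  fix \<xi> \<eta> \<zeta> assume d: "\<xi> \<in> dual V N" "\<eta> \<in> dual V N" "\<zeta> \<in> dual V N"
  show "dual_dist V N \<xi> \<eta> = dual_dist V N \<eta> \<xi>"
    by (simp add: dual_dist_def dual_norm_def op_norm_def abs_minus_commute)
  show "dual_dist V N \<xi> \<zeta> \<le> dual_dist V N \<xi> \<eta> + dual_dist V N \<eta> \<zeta>"
  proof (rule dual_dist_le[OF V])
    fix x assume x: "x \<in> V" "N x \<le> 1"
    have "dual_dist V N \<xi> \<eta> * N x \<le> dual_dist V N \<xi> \<eta>" "dual_dist V N \<eta> \<zeta> * N x \<le> dual_dist V N \<eta> \<zeta>"
      using x(2) dual_dist_nonneg[OF V] d by (simp_all add: mult_left_le)
    then show "\<bar>\<xi> x - \<zeta> x\<bar> \<le> dual_dist V N \<xi> \<eta> + dual_dist V N \<eta> \<zeta>"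
      using dual_dist_bound[OF V d(1,2) x(1)] dual_dist_bound[OF V d(2,3) x(1)] by linarith
  qed
qed

text \<open>The closed span of \<open>D\<close>: the \<open>N\<close>-closure of rational
  combinations, coded by lists of pairs of a coefficient and an index. The empty set is treated
  apart because \<open>from_nat_into\<close> enumerates nonempty sets.\<close>

lemma separable_banach_subspace:
  fixes V :: "'v::real_vector set"
  assumes V: "banach_on V N" and D: "countable D" "D \<subseteq> V"
  obtains W where "D \<subseteq> W" "W \<subseteq> V" "banach_on W N" "separable_for W (norm_dist W N)"
proof (cases "D = {}")
  case True
  have "normed_on {0} N"
    using V normed_on_subspace[of V N "{0}"] subspace_0 by (auto simp: banach_on_def normed_on_def)
  then have "banach_on {0} N" using normed_onD(6) by (fastforce simp: banach_on_iff)
  moreover have "separable_for {0} (norm_dist {0} N)"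
    using \<open>normed_on {0} N\<close> normed_onD(6)[of "{0}" N]
    unfolding separable_for_def by (intro exI[of _ "{0}"]) (auto simp: norm_dist_def)
  moreover have "{0} \<subseteq> V" using V subspace_0 by (auto simp: banach_on_def normed_on_def)
  ultimately show thesis using True that[of "{0}"] by simp
next
  case False
  have nV: "normed_on V N" using V by (simp add: banach_on_def)
  note sub = normed_onD(1)[OF nV] and tri = normed_onD(4)[OF nV] and sc = normed_onD(5)[OF nV]
  define comb where "comb l = sum_list (map (\<lambda>(q, i). real_of_rat q *\<^sub>R from_nat_into D i) l)" for l
  have "from_nat_into D i \<in> V" for i using D(2) from_nat_into[OF False] by blast
  then have comb_V: "comb l \<in> V" for l
    by (induction l) (auto simp: comb_def intro!: subspace_add[OF sub] subspace_scale[OF sub] subspace_0[OF sub])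
  have comb_append: "comb (l @ l') = comb l + comb l'" for l l' by (simp add: comb_def)
  have comb_scale: "comb (map (\<lambda>(q, i). (r * q, i)) l) = real_of_rat r *\<^sub>R comb l" for r l
    by (induction l) (auto simp: comb_def of_rat_mult scaleR_add_right)
  define W where "W = {v \<in> V. \<forall>e>0. \<exists>l. N (v - comb l) < e}"
  have WV: "W \<subseteq> V" by (auto simp: W_def)
  have comb_W: "comb l \<in> W" for l
    using comb_V[of l] normed_onD(6)[OF nV] by (auto simp: W_def intro!: exI[of _ l])
  have W_approx: "\<exists>l. N (v - comb l) < e" if "v \<in> W" "0 < e" for v e
    using that by (simp add: W_def)
  have "subspace W"
  proof (rule subspaceI)
    show "0 \<in> W" using comb_W[of "[]"] by (simp add: comb_def)
    show "u + v \<in> W" if uv: "u \<in> W" "v \<in> W" for u v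
      unfolding W_def
    proof (intro CollectI conjI allI impI)
      show "u + v \<in> V" using uv WV by (blast intro: subspace_add[OF sub])
      fix e :: real assume "0 < e"
      obtain l l' where l: "N (u - comb l) < e / 2" "N (v - comb l') < e / 2"
        using W_approx[OF uv(1), of "e / 2"] W_approx[OF uv(2), of "e / 2"] \<open>0 < e\<close> by auto
      have "N ((u - comb l) + (v - comb l')) \<le> N (u - comb l) + N (v - comb l')"
        using uv WV comb_V by (intro tri subspace_diff[OF sub]) auto
      then have "N (u + v - comb (l @ l')) < e" using l by (simp add: comb_append algebra_simps)
      then show "\<exists>l. N (u + v - comb l) < e" by blast
    qed
    show "c *\<^sub>R v \<in> W" if v: "v \<in> W" for c v
      unfolding W_def
    proof (intro CollectI conjI allI impI)
      have vV: "v \<in> V" using v WV by blast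
      show "c *\<^sub>R v \<in> V" using vV by (intro subspace_scale[OF sub])
      fix e :: real assume "0 < e"
      \<comment> \<open>The scalar is rounded to a rational first; then the approximation of
        \<open>v\<close> must be good enough to survive multiplication by that rational.\<close>
      define \<delta> where "\<delta> = e / (2 * (N v + 1))"
      have \<delta>: "0 < \<delta>" "\<delta> * N v < e / 2"
        using \<open>0 < e\<close> normed_onD(2)[OF nV vV] by (auto simp: \<delta>_def field_simps)
      obtain q where q: "c - \<delta> < real_of_rat q" "real_of_rat q < c + \<delta>"
        using of_rat_dense[of "c - \<delta>" "c + \<delta>"] \<delta>(1) by auto
      have cq: "\<bar>c - real_of_rat q\<bar> \<le> \<delta>" using q by linarith
      define a where "a = \<bar>real_of_rat q\<bar>"
      have a: "0 \<le> a" by (simp add: a_def)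
      have "0 < e / (2 * (a + 1))"
        using a \<open>0 < e\<close> by (intro divide_pos_pos) auto
      from W_approx[OF v this] obtain l where l: "N (v - comb l) < e / (2 * (a + 1))"
        by blast
      have "N ((c - real_of_rat q) *\<^sub>R v + real_of_rat q *\<^sub>R (v - comb l)) \<le>
          N ((c - real_of_rat q) *\<^sub>R v) + N (real_of_rat q *\<^sub>R (v - comb l))"
        using vV comb_V by (intro tri subspace_scale[OF sub] subspace_diff[OF sub])
      also have "N ((c - real_of_rat q) *\<^sub>R v) \<le> \<delta> * N v"
        using sc[OF vV] mult_right_mono[OF cq normed_onD(2)[OF nV vV]] by simp
      also have "N (real_of_rat q *\<^sub>R (v - comb l)) \<le> e / 2"
      proof -
        have "N (real_of_rat q *\<^sub>R (v - comb l)) = a * N (v - comb l)"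
          unfolding a_def using vV comb_V by (intro sc subspace_diff[OF sub])
        also have "\<dots> \<le> a * (e / (2 * (a + 1)))"
          using l a by (intro mult_left_mono) auto
        also have "\<dots> \<le> e / 2" using \<open>0 < e\<close> a by (simp add: field_simps)
        finally show ?thesis .
      qed
      also have "(c - real_of_rat q) *\<^sub>R v + real_of_rat q *\<^sub>R (v - comb l) =
          c *\<^sub>R v - comb (map (\<lambda>(r, i). (q * r, i)) l)"
        unfolding comb_scale by (simp add: algebra_simps)
      finally have "N (c *\<^sub>R v - comb (map (\<lambda>(r, i). (q * r, i)) l)) < e" using \<delta>(2) by linarith
      then show "\<exists>l. N (c *\<^sub>R v - comb l) < e" by blast
    qed
  qed
  then have nW: "normed_on W N" by (rule normed_on_subspace[OF nV _ WV])
  have "banach_on W N"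
    unfolding banach_on_iff
  proof (intro conjI nW allI impI)
    fix \<sigma> :: "nat \<Rightarrow> 'v"
    assume \<sigma>: "\<forall>n. \<sigma> n \<in> W" "\<forall>e>0. \<exists>M. \<forall>m n. M \<le> m \<longrightarrow> M \<le> n \<longrightarrow> N (\<sigma> m - \<sigma> n) < e"
    have \<sigma>V: "\<sigma> n \<in> V" for n using \<sigma>(1) WV by blast
    then obtain x where x: "x \<in> V" "\<forall>e>0. \<exists>M. \<forall>n\<ge>M. N (\<sigma> n - x) < e"
      using V \<sigma>(2) unfolding banach_on_iff by metis
    have "\<exists>l. N (x - comb l) < e" if e: "0 < e" for e
    proof -
      obtain n where n: "N (\<sigma> n - x) < e / 2" using x(2) half_gt_zero[OF e] by blast
      obtain l where l: "N (\<sigma> n - comb l) < e / 2" using W_approx \<sigma>(1) half_gt_zero[OF e] by blast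
      have "N ((x - \<sigma> n) + (\<sigma> n - comb l)) \<le> N (x - \<sigma> n) + N (\<sigma> n - comb l)"
        using x(1) \<sigma>V comb_V by (intro tri subspace_diff[OF sub])
      moreover have "N (x - \<sigma> n) = N (\<sigma> n - x)" by (rule normed_on_minus_commute[OF nV x(1) \<sigma>V])
      ultimately show ?thesis using n l by (intro exI[of _ l]) simp
    qed
    then have "x \<in> W" using x(1) by (simp add: W_def)
    then show "\<exists>x\<in>W. \<forall>e>0. \<exists>M. \<forall>n\<ge>M. N (\<sigma> n - x) < e" using x(2) by blast
  qed
  moreover have "separable_for W (norm_dist W N)"
    unfolding separable_for_def
  proof (intro exI[of _ "range comb"] conjI ballI allI impI)
    fix x and e :: real assume x: "x \<in> W" and "0 < e"
    obtain l where "N (x - comb l) < e" using W_approx[OF x \<open>0 < e\<close>] by blast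
    then show "\<exists>y\<in>range comb. norm_dist W N x y < e"
      using x comb_W by (intro bexI[of _ "comb l"]) (auto simp: norm_dist_def)
  qed (use comb_W in auto)
  moreover have "D \<subseteq> W"
  proof
    fix d assume "d \<in> D"
    then obtain i where "d = from_nat_into D i" using D(1) from_nat_into_to_nat_on by metis
    then have "comb [(1, i)] = d" by (simp add: comb_def)
    then show "d \<in> W" using comb_W by metis
  qed
  ultimately show thesis using WV by (intro that)
qed

lemma translate_bound:
  assumes "continuous_on UNIV (act s)"
  shows "norm (translate act f s) \<le> norm (f :: 'x::topological_space \<Rightarrow>\<^sub>C real)"
proof (rule norm_bound)
  show "norm (apply_bcontfun (translate act f s) x) \<le> norm f" for x
    using norm_bounded[of f "act s x"] by (simp add: apply_translate[where act = act, OF assms])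
qed

lemma topspace_weak_star_topology: "topspace (weak_star_topology V N) = dual V N"
  unfolding weak_star_topology_def by (rule topspace_initial_topology) simp

lemma continuous_map_weak_star_evaluation:
  assumes "v \<in> V"
  shows "continuous_map (weak_star_topology V N) euclideanreal (\<lambda>\<phi>. \<phi> v)"
proof -
  have "continuous_map (weak_star_topology V N) (weak_star_topology V N) id" by (rule continuous_map_id)
  then have "\<forall>g\<in>{(\<lambda>\<phi>. \<phi> v) |v. v \<in> V}. continuous_map (weak_star_topology V N) euclideanreal (g \<circ> id)"
    unfolding weak_star_topology_def by (subst (asm) continuous_map_initial_topology) auto
  then show ?thesis using assms by (auto simp: o_def)
qed

lemma weak_star_continuousD:
  assumes "weak_star_continuous V N \<alpha>"
  shows "\<alpha> x \<in> dual V N" "dual_norm V N (\<alpha> x) \<le> 1" "v \<in> V \<Longrightarrow> continuous_on UNIV (\<lambda>x. \<alpha> x v)"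
proof -
  show "\<alpha> x \<in> dual V N" "dual_norm V N (\<alpha> x) \<le> 1"
    using assms by (auto simp: weak_star_continuous_def dual_ball_def)
  have "continuous_map euclidean (weak_star_topology V N) \<alpha>"
    using assms by (simp add: weak_star_continuous_def)
  then have "continuous_map euclidean euclideanreal ((\<lambda>\<phi>. \<phi> v) \<circ> \<alpha>)" if "v \<in> V"
    using continuous_map_weak_star_evaluation[OF that] by (rule continuous_map_compose)
  then show "v \<in> V \<Longrightarrow> continuous_on UNIV (\<lambda>x. \<alpha> x v)" by (simp add: o_def)
qed

lemma contractionD:
  assumes "normed_on V N" "\<sigma> \<in> contractions V N" "v \<in> V"
  shows "\<sigma> v \<in> V" "N (\<sigma> v) \<le> N v"
proof -
  have \<sigma>: "\<sigma> \<in> bounded_ops V N V N" "op_norm V N N \<sigma> \<le> 1" using assms(2) by (auto simp: contractions_def)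
  then show "\<sigma> v \<in> V" using assms(3) by (simp add: bounded_ops_def)
  show "N (\<sigma> v) \<le> N v"
    using op_norm_bound[OF assms(1,1) \<sigma>(1) assms(3)] mult_right_mono[OF \<sigma>(2) normed_onD(2)[OF assms(1,3)]]
    by simp
qed

text \<open>Equivariance moves the translation onto the vector: \<open>fs\<close> is represented by
  \<open>h s v\<close>, and contractions keep all these vectors in one ball.\<close>

lemma orbit_represented:
  assumes V: "normed_on V N" and act: "\<And>s. continuous_on UNIV (act s)"
    and h: "antihomomorphism V N h" and eq: "equivariant act V h \<alpha>"
    and v: "v \<in> V" and f: "\<And>x. apply_bcontfun f x = \<alpha> x v" and c: "c \<in> orbit act f"
  shows "\<exists>d\<in>V. N d \<le> N v \<and> (\<forall>x. apply_bcontfun c x = \<alpha> x d)"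
proof -
  obtain s where c: "c = translate act f s" using c by (auto simp: orbit_def)
  have hs: "h s \<in> contractions V N" using h by (simp add: antihomomorphism_def)
  have "apply_bcontfun c x = \<alpha> x (h s v)" for x
    using eq v by (simp add: c apply_translate[where act = act, OF act] f equivariant_def)
  then show ?thesis using contractionD[OF V hs v] by blast
qed

lemma asplund_set_orbitI:
  assumes act: "\<And>s. continuous_on UNIV (act s)"
    and "\<And>C. C \<subseteq> orbit act f \<Longrightarrow> countable C \<Longrightarrow> C \<noteq> {} \<Longrightarrow>
      separable_for (dual UNIV norm) (sup_dist C)"
  shows "f \<in> Asp act"
  unfolding Asp_def asplund_set_def
  using assms(2) translate_bound[where act = act and f = f, OF act] by (auto simp: orbit_def)

text \<open>Vectors representing a countable \<open>C\<close> lie in a separable Banach subspace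
  \<open>W\<close>, whose dual is separable. \<open>sup_dist C\<close> is at most \<open>N v\<close>
  times the dual distance of the pulled-back functionals, so small covers return to the dual of
  \<open>C(X)\<close>.\<close>

lemma represented_in_asplund_space_imp_Asp:
  fixes act :: "'s::semigroup_mult \<Rightarrow> 'x::topological_space \<Rightarrow> 'x"
  assumes comp: "compact (UNIV :: 'x set)" and act: "\<And>s. continuous_on UNIV (act s)"
    and V: "asplund_space V N" and h: "antihomomorphism V N h"
    and \<alpha>: "weak_star_continuous V N \<alpha>" and eq: "equivariant act V h \<alpha>"
    and v: "v \<in> V" and f: "\<And>x. apply_bcontfun f x = \<alpha> x v"
  shows "f \<in> Asp act"
proof (rule asplund_set_orbitI[OF act])
  fix C assume C: "C \<subseteq> orbit act f" "countable C" "C \<noteq> {}"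
  have bV: "banach_on V N" and nV: "normed_on V N"
    using V by (auto simp: asplund_space_def banach_on_def)
  have "\<forall>c\<in>C. \<exists>d\<in>V. N d \<le> N v \<and> (\<forall>x. apply_bcontfun c x = \<alpha> x d)"
    using orbit_represented[OF nV act h eq v f] C(1) by blast
  then obtain d where d: "\<And>c. c \<in> C \<Longrightarrow> d c \<in> V" "\<And>c. c \<in> C \<Longrightarrow> N (d c) \<le> N v"
    "\<And>c x. c \<in> C \<Longrightarrow> apply_bcontfun c x = \<alpha> x (d c)" by metis
  have "countable (d ` C)" "d ` C \<subseteq> V" using C(2) d(1) by auto
  from separable_banach_subspace[OF bV this] obtain W where W: "d ` C \<subseteq> W" "W \<subseteq> V"
    "banach_on W N" "separable_for W (norm_dist W N)" by metis
  have nW: "normed_on W N" using W(3) by (simp add: banach_on_def)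
  have "separable_for (dual W N) (dual_dist W N)" using V W by (simp add: asplund_space_def)
  then have small: "ctbl_small (dual W N) (dual_dist W N)" by (rule ctbl_small_dual_dist[OF nW])
  define T where "T v = Bcontfun (\<lambda>x. \<alpha> x v)" for v
  have T: "apply_bcontfun (T v) x = \<alpha> x v" if "v \<in> V" for v x
    unfolding T_def using weak_star_continuousD(3)[OF \<alpha> that] by (simp add: apply_Bcontfun_compact[OF comp])
  have \<alpha>lin: "\<alpha> x (u + v) = \<alpha> x u + \<alpha> x v" "\<alpha> x (c *\<^sub>R u) = c * \<alpha> x u" if "u \<in> V" "v \<in> V" for x u v c
    using weak_star_continuousD(1)[OF \<alpha>, of x] that by (auto simp: dual_def bounded_ops_def)
  have T_bound: "norm (T v) \<le> N v" if "v \<in> V" for v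
  proof (rule norm_bound)
    fix x
    have "\<bar>\<alpha> x v\<bar> \<le> dual_norm V N (\<alpha> x) * N v"
      using weak_star_continuousD(1)[OF \<alpha>, of x] op_norm_bound[OF nV normed_on_abs _ that]
      by (simp add: dual_def dual_norm_def)
    also have "\<dots> \<le> N v"
      using mult_right_mono[OF weak_star_continuousD(2)[OF \<alpha>] normed_onD(2)[OF nV that], of x] by simp
    finally show "norm (apply_bcontfun (T v) x) \<le> N v" by (simp add: T[OF that])
  qed
  \<comment> \<open>The adjoint of \<open>T\<close> restricted to \<open>W\<close>, normalized to
    vanish off \<open>W\<close>.\<close>
  define R where "R \<xi> v = (if v \<in> W then \<xi> (T v) else 0)" for \<xi> :: "('x \<Rightarrow>\<^sub>C real) \<Rightarrow> real" and v
  have R: "R \<xi> \<in> dual W N" if "\<xi> \<in> dual UNIV norm" for \<xi>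
  proof -
    have "bounded_linear \<xi>" using that by (simp add: dual_UNIV)
    then interpret bounded_linear \<xi> .
    have "T (u + v) = T u + T v" "T (c *\<^sub>R u) = c *\<^sub>R T u" if "u \<in> W" "v \<in> W" for u v c
      using that W(2) normed_onD(1)[OF nV] \<alpha>lin
      by (auto intro!: bcontfun_eqI simp: T subspace_add subspace_scale subset_iff)
    moreover obtain K where K: "0 \<le> K" "\<And>g. norm (\<xi> g) \<le> norm g * K" using nonneg_bounded by blast
    have "\<bar>\<xi> (T v)\<bar> \<le> K * N v" if "v \<in> W" for v
      using K(2)[of "T v"] mult_left_mono[OF T_bound K(1), of v] that W(2) by (auto simp: mult.commute)
    then have "\<exists>K. \<forall>v\<in>W. \<bar>\<xi> (T v)\<bar> \<le> K * N v" by blast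
    ultimately show ?thesis
      unfolding dual_def bounded_ops_def R_def using normed_onD(1)[OF nW]
      by (auto simp: subspace_add subspace_scale add scale)
  qed
  have "ctbl_small (dual UNIV norm) (sup_dist C)"
  proof (rule ctbl_small_pullback[OF small])
    fix e :: real assume "0 < e"
    define \<delta> where "\<delta> = e / (2 * (N v + 1))"
    have \<delta>: "0 < \<delta>" "\<delta> * N v \<le> e / 2"
      using \<open>0 < e\<close> normed_onD(2)[OF nV v] by (auto simp: \<delta>_def field_simps)
    have "sup_dist C \<xi> \<eta> < e"
      if \<xi>: "\<xi> \<in> dual UNIV norm" and \<eta>: "\<eta> \<in> dual UNIV norm" and less: "dual_dist W N (R \<xi>) (R \<eta>) < \<delta>" for \<xi> \<eta>
    proof -
      have "\<bar>\<xi> c - \<eta> c\<bar> \<le> e / 2" if c: "c \<in> C" for c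
      proof -
        have dW: "d c \<in> W" using W(1) c by blast
        have "T (d c) = c" using d(1,3)[OF c] by (intro bcontfun_eqI) (simp add: T)
        then have "\<bar>\<xi> c - \<eta> c\<bar> = \<bar>R \<xi> (d c) - R \<eta> (d c)\<bar>" using dW by (simp add: R_def)
        also have "\<dots> \<le> dual_dist W N (R \<xi>) (R \<eta>) * N (d c)"
          by (rule dual_dist_bound[OF nW R[OF \<xi>] R[OF \<eta>] dW])
        also have "\<dots> \<le> \<delta> * N v"
          using less d(2)[OF c] \<delta>(1) normed_onD(2)[OF nW dW] by (intro mult_mono) auto
        finally show ?thesis using \<delta>(2) by linarith
      qed
      then have "sup_dist C \<xi> \<eta> \<le> e / 2" using C(3) by (intro cSUP_least)
      then show ?thesis using \<open>0 < e\<close> by linarith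
    qed
    then show "\<exists>f \<delta>. 0 < \<delta> \<and> (\<forall>x\<in>dual UNIV norm. f x \<in> dual W N) \<and>
        (\<forall>x\<in>dual UNIV norm. \<forall>y\<in>dual UNIV norm. dual_dist W N (f x) (f y) < \<delta> \<longrightarrow>
          sup_dist C x y < e)"
      using \<delta>(1) R by (intro exI[of _ R] exI[of _ \<delta>]) simp
  qed
  then show "separable_for (dual UNIV norm) (sup_dist C)"
    by (rule ctbl_small_imp_separable_for)
qed

text \<open>A weak-star open piece of small norm diameter pulls back along \<open>\<alpha>\<close>
  to an open set on which all members of the orbit oscillate little, because they are represented by
  vectors of \<open>N\<close> at most \<open>N v\<close>. The points are then separable for each
  countable \<open>C\<close>.\<close>

lemma represented_fragmented_imp_Asp:
  fixes act :: "'s::semigroup_mult \<Rightarrow> 'x::t2_space \<Rightarrow> 'x"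
  assumes comp: "compact (UNIV :: 'x set)" and act: "\<And>s. continuous_on UNIV (act s)"
    and nV: "normed_on V N" and h: "antihomomorphism V N h"
    and \<alpha>: "weak_star_continuous V N \<alpha>" and eq: "equivariant act V h \<alpha>"
    and frag: "fragmented V N (range \<alpha>)"
    and v: "v \<in> V" and f: "\<And>x. apply_bcontfun f x = \<alpha> x v"
  shows "f \<in> Asp act"
proof (rule asplund_set_orbitI[OF act])
  fix C assume C: "C \<subseteq> orbit act f" "countable C" "C \<noteq> {}"
  have norm_C: "norm c \<le> norm f" if "c \<in> C" for c
    using that C(1) translate_bound[where act = act and f = f, OF act] by (auto simp: orbit_def)
  define c where "c = from_nat_into C"
  have c: "range c = C" unfolding c_def using C(2,3) by (intro range_from_nat_into)
  have rep: "\<exists>d\<in>V. N d \<le> N v \<and> (\<forall>x. apply_bcontfun (c k) x = \<alpha> x d)" for k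
    using C(1) c by (intro orbit_represented[OF nV act h eq v f]) auto
  have "ctbl_small UNIV (point_dist C)"
  proof (rule ctbl_smallI)
    fix e :: real assume "0 < e"
    define \<delta> where "\<delta> = e / (2 * (N v + 1))"
    have \<delta>: "0 < \<delta>" "\<delta> * N v \<le> e / 2"
      using \<open>0 < e\<close> normed_onD(2)[OF nV v] by (auto simp: \<delta>_def field_simps)
    have "\<exists>G. countable G \<and> UNIV \<subseteq> \<Union>G \<and>
        (\<forall>g\<in>G. \<forall>x\<in>g. \<forall>y\<in>g. \<forall>k. \<bar>apply_bcontfun (c k) x - c k y\<bar> \<le> e / 2)"
    proof (rule fragmented_imp_countable_cover[OF comp])
      fix Z :: "'x set" assume "closed Z" "Z \<noteq> {}"
      have "\<alpha> ` Z \<subseteq> range \<alpha> \<and> \<alpha> ` Z \<noteq> {} \<and> 0 < \<delta>" using \<open>Z \<noteq> {}\<close> \<delta>(1) by blast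
      from frag[unfolded fragmented_def, THEN spec, THEN spec, THEN mp, OF this]
      obtain U where U: "openin (weak_star_topology V N) U" "U \<inter> \<alpha> ` Z \<noteq> {}"
        and diam: "\<forall>\<xi>\<in>U \<inter> \<alpha> ` Z. \<forall>\<eta>\<in>U \<inter> \<alpha> ` Z. dual_dist V N \<xi> \<eta> \<le> \<delta>"
        by (elim exE conjE) (rule that)
      have "continuous_map euclidean (weak_star_topology V N) \<alpha>"
        using \<alpha> by (simp add: weak_star_continuous_def)
      from openin_continuous_map_preimage[OF this U(1)] have "open (\<alpha> -` U)"
        by (simp add: vimage_def)
      moreover have "\<alpha> -` U \<inter> Z \<noteq> {}" using U(2) by blast
      moreover have "\<bar>apply_bcontfun (c k) x - c k y\<bar> \<le> e / 2" if "x \<in> \<alpha> -` U \<inter> Z" "y \<in> \<alpha> -` U \<inter> Z" for x y k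
      proof -
        obtain d where d: "d \<in> V" "N d \<le> N v" "\<And>x. apply_bcontfun (c k) x = \<alpha> x d" using rep by blast
        have "\<bar>\<alpha> x d - \<alpha> y d\<bar> \<le> dual_dist V N (\<alpha> x) (\<alpha> y) * N d"
          by (intro dual_dist_bound[OF nV] weak_star_continuousD(1)[OF \<alpha>] d(1))
        also have "\<dots> \<le> \<delta> * N v"
          using that diam d(2) \<delta>(1) normed_onD(2)[OF nV d(1)] by (intro mult_mono) auto
        finally show ?thesis using \<delta>(2) by (simp add: d(3))
      qed
      ultimately show "\<exists>Q. open Q \<and> Q \<inter> Z \<noteq> {} \<and>
          (\<forall>x\<in>Q \<inter> Z. \<forall>y\<in>Q \<inter> Z. \<forall>k. \<bar>apply_bcontfun (c k) x - c k y\<bar> \<le> e / 2)" by blast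
    qed simp
    then obtain G where G: "countable G" "UNIV \<subseteq> \<Union>G"
      and small: "\<forall>g\<in>G. \<forall>x\<in>g. \<forall>y\<in>g. \<forall>k. \<bar>apply_bcontfun (c k) x - c k y\<bar> \<le> e / 2" by blast
    have "point_dist C x y < e" if "g \<in> G" "x \<in> g" "y \<in> g" for g x y
    proof -
      have "\<bar>apply_bcontfun c' x - c' y\<bar> \<le> e / 2" if "c' \<in> C" for c'
        using small \<open>g \<in> G\<close> \<open>x \<in> g\<close> \<open>y \<in> g\<close> that unfolding c[symmetric] by blast
      then have "point_dist C x y \<le> e / 2" using C(3) by (intro cSUP_least)
      then show ?thesis using \<open>0 < e\<close> by linarith
    qed
    then show "\<exists>G. countable G \<and> UNIV \<subseteq> \<Union>G \<and> (\<forall>g\<in>G. \<forall>x\<in>g \<inter> UNIV. \<forall>y\<in>g \<inter> UNIV.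
        point_dist C x y < e)"
      using G by (intro exI[of _ G]) simp
  qed
  then have "separable_for UNIV (point_dist C)"
    by (rule ctbl_small_imp_separable_for)
  then show "separable_for (dual UNIV norm) (sup_dist C)"
    by (rule separable_points_imp_separable_dual[OF comp C(2,3), rotated]) (rule norm_C)
qed

lemma asplund_representable_imp_Asp:
  fixes act :: "'s::{semigroup_mult,topological_space} \<Rightarrow> 'x::topological_space \<Rightarrow> 'x"
  assumes "compact (UNIV :: 'x set)" "\<And>s. continuous_on UNIV (act s)"
    and "asplund_representable TYPE('v::real_vector) act f"
  shows "f \<in> Asp act"
proof -
  obtain V :: "'v set" and N h \<alpha> v where "asplund_space V N" "representation act V N h \<alpha>" "v \<in> V"
    "\<forall>x. apply_bcontfun f x = \<alpha> x v"
    using assms(3) unfolding asplund_representable_def by blast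
  then show ?thesis
    unfolding representation_def
    by (intro represented_in_asplund_space_imp_Asp[where act = act and f = f and h = h and \<alpha> = \<alpha> and V = V and N = N and v = v] assms(1,2)) auto
qed

lemma strongly_asplund_representable_imp_Asp:
  fixes act :: "'s::{semigroup_mult,topological_space} \<Rightarrow> 'x::topological_space \<Rightarrow> 'x"
  assumes "compact (UNIV :: 'x set)" "\<And>s. continuous_on UNIV (act s)"
    and "strongly_asplund_representable TYPE('v::real_vector) act f"
  shows "f \<in> Asp act"
proof -
  obtain V :: "'v set" and N h \<alpha> v where "asplund_space V N" "antihomomorphism V N h"
    "weak_star_continuous V N \<alpha>" "equivariant act V h \<alpha>" "v \<in> V" "\<forall>x. apply_bcontfun f x = \<alpha> x v"
    using assms(3) unfolding strongly_asplund_representable_def by blast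
  then show ?thesis
    by (intro represented_in_asplund_space_imp_Asp[where act = act and f = f and h = h and \<alpha> = \<alpha> and V = V and N = N and v = v] assms(1,2)) auto
qed

lemma fragmented_representable_imp_Asp:
  fixes act :: "'s::semigroup_mult \<Rightarrow> 'x::t2_space \<Rightarrow> 'x"
  assumes "compact (UNIV :: 'x set)" "\<And>s. continuous_on UNIV (act s)"
    and "fragmented_representable TYPE('v::real_vector) act f"
  shows "f \<in> Asp act"
proof -
  obtain V :: "'v set" and N h \<alpha> v where "normed_on V N" "antihomomorphism V N h"
    "weak_star_continuous V N \<alpha>" "equivariant act V h \<alpha>" "fragmented V N (range \<alpha>)" "v \<in> V"
    "\<forall>x. apply_bcontfun f x = \<alpha> x v"
    using assms(3) unfolding fragmented_representable_def banach_on_def by blast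
  then show ?thesis
    by (intro represented_fragmented_imp_Asp[where act = act and f = f and h = h and \<alpha> = \<alpha> and V = V and N = N and v = v] assms(1,2)) auto
qed

section \<open>Asplund functions are representable\<close>

lemma ctbl_small_real: "ctbl_small (UNIV :: real set) (\<lambda>x y. \<bar>x - y\<bar>)"
proof (rule separable_for_imp_ctbl_small)
  have "\<exists>y\<in>\<rat>. \<bar>x - y\<bar> < \<epsilon>" if "0 < \<epsilon>" for x \<epsilon> :: real
  proof -
    obtain q where "x < real_of_rat q" "real_of_rat q < x + \<epsilon>"
      using of_rat_dense[of x "x + \<epsilon>"] \<open>0 < \<epsilon>\<close> by auto
    then show ?thesis by (intro bexI[of _ "real_of_rat q"]) (auto simp: Rats_def)
  qed
  then show "separable_for UNIV (\<lambda>x y :: real. \<bar>x - y\<bar>)"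
    unfolding separable_for_def using countable_rat by (intro exI[of _ "\<rat>"]) auto
qed auto

lemma asplund_set_ctbl_small:
  assumes "asplund_set UNIV norm M" "C \<subseteq> M" "countable C" "C \<noteq> {}"
  shows "ctbl_small (dual UNIV norm) (sup_dist C)"
proof -
  obtain K where "\<forall>m\<in>M. norm m \<le> K" using assms(1) unfolding asplund_set_def by blast
  then have K: "norm c \<le> K" if "c \<in> C" for c using that assms(2) by blast
  have "separable_for (dual UNIV norm) (sup_dist C)"
    using assms unfolding asplund_set_def by simp
  then show ?thesis by (rule ctbl_small_dual) (fact assms(4), fact K)
qed

text \<open>Closeness on \<open>C\<close> follows from closeness on a countable part of
  \<open>M\<close> and at the single vector \<open>f\<close>; the latter pulls back covers of the
  real line.\<close>

lemma asplund_set_insert: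
  assumes M: "asplund_set UNIV norm M"
  shows "asplund_set UNIV norm (insert f M)"
  unfolding asplund_set_def
proof (intro conjI allI impI)
  obtain K where K: "\<forall>m\<in>M. norm m \<le> K" using M unfolding asplund_set_def by blast
  then show "\<exists>K. \<forall>m\<in>insert f M. norm m \<le> K" by (intro exI[of _ "max K (norm f)"]) force
  fix C assume C: "C \<subseteq> insert f M \<and> countable C \<and> C \<noteq> {}"
  obtain m where m: "m \<in> M" using M by (auto simp: asplund_set_def)
  \<comment> \<open>The extra member \<open>m\<close> keeps \<open>C'\<close> nonempty when
    \<open>C\<close> is just \<open>{f}\<close>.\<close>
  define C' where "C' = insert m (C - {f})"
  have C': "C' \<subseteq> M" "countable C'" "C' \<noteq> {}" unfolding C'_def using C m by auto
  have f: "ctbl_small (dual UNIV norm) (\<lambda>\<xi> \<eta>. \<bar>\<xi> f - \<eta> f\<bar>)"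
  proof (rule ctbl_small_pullback[OF ctbl_small_real])
    show "\<exists>(g :: _ \<Rightarrow> real) \<delta>. 0 < \<delta> \<and> (\<forall>\<xi>\<in>dual UNIV norm. g \<xi> \<in> UNIV) \<and> (\<forall>\<xi>\<in>dual UNIV norm. \<forall>\<eta>\<in>dual UNIV norm.
        \<bar>g \<xi> - g \<eta>\<bar> < \<delta> \<longrightarrow> \<bar>\<xi> f - \<eta> f\<bar> < \<epsilon>)" if "0 < \<epsilon>" for \<epsilon>
      using that by (intro exI[of _ "\<lambda>\<xi>. \<xi> f"] exI[of _ \<epsilon>]) simp
  qed
  have "ctbl_small (dual UNIV norm) (sup_dist C)"
  proof (rule ctbl_small_two[OF asplund_set_ctbl_small[OF M C'] f])
    fix \<epsilon> :: real assume "0 < \<epsilon>"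
    have "sup_dist C \<xi> \<eta> < \<epsilon>"
      if \<xi>\<eta>: "\<xi> \<in> dual UNIV norm" "\<eta> \<in> dual UNIV norm"
        and less: "sup_dist C' \<xi> \<eta> < \<epsilon> / 2" "\<bar>\<xi> f - \<eta> f\<bar> < \<epsilon> / 2" for \<xi> \<eta>
    proof -
      have "\<bar>\<xi> c - \<eta> c\<bar> \<le> \<epsilon> / 2" if "c \<in> C" for c
      proof (cases "c = f")
        case False
        then have "\<bar>\<xi> c - \<eta> c\<bar> \<le> sup_dist C' \<xi> \<eta>"
          using \<xi>\<eta> that K C'(1)
          by (intro cSUP_upper bdd_above_bounded_functional_diff[of _ _ _ K])
            (auto simp: dual_UNIV C'_def)
        then show ?thesis using less(1) by linarith
      qed (use less(2) in simp)
      then have "sup_dist C \<xi> \<eta> \<le> \<epsilon> / 2" using C by (intro cSUP_least) auto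
      then show ?thesis using \<open>0 < \<epsilon>\<close> by linarith
    qed
    then show "\<exists>\<delta>>0. \<forall>\<xi>\<in>dual UNIV norm. \<forall>\<eta>\<in>dual UNIV norm.
        sup_dist C' \<xi> \<eta> < \<delta> \<and> \<bar>\<xi> f - \<eta> f\<bar> < \<delta> \<longrightarrow> sup_dist C \<xi> \<eta> < \<epsilon>"
      using \<open>0 < \<epsilon>\<close> by (intro exI[of _ "\<epsilon> / 2"]) simp
  qed
  then show "separable_for (dual UNIV norm) (sup_dist C)"
    by (rule ctbl_small_imp_separable_for)
qed simp_all

lemma asplund_set_scaleR:
  assumes M: "asplund_set UNIV norm M"
  shows "asplund_set UNIV norm ((*\<^sub>R) r ` M)"
  unfolding asplund_set_def
proof (intro conjI allI impI)
  obtain K where K: "\<forall>m\<in>M. norm m \<le> K" using M unfolding asplund_set_def by blast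
  then show "\<exists>K. \<forall>m\<in>(*\<^sub>R) r ` M. norm m \<le> K"
    by (intro exI[of _ "\<bar>r\<bar> * K"]) (auto intro: mult_left_mono)
  show "(*\<^sub>R) r ` M \<noteq> {}" using M by (simp add: asplund_set_def)
  fix C assume C: "C \<subseteq> (*\<^sub>R) r ` M \<and> countable C \<and> C \<noteq> {}"
  then obtain C' where C': "C' \<subseteq> M" "countable C'" "C = (*\<^sub>R) r ` C'"
    by (meson countable_subset_image)
  have ne: "C' \<noteq> {}" using C C'(3) by auto
  have "ctbl_small (dual UNIV norm) (sup_dist C)"
  proof (rule ctbl_small_pullback[OF asplund_set_ctbl_small[OF M C'(1,2) ne]])
    fix \<epsilon> :: real assume "0 < \<epsilon>"
    define \<delta> where "\<delta> = \<epsilon> / (2 * (\<bar>r\<bar> + 1))"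
    have \<delta>: "0 < \<delta>" "\<bar>r\<bar> * \<delta> \<le> \<epsilon> / 2" using \<open>0 < \<epsilon>\<close> by (auto simp: \<delta>_def field_simps)
    have "sup_dist C \<xi> \<eta> < \<epsilon>"
      if \<xi>\<eta>: "\<xi> \<in> dual UNIV norm" "\<eta> \<in> dual UNIV norm"
        and less: "sup_dist C' \<xi> \<eta> < \<delta>" for \<xi> \<eta>
    proof -
      have bl: "bounded_linear \<xi>" "bounded_linear \<eta>" using \<xi>\<eta> by (auto simp: dual_UNIV)
      have "\<bar>\<xi> (r *\<^sub>R c) - \<eta> (r *\<^sub>R c)\<bar> \<le> \<epsilon> / 2" if "c \<in> C'" for c
      proof -
        have "\<bar>\<xi> c - \<eta> c\<bar> \<le> sup_dist C' \<xi> \<eta>"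
          using that K C'(1) by (intro cSUP_upper bdd_above_bounded_functional_diff[OF bl, of _ K]) auto
        then have "\<bar>r\<bar> * \<bar>\<xi> c - \<eta> c\<bar> \<le> \<bar>r\<bar> * \<delta>" using less by (intro mult_left_mono) auto
        moreover have "\<xi> (r *\<^sub>R c) - \<eta> (r *\<^sub>R c) = r * (\<xi> c - \<eta> c)"
          using bl by (simp add: linear_simps right_diff_distrib)
        ultimately show ?thesis using \<delta>(2) by (simp add: abs_mult)
      qed
      then have "sup_dist C \<xi> \<eta> \<le> \<epsilon> / 2" using C C'(3) by (intro cSUP_least) auto
      then show ?thesis using \<open>0 < \<epsilon>\<close> by linarith
    qed
    then show "\<exists>f \<delta>. 0 < \<delta> \<and> (\<forall>x\<in>dual UNIV norm. f x \<in> dual UNIV norm) \<and>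
        (\<forall>x\<in>dual UNIV norm. \<forall>y\<in>dual UNIV norm. sup_dist C' (f x) (f y) < \<delta> \<longrightarrow>
          sup_dist C x y < \<epsilon>)"
      using \<delta>(1) by (intro exI[of _ "\<lambda>x. x"] exI[of _ \<delta>]) simp
  qed
  then show "separable_for (dual UNIV norm) (sup_dist C)"
    by (rule ctbl_small_imp_separable_for)
qed simp

text \<open>Points sit in the dual as evaluations, so small covers of the dual pull back to the
  space.\<close>

lemma asplund_set_points_small:
  fixes M :: "('x::topological_space \<Rightarrow>\<^sub>C real) set"
  assumes M: "asplund_set UNIV norm M" and C: "countable C" "C \<subseteq> M" "C \<noteq> {}" and "0 < \<epsilon>"
  shows "\<exists>G :: nat \<Rightarrow> 'x set. (\<Union>n. G n) = UNIV \<and>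
    (\<forall>n. \<forall>x\<in>G n. \<forall>y\<in>G n. \<forall>c\<in>C. \<bar>c x - c y\<bar> < \<epsilon>)"
proof -
  obtain K where "\<forall>m\<in>M. norm m \<le> K" using M unfolding asplund_set_def by blast
  then have K: "norm c \<le> K" if "c \<in> C" for c using that C(2) by blast
  have small: "ctbl_small (UNIV :: 'x set) (point_dist C)"
  proof (rule ctbl_small_pullback[OF asplund_set_ctbl_small[OF M C(2,1,3)]])
    show "\<exists>f \<delta>. 0 < \<delta> \<and> (\<forall>x\<in>UNIV. f x \<in> dual UNIV norm) \<and> (\<forall>x\<in>UNIV. \<forall>y\<in>UNIV.
        sup_dist C (f x) (f y) < \<delta> \<longrightarrow> point_dist C x y < \<epsilon>)" if "0 < \<epsilon>" for \<epsilon>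
      using that
      by (intro exI[of _ "\<lambda>x f. apply_bcontfun f x"] exI[of _ \<epsilon>])
        (simp add: dual_UNIV bounded_linear_apply_bcontfun)
  qed
  obtain G :: "nat \<Rightarrow> 'x set" where G: "UNIV \<subseteq> (\<Union>n. G n)"
    "\<And>n x y. x \<in> G n \<Longrightarrow> y \<in> G n \<Longrightarrow> x \<in> UNIV \<Longrightarrow> y \<in> UNIV \<Longrightarrow>
      point_dist C x y < \<epsilon>"
    by (fact ctbl_smallE[OF small \<open>0 < \<epsilon>\<close>])
  have "\<bar>apply_bcontfun c x - c y\<bar> < \<epsilon>" if "c \<in> C" "x \<in> G n" "y \<in> G n" for c x y n
  proof -
    have "\<bar>apply_bcontfun c x - c y\<bar> \<le> point_dist C x y"
      using that(1) K by (intro cSUP_upper bdd_above_bcontfun_diff)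
    then show ?thesis using G(2)[OF that(2,3) UNIV_I UNIV_I] by linarith
  qed
  then show ?thesis using G(1) by (intro exI[of _ G]) blast
qed

section \<open>Translations on \<open>C(X)\<close> and the representation they induce\<close>

lemma complete_bcontfun: "complete (UNIV :: ('x::topological_space \<Rightarrow>\<^sub>C 'b::complete_space) set)"
  unfolding complete_def
proof (intro allI impI)
  fix \<sigma> :: "nat \<Rightarrow> 'x \<Rightarrow>\<^sub>C 'b"
  assume \<sigma>: "(\<forall>n. \<sigma> n \<in> UNIV) \<and> Cauchy \<sigma>"
  have "uniformly_Cauchy_on UNIV (\<lambda>n. apply_bcontfun (\<sigma> n))"
    unfolding uniformly_Cauchy_on_def
  proof (intro allI impI)
    fix e :: real assume "0 < e"
    then obtain M where "\<And>m n. M \<le> m \<Longrightarrow> M \<le> n \<Longrightarrow> dist (\<sigma> m) (\<sigma> n) < e"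
      using \<sigma> metric_CauchyD by blast
    then show "\<exists>M. \<forall>x\<in>UNIV. \<forall>m\<ge>M. \<forall>n\<ge>M. dist (\<sigma> m x) (\<sigma> n x) < e"
      by (intro exI[of _ M]) (simp add: dist_fun_lt_imp_dist_val_lt)
  qed
  then obtain l where "uniform_limit UNIV (\<lambda>n. apply_bcontfun (\<sigma> n)) l sequentially"
    using Cauchy_uniformly_convergent unfolding uniformly_convergent_on_def by blast
  then show "\<exists>l\<in>UNIV. \<sigma> \<longlonglongrightarrow> l"
    by (rule uniform_limit_bcontfunE) auto
qed

lemma linear_translate:
  assumes "continuous_on UNIV (act s)"
  shows "linear (\<lambda>g :: 'x::topological_space \<Rightarrow>\<^sub>C real. translate act g s)"
  by (rule linearI; rule bcontfun_eqI) (simp_all add: apply_translate[where act = act, OF assms])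

lemma translate_translate:
  fixes act :: "'s::semigroup_mult \<Rightarrow> 'x::topological_space \<Rightarrow> 'x"
  assumes "\<And>s. continuous_on UNIV (act s)" "left_action UNIV act"
  shows "translate act (translate act g s) t = translate act g (s * t)"
  using assms(2)
  by (intro bcontfun_eqI) (simp add: apply_translate[where act = act, OF assms(1)] left_action_def)

lemma translate_identity:
  fixes act :: "'s::semigroup_mult \<Rightarrow> 'x::topological_space \<Rightarrow> 'x"
  assumes "\<And>s. continuous_on UNIV (act s)" "left_action UNIV act" "is_identity e"
  shows "translate act g e = g"
  using assms(2,3)
  by (intro bcontfun_eqI) (simp add: apply_translate[where act = act, OF assms(1)] left_action_def)

text \<open>By compactness, joint continuity makes \<open>g (act s' x)\<close> close to
  \<open>g (act s x)\<close> uniformly in \<open>x\<close>, which is closeness in the sup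
  norm.\<close>

lemma continuous_on_translate:
  fixes act :: "'s::topological_space \<Rightarrow> 'x::topological_space \<Rightarrow> 'x"
  assumes comp: "compact (UNIV :: 'x set)" and act: "\<And>s. continuous_on UNIV (act s)"
    and joint: "jointly_continuous act"
  shows "continuous_on UNIV (\<lambda>s. translate act g s)"
  unfolding continuous_on_def
proof (intro ballI tendstoI)
  fix s :: 's and \<epsilon> :: real assume "0 < \<epsilon>"
  have cont: "continuous_on (UNIV \<times> UNIV) (\<lambda>p. apply_bcontfun g (case p of (s, x) \<Rightarrow> act s x))"
    using joint unfolding jointly_continuous_def UNIV_Times_UNIV
    by (intro continuous_on_compose2[OF continuous_on_apply_bcontfun[of UNIV g]]) auto
  obtain U where U: "s \<in> U" "open U"
    "\<forall>s'\<in>U \<inter> UNIV. \<forall>x\<in>UNIV. dist (g (act s' x)) (g (act s x)) \<le> \<epsilon> / 2"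
    by (fact continuous_on_prod_compactE[OF cont comp UNIV_I half_gt_zero[OF \<open>0 < \<epsilon>\<close>], of s, unfolded prod.case])
  have "dist (translate act g s') (translate act g s) < \<epsilon>" if "s' \<in> U" for s'
  proof -
    have "dist (translate act g s') (translate act g s) \<le> \<epsilon> / 2"
      using U(3) that by (intro dist_bound) (simp add: apply_translate[where act = act, OF act])
    then show ?thesis using \<open>0 < \<epsilon>\<close> by linarith
  qed
  then show "\<forall>\<^sub>F s' in at s. dist (translate act g s') (translate act g s) < \<epsilon>"
    using U(1,2) unfolding eventually_at_topological by blast
qed

text \<open>The vectors are functions on \<open>X\<close> themselves: \<open>h s\<close> is
  translation by \<open>s\<close>, \<open>\<alpha> x\<close> is evaluation at \<open>x\<close>, and
  \<open>f\<close> is its own representing vector.\<close>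

lemma Asp_imp_representation:
  fixes act :: "'s::{semigroup_mult,topological_space} \<Rightarrow> 'x::t2_space \<Rightarrow> 'x"
    and f :: "'x \<Rightarrow>\<^sub>C real"
  assumes comp: "compact (UNIV :: 'x set)" and flow: "flow act" and adm: "w_admissible act"
    and f: "f \<in> Asp act"
  obtains V :: "('x \<Rightarrow>\<^sub>C real) set" and N h \<alpha> where "asplund_space V N" "antihomomorphism V N h"
    "weakly_continuous V N h" "jointly_continuous act \<Longrightarrow> strongly_continuous V N h"
    "weak_star_continuous V N \<alpha>" "equivariant act V h \<alpha>" "fragmented V N (range \<alpha>)"
    "f \<in> V" "\<And>x. apply_bcontfun f x = \<alpha> x f"
proof -
  have act: "continuous_on UNIV (act s)" for s using flow by (simp add: flow_def)
  have left: "left_action UNIV act" using flow by (simp add: flow_def)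
  define T where "T s g = translate act g s" for s and g :: "'x \<Rightarrow>\<^sub>C real"
  have T_apply: "apply_bcontfun (T s g) x = g (act s x)" for s g x
    unfolding T_def by (rule apply_translate[where act = act, OF act])
  have T_linear: "linear (T s)" for s
    unfolding T_def by (rule linear_translate[where act = act, OF act])
  have T_norm: "norm (T s g) \<le> norm g" for s g
    unfolding T_def by (rule translate_bound[where act = act, OF act])
  have T_mult: "T (s * t) g = T t (T s g)" for s t g
    unfolding T_def by (simp add: translate_translate[OF act left])
  \<comment> \<open>The scale that brings \<open>M\<close> into the unit ball; the added one keeps
    it positive when \<open>f = 0\<close>.\<close>
  define L where "L = norm f + 1"
  have L: "0 < L" by (simp add: L_def add_nonneg_pos)
  define M where "M = (*\<^sub>R) (inverse L) ` insert f (orbit act f)"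
  have orbit: "orbit act f = range (\<lambda>s. T s f)" by (simp add: orbit_def T_def)
  interpret asplund_interpolation M
  proof
    show "complete (UNIV :: ('x \<Rightarrow>\<^sub>C real) set)" by (rule complete_bcontfun)
    show "asplund_set UNIV norm M"
      unfolding M_def using f by (intro asplund_set_scaleR asplund_set_insert) (simp add: Asp_def)
    fix c assume "c \<in> M"
    then obtain g where g: "c = inverse L *\<^sub>R g" "g \<in> insert f (orbit act f)" by (auto simp: M_def)
    then have "norm g \<le> L" using T_norm[of _ f] by (auto simp: orbit L_def intro: add_increasing2)
    then show "norm c \<le> 1" using L by (simp add: g(1) field_simps)
  qed
  have T_M: "T s ` M \<subseteq> M" for s
  proof -
    have "T s (inverse L *\<^sub>R g) \<in> M" if "g \<in> insert f (orbit act f)" for g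
    proof -
      have "T s g \<in> orbit act f" using that T_mult[symmetric] by (auto simp: orbit)
      then show ?thesis unfolding M_def linear_scale[OF T_linear] by blast
    qed
    then show ?thesis unfolding M_def by blast
  qed
  have T_hull: "T s ` hull_M \<subseteq> hull_M" for s
  proof -
    have "T s ` hull_M = convex hull (T s ` (M \<union> uminus ` M))"
      unfolding hull_M_def by (rule convex_hull_linear_image[OF T_linear])
    also have "T s ` (M \<union> uminus ` M) \<subseteq> M \<union> uminus ` M"
      using T_M[of s] by (auto simp: linear_neg[OF T_linear])
    then have "convex hull (T s ` (M \<union> uminus ` M)) \<subseteq> hull_M" unfolding hull_M_def by (rule hull_mono)
    finally show ?thesis .
  qed
  note contr = T_linear T_norm T_hull
  have inV: "T s v \<in> V" if "v \<in> V" for s v by (rule contraction_in_V[OF contr that])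
  define h where "h s = restr (T s)" for s
  define \<alpha> where "\<alpha> x v = (if v \<in> V then apply_bcontfun v x else 0)" for x v
  have M_V: "M \<subseteq> V" using M_subset_hull_M W_subset_V by blast
  have f_V: "f \<in> V"
  proof -
    have "inverse L *\<^sub>R f \<in> V" using M_V by (auto simp: M_def)
    then have "L *\<^sub>R (inverse L *\<^sub>R f) \<in> V" by (rule subspace_scale[OF subspace_V])
    then show ?thesis using L by simp
  qed
  have \<alpha>_le: "\<bar>apply_bcontfun v x\<bar> \<le> N v" if "v \<in> V" for v x
    using norm_bounded[of v x] norm_le_N[OF that] by simp
  have \<alpha>_dual: "\<alpha> x \<in> dual V N" for x
    unfolding dual_def bounded_ops_def
  proof (intro CollectI conjI ballI allI impI)
    show "\<exists>K. \<forall>v\<in>V. \<bar>\<alpha> x v\<bar> \<le> K * N v" using \<alpha>_le by (intro exI[of _ 1]) (simp add: \<alpha>_def)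
  qed (simp_all add: \<alpha>_def subspace_add[OF subspace_V] subspace_scale[OF subspace_V])
  have "dual_norm V N (\<alpha> x) \<le> 1" for x
    unfolding dual_norm_def
    by (intro op_norm_le[OF normed_on_V]) (use order.trans[OF \<alpha>_le] in \<open>auto simp: \<alpha>_def\<close>)
  moreover have \<alpha>_cont: "continuous_map euclidean (weak_star_topology V N) \<alpha>"
    unfolding weak_star_topology_def
    by (subst continuous_map_initial_topology) (auto simp: \<alpha>_dual o_def \<alpha>_def)
  ultimately have \<alpha>_weak_star: "weak_star_continuous V N \<alpha>"
    using \<alpha>_dual by (auto simp: weak_star_continuous_def dual_ball_def)
  have anti: "antihomomorphism V N h"
    unfolding antihomomorphism_def
  proof (intro conjI allI)
    show "h s \<in> contractions V N" for s unfolding h_def by (rule restr_contraction[OF contr])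
    show "h (s * t) = h t \<circ> h s" for s t
      using inV subspace_0[OF subspace_V] linear_0[OF T_linear]
      by (auto simp: h_def restr_def T_mult fun_eq_iff)
  qed
  have "continuous_map euclidean (weak_topology UNIV norm) (\<lambda>s. T s v)" for v
    using adm by (simp add: w_admissible_def T_def)
  then have weak: "weakly_continuous V N h"
    unfolding h_def by (rule weakly_continuous_restr[OF contr])
  have strong: "strongly_continuous V N h" if "jointly_continuous act"
    unfolding h_def
    by (rule strongly_continuous_restr[OF contr], unfold T_def, rule continuous_on_translate[OF comp act that])
  have equiv: "equivariant act V h \<alpha>"
    by (simp add: equivariant_def h_def restr_def \<alpha>_def inV T_apply)
  have frag: "fragmented V N (range \<alpha>)"
    unfolding fragmented_def
  proof (intro allI impI)
    fix A and \<epsilon> :: real assume A: "A \<subseteq> range \<alpha> \<and> A \<noteq> {} \<and> 0 < \<epsilon>"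
    then have "0 < \<epsilon>" by blast
    \<comment> \<open>The estimate is applied to differences of two evaluations, of norm at most 2,
      on vectors of cost below 2: \<open>n\<close> bounds the remainder by
      \<open>\<epsilon> / 2\<close>, and \<open>\<delta>\<close> then makes the hull part equal to
      \<open>\<epsilon> / 2\<close>.\<close>
    obtain n where "16 / \<epsilon> < 2 ^ n" using real_arch_pow[of 2] by auto
    then have n: "2 / 2 ^ n * 2 \<le> \<epsilon> / 2" using \<open>0 < \<epsilon>\<close> by (simp add: field_simps)
    define \<delta> where "\<delta> = \<epsilon> / (4 * 2 ^ n)"
    have \<delta>: "0 < \<delta>" "2 * 2 ^ n * \<delta> = \<epsilon> / 2" using \<open>0 < \<epsilon>\<close> by (auto simp: \<delta>_def)
    \<comment> \<open>The tree argument runs in \<open>X\<close>, where compactness is available,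
      but its outcome has to be weak-star open. Cutting by a function in \<open>M\<close> stays in
      the class, since evaluation at a vector of \<open>V\<close> is weak-star continuous.\<close>
    define \<U> where "\<U> = {\<alpha> -` U |U. openin (weak_star_topology V N) U}"
    have "\<exists>Q\<in>\<U>. Q \<inter> \<alpha> -` A \<noteq> {} \<and>
        (\<forall>x\<in>Q \<inter> \<alpha> -` A. \<forall>y\<in>Q \<inter> \<alpha> -` A. \<forall>c\<in>M. \<bar>apply_bcontfun c x - c y\<bar> \<le> \<delta>)"
    proof (rule countably_small_imp_fragmented[OF comp])
      show "\<exists>G :: nat \<Rightarrow> 'x set. (\<Union>n. G n) = UNIV \<and>
          (\<forall>n. \<forall>x\<in>G n. \<forall>y\<in>G n. \<forall>c\<in>C. \<bar>apply_bcontfun c x - c y\<bar> < \<epsilon>)"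
        if "countable C" "C \<subseteq> M" "C \<noteq> {}" "0 < \<epsilon>" for C \<epsilon>
        using that by (rule asplund_set_points_small[OF M_asplund])
      have "openin (weak_star_topology V N) (dual V N)"
        using openin_topspace[of "weak_star_topology V N"] by (simp add: topspace_weak_star_topology)
      moreover have "\<alpha> -` dual V N = UNIV" using \<alpha>_dual by blast
      ultimately show "UNIV \<in> \<U>" unfolding \<U>_def by blast
      show "Q \<inter> {z. \<bar>apply_bcontfun c z - t\<bar> < e} \<in> \<U>" if Q: "Q \<in> \<U>" and c: "c \<in> M" for Q c t e
      proof -
        obtain U where U: "openin (weak_star_topology V N) U" "Q = \<alpha> -` U" using Q unfolding \<U>_def by blast
        have cV: "c \<in> V" using c M_V by blast
        have "open {r :: real. \<bar>r - t\<bar> < e}" by (intro open_Collect_less continuous_intros)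
        then have "openin (weak_star_topology V N)
            {\<phi> \<in> topspace (weak_star_topology V N). \<phi> c \<in> {r. \<bar>r - t\<bar> < e}}"
          by (intro openin_continuous_map_preimage[OF continuous_map_weak_star_evaluation[OF cV]])
            (simp only: open_openin)
        then have "openin (weak_star_topology V N) {\<phi> \<in> dual V N. \<phi> c \<in> {r. \<bar>r - t\<bar> < e}}"
          by (simp only: topspace_weak_star_topology)
        then have "openin (weak_star_topology V N) (U \<inter> {\<phi> \<in> dual V N. \<phi> c \<in> {r. \<bar>r - t\<bar> < e}})"
          using U(1) by (intro openin_Int)
        moreover have "Q \<inter> {z. \<bar>apply_bcontfun c z - t\<bar> < e} =
            \<alpha> -` (U \<inter> {\<phi> \<in> dual V N. \<phi> c \<in> {r. \<bar>r - t\<bar> < e}})"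
          using U(2) cV \<alpha>_dual by (auto simp: \<alpha>_def)
        ultimately show ?thesis unfolding \<U>_def by blast
      qed
      show "\<alpha> -` A \<noteq> {}" using A by blast
    qed (rule \<delta>(1))
    then obtain U where U: "openin (weak_star_topology V N) U" "\<alpha> -` U \<inter> \<alpha> -` A \<noteq> {}"
      and small: "\<And>x y c. x \<in> \<alpha> -` U \<inter> \<alpha> -` A \<Longrightarrow> y \<in> \<alpha> -` U \<inter> \<alpha> -` A \<Longrightarrow> c \<in> M \<Longrightarrow>
        \<bar>apply_bcontfun c x - c y\<bar> \<le> \<delta>"
      unfolding \<U>_def by blast
    have "dual_dist V N (\<alpha> x) (\<alpha> y) \<le> \<epsilon>" if xy: "\<alpha> x \<in> U \<inter> A" "\<alpha> y \<in> U \<inter> A" for x y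
    proof (rule dual_dist_le[OF normed_on_V])
      fix v assume v: "v \<in> V" "N v \<le> 1"
      have cost: "cost n v < 2" using cost_le_N[OF v(1), of n] v(2) by linarith
      obtain F where F: "finite F" "F \<subseteq> M" "F \<noteq> {}"
        and est: "\<And>(\<zeta> :: ('x \<Rightarrow>\<^sub>C real) \<Rightarrow> real) b t. linear \<zeta> \<Longrightarrow> (\<And>x. \<bar>\<zeta> x\<bar> \<le> b * norm x) \<Longrightarrow>
          (\<And>c. c \<in> F \<Longrightarrow> \<bar>\<zeta> c\<bar> \<le> t) \<Longrightarrow> 0 \<le> b \<Longrightarrow> 0 \<le> t \<Longrightarrow> \<bar>\<zeta> v\<bar> \<le> 2 * 2 ^ n * t + 2 / 2 ^ n * b"
        by (fact cost_less_estimate[OF cost])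
      have "\<bar>apply_bcontfun v x - v y\<bar> \<le> 2 * 2 ^ n * \<delta> + 2 / 2 ^ n * 2"
      proof (rule est)
        show "linear (\<lambda>v :: 'x \<Rightarrow>\<^sub>C real. apply_bcontfun v x - v y)"
          by (intro bounded_linear.linear bounded_linear_sub bounded_linear_apply_bcontfun)
        show "\<bar>apply_bcontfun g x - g y\<bar> \<le> 2 * norm g" for g :: "'x \<Rightarrow>\<^sub>C real"
          using norm_bounded[of g x] norm_bounded[of g y] unfolding real_norm_def by linarith
        show "\<bar>apply_bcontfun c x - c y\<bar> \<le> \<delta>" if "c \<in> F" for c
          using that F(2) xy by (intro small) auto
      qed (use \<delta>(1) in auto)
      then show "\<bar>\<alpha> x v - \<alpha> y v\<bar> \<le> \<epsilon>" using v(1) n \<delta>(2) by (simp add: \<alpha>_def)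
    qed
    then have "\<forall>\<xi>\<in>U \<inter> A. \<forall>\<eta>\<in>U \<inter> A. dual_dist V N \<xi> \<eta> \<le> \<epsilon>" using A by blast
    moreover have "U \<inter> A \<noteq> {}" using U(2) by blast
    ultimately show "\<exists>U. openin (weak_star_topology V N) U \<and> U \<inter> A \<noteq> {} \<and>
        (\<forall>\<xi>\<in>U \<inter> A. \<forall>\<eta>\<in>U \<inter> A. dual_dist V N \<xi> \<eta> \<le> \<epsilon>)" using U(1) by blast
  qed
  have "apply_bcontfun f x = \<alpha> x f" for x using f_V by (simp add: \<alpha>_def)
  with asplund_space_V anti weak strong \<alpha>_weak_star equiv frag f_V show thesis by (rule that)
qed

text \<open>Evaluations are continuous by the choice of topology on the orbit, translation provides
  the right action, and \<open>Bcontfun\<close> undoes \<open>apply_bcontfun\<close>; both sides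
  therefore ask for the Asplund property of the same set.\<close>

lemma orbit_asplund_duality_iff_Asp:
  fixes act :: "'s::{semigroup_mult,topological_space} \<Rightarrow> 'x::topological_space \<Rightarrow> 'x"
  assumes flow: "flow act"
  shows "orbit_asplund_duality act f \<longleftrightarrow> f \<in> Asp act"
proof -
  have act: "continuous_on UNIV (act s)" for s using flow by (simp add: flow_def)
  have left: "left_action UNIV act" using flow by (simp add: flow_def)
  have top: "topspace (orbit_topology act f) = orbit act f"
    unfolding orbit_topology_def by (rule topspace_initial_topology) simp
  have "continuous_map (orbit_topology act f) (orbit_topology act f) id" by (rule continuous_map_id)
  then have ev: "continuous_map (orbit_topology act f) euclideanreal (\<lambda>y. apply_bcontfun y x)" for x
    unfolding orbit_topology_def by (subst (asm) continuous_map_initial_topology) (auto simp: o_def)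
  have dual: "duality (orbit_topology act f) apply_bcontfun"
    using ev by (simp add: duality_def)
  have "right_action (orbit act f) (translate act)"
    unfolding right_action_def
    using translate_translate[OF act left] translate_identity[OF act left] by (auto simp: orbit_def)
  then have "S_duality act (translate act) (orbit_topology act f) apply_bcontfun"
    using dual left by (simp add: S_duality_def top apply_translate[where act = act, OF act])
  moreover have "\<exists>K. \<forall>y\<in>orbit act f. \<forall>x. \<bar>apply_bcontfun y x\<bar> \<le> K"
    using norm_bounded[of f] by (intro exI[of _ "norm f"])
      (auto simp: orbit_def apply_translate[where act = act, OF act])
  moreover have "(\<lambda>y. Bcontfun (apply_bcontfun y)) ` orbit act f = orbit act f"
    by (simp add: apply_bcontfun_inverse)
  ultimately show ?thesis
    using dual by (simp add: orbit_asplund_duality_def asplund_duality_def top Asp_def)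
qed

theorem theorem7p11:
  fixes act :: "'s::{semigroup_mult,topological_space} \<Rightarrow> 'x::t2_space \<Rightarrow> 'x"
    and f :: "'x \<Rightarrow>\<^sub>C real"
  assumes "semitopological TYPE('s)"
    and "compact (UNIV :: 'x set)"
    and "flow act"
    and "w_admissible act"
  shows
    \<comment> \<open>the equivalences, with \<open>V\<close> in (iii) and (iv) found among the Banach spaces whose vectors
        are elements of \<open>C(X)\<close>\<close>
    "(f \<in> Asp act \<longleftrightarrow> orbit_asplund_duality act f) \<and>
     (f \<in> Asp act \<longleftrightarrow> asplund_representable TYPE('x \<Rightarrow>\<^sub>C real) act f) \<and>
     (f \<in> Asp act \<longleftrightarrow> fragmented_representable TYPE('x \<Rightarrow>\<^sub>C real) act f) \<and>
     (jointly_continuous act \<longrightarrow>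
        (f \<in> Asp act \<longleftrightarrow> strongly_asplund_representable TYPE('x \<Rightarrow>\<^sub>C real) act f)) \<and>
     \<comment> \<open>any Banach space whatsoever, in an arbitrary type \<open>'v\<close>, may witness (iii) or (iv)\<close>
     (asplund_representable TYPE('v::real_vector) act f \<longrightarrow> f \<in> Asp act) \<and>
     (fragmented_representable TYPE('v) act f \<longrightarrow> f \<in> Asp act) \<and>
     (jointly_continuous act \<longrightarrow>
        strongly_asplund_representable TYPE('v) act f \<longrightarrow> f \<in> Asp act)"
proof -
  note comp = assms(2) and flow = assms(3)
  have act: "continuous_on UNIV (act s)" for s using flow by (simp add: flow_def)
  \<comment> \<open>One space of functions on \<open>X\<close> witnesses all three conditions at
    once.\<close>
  have exist: "asplund_representable TYPE('x \<Rightarrow>\<^sub>C real) act f"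
    "fragmented_representable TYPE('x \<Rightarrow>\<^sub>C real) act f"
    "jointly_continuous act \<Longrightarrow> strongly_asplund_representable TYPE('x \<Rightarrow>\<^sub>C real) act f" if f: "f \<in> Asp act"
  proof -
    obtain V :: "('x \<Rightarrow>\<^sub>C real) set" and N h \<alpha> where rep: "asplund_space V N" "antihomomorphism V N h"
      "weakly_continuous V N h" "jointly_continuous act \<Longrightarrow> strongly_continuous V N h"
      "weak_star_continuous V N \<alpha>" "equivariant act V h \<alpha>" "fragmented V N (range \<alpha>)"
      "f \<in> V" "\<And>x. apply_bcontfun f x = \<alpha> x f"
      by (fact Asp_imp_representation[OF comp flow assms(4) f])
    have v: "\<exists>v\<in>V. \<forall>x. apply_bcontfun f x = \<alpha> x v" using rep(8,9) by blast
    show "asplund_representable TYPE('x \<Rightarrow>\<^sub>C real) act f"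
      unfolding asplund_representable_def representation_def using rep(1-3,5,6) v by blast
    show "fragmented_representable TYPE('x \<Rightarrow>\<^sub>C real) act f"
      unfolding fragmented_representable_def
      using rep(1,2,5-7) v unfolding asplund_space_def by blast
    show "strongly_asplund_representable TYPE('x \<Rightarrow>\<^sub>C real) act f" if "jointly_continuous act"
      unfolding strongly_asplund_representable_def using rep(1,2,5,6) rep(4)[OF that] v by blast
  qed
  note iii = asplund_representable_imp_Asp[where act = act and f = f, OF comp act]
    and iii_strong = strongly_asplund_representable_imp_Asp[where act = act and f = f, OF comp act]
    and iv = fragmented_representable_imp_Asp[where act = act and f = f, OF comp act]
  show ?thesis
    using exist orbit_asplund_duality_iff_Asp[OF flow, of f]
      iii[where 'v = 'v] iii[where 'v = "'x \<Rightarrow>\<^sub>C real"]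
      iii_strong[where 'v = 'v] iii_strong[where 'v = "'x \<Rightarrow>\<^sub>C real"]
      iv[where 'v = 'v] iv[where 'v = "'x \<Rightarrow>\<^sub>C real"]
    by blast
qed

end
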